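(* Let $\mathrm{UPIC}$ denote the family of compact subsets of the plane which are finite unions of pairwise disjoint sets $\sigma_m\in\mathrm{PIC}$, $m=1,\dots,M$. Suppose that $\sigma,\tau\in\mathrm{UPIC}$. Then $AC(\sigma)$ is isomorphic to $AC(\tau)$ if and only if $\sigma$ is homeomorphic to $\tau$.
   Context: The plane is identified with $\mathbb{C}$ or $\mathbb{R}^2$. All function algebras are complex-valued. "Isomorphic" means isomorphic as Banach algebras: there is a continuous algebra isomorphism with continuous inverse. **Variation.** Let $\sigma$ be a nonempty compact subset of the plane and $f:\sigma\to\mathbb{C}$. Let $S=[x_0,x_1,\dots,x_n]$ be a finite ordered list of elements of $\sigma$; points may repeat but consecutive points must be different. For $n\ge 1$ put $\mathrm{cvar}(f,S)=\sum_{i=1}^n|f(x_i)-f(x_{i-1})|$. For a line $\ell$ in the plane and $0\le i<n$, the segment $\overline{x_i\,x_{i+1}}$ is a crossing segment of $S$ on $\ell$ if one of the following holds: (i) $x_i$ and $x_{i+1}$ lie on strictly opposite sides of $\ell$; (ii) $i=0$ and $x_0\in\ell$; (iii) $x_i\notin\ell$ and $x_{i+1}\in\ell$. Let $\mathrm{vf}(S,\ell)$ be the number of crossing segments of $S$ on $\ell$ and $\mathrm{vf}(S)=\max_\ell \mathrm{vf}(S,\ell)$. For a one-point list, $\mathrm{cvar}(f,[x_0])=0$ and $\mathrm{vf}([x_0],\ell)=1$ whenever $x_0\in\ell$. The two-dimensional variation is $\mathrm{var}(f,\sigma)=\sup_S \mathrm{cvar}(f,S)/\mathrm{vf}(S)$,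 the supremum being over all finite ordered lists of elements of $\sigma$. Put $\|f\|_{BV(\sigma)}=\|f\|_\infty+\mathrm{var}(f,\sigma)$ and $BV(\sigma)=\{f:\sigma\to\mathbb{C} : \|f\|_{BV(\sigma)}<\infty\}$, which is a Banach algebra under pointwise operations. **Absolutely continuous functions.** $AC(\sigma)$ is the closure in $BV(\sigma)$ of the algebra of restrictions to $\sigma$ of complex polynomials $p(x,y)=\sum_{n,m}c_{nm}x^ny^m$ in two real variables. It is a closed subalgebra of $BV(\sigma)$, hence a Banach algebra. **Polygonally inscribed curves.** A finite length curve $C$ (the image of a continuous one-to-one $\gamma:[0,L]\to\mathbb{R}^2$) is convex if through each point of $C$ there is a supporting line of $C$ (a line through the point such that $C$ lies in one of the two closed half-planes it bounds). A differentiable convex curve is a convex curve with distinct endpoints having a well-defined tangent at every point except possibly its endpoints. A polygon means a simple closed polygon including its interior. A polygonal mosaic is a finite collection $\mathcal{M}$ of convex polygons such that $\bigcup_{P\in\mathcal{M}}P$ is connected and, if $P\ne Q\in\mathcal{M}$ intersect, then $P\cap Q$ is either a single point which is a vertex of both $P$ and $Q$, or a line segment which is a full side of both $P$ and $Q$. A nonempty compact connected set $\sigma$ is a polygonally inscribed curve if there is a polygonal mosaic $\mathcal{M}=\{P_i\}_{i=1}^M$ with $\sigma\subseteq\bigcup_i P_i$ such that for each $i$, $\sigma\cap P_i$ is a differentiable convex curve $c_i$ joining two vertices of $P_i$ which touches the boundary of $P_i$ only at those two points. $\mathrm{PIC}$ denotes the collection of all polygonally inscribed curves. *)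

theory Defs
  imports "HOL-Analysis.Analysis"
begin

text \<open>The plane is the type \<^typ>\<open>complex\<close>; its real inner product is \<open>\<bullet>\<close>. The line with normal
  vector \<open>a \<noteq> 0\<close> and offset \<open>b\<close> is \<open>{z. a \<bullet> z = b}\<close>.\<close>

definition cvar :: "(complex \<Rightarrow> complex) \<Rightarrow> complex list \<Rightarrow> real" where
  "cvar f S = (\<Sum>i<length S - 1. norm (f (S ! Suc i) - f (S ! i)))"

definition strictly_opposite :: "complex \<Rightarrow> real \<Rightarrow> complex \<Rightarrow> complex \<Rightarrow> bool" where
  "strictly_opposite a b x y \<longleftrightarrow> a \<bullet> x < b \<and> b < a \<bullet> y \<or> a \<bullet> y < b \<and> b < a \<bullet> x"

definition crossing :: "complex \<Rightarrow> real \<Rightarrow> complex list \<Rightarrow> nat \<Rightarrow> bool" where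
  "crossing a b S i \<longleftrightarrow>
     strictly_opposite a b (S ! i) (S ! Suc i) \<or>
     i = 0 \<and> a \<bullet> (S ! 0) = b \<or>
     a \<bullet> (S ! i) \<noteq> b \<and> a \<bullet> (S ! Suc i) = b"

definition vf_line :: "complex list \<Rightarrow> complex \<Rightarrow> real \<Rightarrow> nat" where
  "vf_line S a b =
     (if length S = 1 then (if a \<bullet> (S ! 0) = b then 1 else 0)
      else card {i. i < length S - 1 \<and> crossing a b S i})"

definition vf :: "complex list \<Rightarrow> nat" where
  "vf S = Max {vf_line S a b | a b. a \<noteq> 0}"

lemma finite_vf_lines: "finite {vf_line S a b | a b. a \<noteq> 0}"
proof (rule finite_subset)
  have "card {i. i < length S - 1 \<and> crossing a b S i} \<le> length S - 1" for a b
    using card_mono[of "{..<length S - 1}" "{i. i < length S - 1 \<and> crossing a b S i}"] by auto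
  then show "{vf_line S a b | a b. a \<noteq> 0} \<subseteq> {..max 1 (length S - 1)}"
    by (auto simp: vf_line_def le_max_iff_disj)
qed simp

definition admissible_lists :: "complex set \<Rightarrow> complex list set" where
  "admissible_lists \<sigma> = {S. S \<noteq> [] \<and> set S \<subseteq> \<sigma> \<and> distinct_adj S}"

definition var :: "complex set \<Rightarrow> (complex \<Rightarrow> complex) \<Rightarrow> ennreal" where
  "var \<sigma> f = (SUP S\<in>admissible_lists \<sigma>. ennreal (cvar f S / real (vf S)))"

definition BV_norm :: "complex set \<Rightarrow> (complex \<Rightarrow> complex) \<Rightarrow> ennreal" where
  "BV_norm \<sigma> f = (SUP x\<in>\<sigma>. ennreal (norm (f x))) + var \<sigma> f"

text \<open>A function \<open>\<sigma> \<rightarrow> \<complex>\<close> is represented by its extension by zero to the whole plane; this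
  makes the representation unique and commutes with all pointwise algebra operations.\<close>

definition BV :: "complex set \<Rightarrow> (complex \<Rightarrow> complex) set" where
  "BV \<sigma> = {f. (\<forall>z. z \<notin> \<sigma> \<longrightarrow> f z = 0) \<and> BV_norm \<sigma> f < \<infinity>}"

definition BV_dist :: "complex set \<Rightarrow> (complex \<Rightarrow> complex) \<Rightarrow> (complex \<Rightarrow> complex) \<Rightarrow> real" where
  "BV_dist \<sigma> f g = enn2real (BV_norm \<sigma> (\<lambda>z. f z - g z))"

definition BV_topology :: "complex set \<Rightarrow> (complex \<Rightarrow> complex) topology" where
  "BV_topology \<sigma> = Metric_space.mtopology (BV \<sigma>) (BV_dist \<sigma>)"

text \<open>\<open>Metric_space.mtopology\<close> only has its intended meaning when the metric space axioms hold,
  which is established here for every set \<open>\<sigma>\<close>.\<close>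

lemma cvar_triangle: "cvar (\<lambda>z. f z + g z) S \<le> cvar f S + cvar g S"
proof -
  have "norm (f x + g x - (f y + g y)) \<le> norm (f x - f y) + norm (g x - g y)" for x y
    using norm_triangle_ineq[of "f x - f y" "g x - g y"] by (simp add: algebra_simps)
  then show ?thesis
    unfolding cvar_def sum.distrib[symmetric] by (intro sum_mono)
qed

lemma cvar_nonneg: "0 \<le> cvar f S"
  unfolding cvar_def by (intro sum_nonneg) auto

lemma var_triangle: "var \<sigma> (\<lambda>z. f z + g z) \<le> var \<sigma> f + var \<sigma> g"
  unfolding var_def
proof (rule SUP_least)
  fix S assume S: "S \<in> admissible_lists \<sigma>"
  have "ennreal (cvar (\<lambda>z. f z + g z) S / real (vf S))
      \<le> ennreal (cvar f S / real (vf S) + cvar g S / real (vf S))"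
    unfolding add_divide_distrib[symmetric]
    by (intro ennreal_leI divide_right_mono cvar_triangle) auto
  also have "\<dots> = ennreal (cvar f S / real (vf S)) + ennreal (cvar g S / real (vf S))"
    by (intro ennreal_plus) (auto simp: cvar_nonneg)
  also have "\<dots> \<le> (SUP S\<in>admissible_lists \<sigma>. ennreal (cvar f S / real (vf S)))
                + (SUP S\<in>admissible_lists \<sigma>. ennreal (cvar g S / real (vf S)))"
    by (intro add_mono SUP_upper S)
  finally show "ennreal (cvar (\<lambda>z. f z + g z) S / real (vf S)) \<le> \<dots>" .
qed

lemma BV_norm_triangle: "BV_norm \<sigma> (\<lambda>z. f z + g z) \<le> BV_norm \<sigma> f + BV_norm \<sigma> g"
proof -
  have "(SUP x\<in>\<sigma>. ennreal (norm (f x + g x)))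
      \<le> (SUP x\<in>\<sigma>. ennreal (norm (f x))) + (SUP x\<in>\<sigma>. ennreal (norm (g x)))"
  proof (rule SUP_least)
    fix x assume x: "x \<in> \<sigma>"
    have "ennreal (norm (f x + g x)) \<le> ennreal (norm (f x)) + ennreal (norm (g x))"
      by (simp add: norm_triangle_ineq ennreal_leI flip: ennreal_plus)
    also have "\<dots> \<le> (SUP x\<in>\<sigma>. ennreal (norm (f x))) + (SUP x\<in>\<sigma>. ennreal (norm (g x)))"
      by (intro add_mono SUP_upper x)
    finally show "ennreal (norm (f x + g x)) \<le> \<dots>" .
  qed
  from add_mono[OF this var_triangle[of \<sigma> f g]] show ?thesis
    by (simp add: BV_norm_def ac_simps)
qed

lemma BV_norm_uminus: "BV_norm \<sigma> (\<lambda>z. - f z) = BV_norm \<sigma> f"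
proof -
  have "norm (- f x - - f y) = norm (f x - f y)" for x y
    using norm_minus_commute[of "f x" "f y"] by simp
  then show ?thesis by (simp add: BV_norm_def var_def cvar_def)
qed

lemma BV_norm_minus_commute: "BV_norm \<sigma> (\<lambda>z. f z - g z) = BV_norm \<sigma> (\<lambda>z. g z - f z)"
  using BV_norm_uminus[of \<sigma> "\<lambda>z. g z - f z"] by simp

lemma BV_norm_diff_finite:
  assumes "f \<in> BV \<sigma>" "g \<in> BV \<sigma>"
  shows "BV_norm \<sigma> (\<lambda>z. f z - g z) < \<infinity>"
  using BV_norm_triangle[of \<sigma> f "\<lambda>z. - g z"] assms
  by (auto simp: BV_def BV_norm_uminus intro: le_less_trans)

lemma Metric_space_BV: "Metric_space (BV \<sigma>) (BV_dist \<sigma>)"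
proof
  fix f g h
  show "0 \<le> BV_dist \<sigma> f g" by (simp add: BV_dist_def)
  show "BV_dist \<sigma> f g = BV_dist \<sigma> g f"
    by (simp add: BV_dist_def BV_norm_minus_commute[of \<sigma> f])
  assume f: "f \<in> BV \<sigma>" and g: "g \<in> BV \<sigma>"
  show "BV_dist \<sigma> f g = 0 \<longleftrightarrow> f = g"
  proof
    assume "f = g"
    then show "BV_dist \<sigma> f g = 0"
      by (simp add: BV_dist_def BV_norm_def var_def cvar_def image_constant_conv bot_ennreal)
  next
    assume "BV_dist \<sigma> f g = 0"
    with BV_norm_diff_finite[OF f g] have "BV_norm \<sigma> (\<lambda>z. f z - g z) = 0"
      by (auto simp: BV_dist_def enn2real_eq_0_iff)
    then have s: "(SUP x\<in>\<sigma>. ennreal (norm (f x - g x))) = 0"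
      by (simp add: BV_norm_def)
    have "f x = g x" if "x \<in> \<sigma>" for x
      using SUP_upper[OF that, of "\<lambda>x. ennreal (norm (f x - g x))"] s by simp
    moreover have "f x = g x" if "x \<notin> \<sigma>" for x
      using f g that by (simp add: BV_def)
    ultimately show "f = g" by blast
  qed
  assume h: "h \<in> BV \<sigma>"
  have "BV_norm \<sigma> (\<lambda>z. f z - h z) \<le> BV_norm \<sigma> (\<lambda>z. f z - g z) + BV_norm \<sigma> (\<lambda>z. g z - h z)"
    using BV_norm_triangle[of \<sigma> "\<lambda>z. f z - g z" "\<lambda>z. g z - h z"] by simp
  then have "enn2real (BV_norm \<sigma> (\<lambda>z. f z - h z))
      \<le> enn2real (BV_norm \<sigma> (\<lambda>z. f z - g z) + BV_norm \<sigma> (\<lambda>z. g z - h z))"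
    using BV_norm_diff_finite[OF f g] BV_norm_diff_finite[OF g h]
    by (intro enn2real_mono) auto
  also have "\<dots> = BV_dist \<sigma> f g + BV_dist \<sigma> g h"
    using BV_norm_diff_finite[OF f g] BV_norm_diff_finite[OF g h]
    by (simp add: BV_dist_def enn2real_plus)
  finally show "BV_dist \<sigma> f h \<le> BV_dist \<sigma> f g + BV_dist \<sigma> g h"
    by (simp add: BV_dist_def)
qed

definition poly_restrictions :: "complex set \<Rightarrow> (complex \<Rightarrow> complex) set" where
  "poly_restrictions \<sigma> =
     {\<lambda>z. if z \<in> \<sigma>
          then (\<Sum>n\<le>N. \<Sum>m\<le>N. c n m * of_real (Re z) ^ n * of_real (Im z) ^ m)
          else 0 | (c :: nat \<Rightarrow> nat \<Rightarrow> complex) (N :: nat). True}"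

definition AC :: "complex set \<Rightarrow> (complex \<Rightarrow> complex) set" where
  "AC \<sigma> = BV_topology \<sigma> closure_of poly_restrictions \<sigma>"

definition AC_topology :: "complex set \<Rightarrow> (complex \<Rightarrow> complex) topology" where
  "AC_topology \<sigma> = subtopology (BV_topology \<sigma>) (AC \<sigma>)"

definition AC_isomorphic :: "complex set \<Rightarrow> complex set \<Rightarrow> bool" where
  "AC_isomorphic \<sigma> \<tau> \<longleftrightarrow>
     (\<exists>\<Phi>. homeomorphic_map (AC_topology \<sigma>) (AC_topology \<tau>) \<Phi> \<and>
          (\<forall>f\<in>AC \<sigma>. \<forall>g\<in>AC \<sigma>. \<Phi> (\<lambda>z. f z + g z) = (\<lambda>z. \<Phi> f z + \<Phi> g z)) \<and>
          (\<forall>f\<in>AC \<sigma>. \<forall>g\<in>AC \<sigma>. \<Phi> (\<lambda>z. f z * g z) = (\<lambda>z. \<Phi> f z * \<Phi> g z)) \<and>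
          (\<forall>c. \<forall>f\<in>AC \<sigma>. \<Phi> (\<lambda>z. c * f z) = (\<lambda>z. c * \<Phi> f z)))"

definition finite_length :: "(real \<Rightarrow> complex) \<Rightarrow> bool" where
  "finite_length \<gamma> \<longleftrightarrow>
     (\<exists>B. \<forall>ts. sorted ts \<and> set ts \<subseteq> {0..1} \<longrightarrow>
        (\<Sum>i<length ts - 1. dist (\<gamma> (ts ! i)) (\<gamma> (ts ! Suc i))) \<le> B)"

definition convex_set_curve :: "complex set \<Rightarrow> bool" where
  "convex_set_curve C \<longleftrightarrow>
     (\<forall>p\<in>C. \<exists>a b. a \<noteq> 0 \<and> a \<bullet> p = b \<and> (C \<subseteq> {z. a \<bullet> z \<le> b} \<or> C \<subseteq> {z. a \<bullet> z \<ge> b}))"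

text \<open>The tangent direction at \<open>\<gamma> t\<close> is the limit of the normalised secant directions, oriented
  along \<open>\<gamma>\<close>. This does not depend on the parametrisation, so no differentiability or speed
  condition is imposed on \<open>\<gamma>\<close> itself. Nor is anything lost by parametrising over \<open>[0,1]\<close>.\<close>

definition has_tangent_at :: "(real \<Rightarrow> complex) \<Rightarrow> real \<Rightarrow> bool" where
  "has_tangent_at \<gamma> t \<longleftrightarrow>
     (\<exists>u. ((\<lambda>s. sgn ((\<gamma> s - \<gamma> t) /\<^sub>R (s - t))) \<longlongrightarrow> u) (at t within {0..1}))"

definition differentiable_convex_curve :: "(real \<Rightarrow> complex) \<Rightarrow> bool" where
  "differentiable_convex_curve \<gamma> \<longleftrightarrow>
     arc \<gamma> \<and> finite_length \<gamma> \<and> convex_set_curve (path_image \<gamma>) \<and>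
     (\<forall>t\<in>{0<..<1}. has_tangent_at \<gamma> t)"

text \<open>A convex polygon with its interior is a two-dimensional polytope; its vertices are its
  extreme points and its sides are its edges.\<close>

definition convex_polygon :: "complex set \<Rightarrow> bool" where
  "convex_polygon P \<longleftrightarrow> polytope P \<and> aff_dim P = 2"

definition polygonal_mosaic :: "complex set set \<Rightarrow> bool" where
  "polygonal_mosaic \<M> \<longleftrightarrow>
     finite \<M> \<and> (\<forall>P\<in>\<M>. convex_polygon P) \<and> connected (\<Union>\<M>) \<and>
     (\<forall>P\<in>\<M>. \<forall>Q\<in>\<M>. P \<noteq> Q \<and> P \<inter> Q \<noteq> {} \<longrightarrow>
        (\<exists>v. P \<inter> Q = {v} \<and> v extreme_point_of P \<and> v extreme_point_of Q) \<or>
        (P \<inter> Q) edge_of P \<and> (P \<inter> Q) edge_of Q)"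

definition PIC :: "complex set set" where
  "PIC = {\<sigma>. \<sigma> \<noteq> {} \<and> compact \<sigma> \<and> connected \<sigma> \<and>
     (\<exists>\<M>. polygonal_mosaic \<M> \<and> \<sigma> \<subseteq> \<Union>\<M> \<and>
        (\<forall>P\<in>\<M>. \<exists>\<gamma>. differentiable_convex_curve \<gamma> \<and> path_image \<gamma> = \<sigma> \<inter> P \<and>
           pathstart \<gamma> extreme_point_of P \<and> pathfinish \<gamma> extreme_point_of P \<and>
           path_image \<gamma> \<inter> frontier P = {pathstart \<gamma>, pathfinish \<gamma>}))}"

definition UPIC :: "complex set set" where
  "UPIC = {\<Union>\<C> | \<C>. finite \<C> \<and> \<C> \<noteq> {} \<and> \<C> \<subseteq> PIC \<and> disjoint \<C>}"

end

theory Submission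
  imports Defs "HOL-Computational_Algebra.Polynomial"
begin

text \<open>One direction is Gelfand theory. For any nonempty compact plane set \<open>\<sigma>\<close>, every nonzero character
  of the algebra \<open>AC \<sigma>\<close> is evaluation at a point (\<open>character_is_evaluation\<close>): otherwise compactness
  produces a finite sum of functions \<open>|g|\<^sup>2\<close> that lies in the kernel and has no zero, although
  positive functions in \<open>AC \<sigma>\<close> are invertible there. An isomorphism therefore is composition with a
  map of the underlying sets, and this map is a homeomorphism
  (\<open>compact_homeomorphic_if_AC_isomorphic\<close>).

  For the converse one replaces a given homeomorphism by a better one. A set in \<open>UPIC\<close> can be cut at
  finitely many points into pieces on which some linear functional is injective; each piece is then
  the graph of a convex or concave function over that functional and carries an affine parameter
  \<open>t \<in> {0..1}\<close>, a \<open>chart\<close>. If the cut points of the two sets correspond under the given homeomorphism,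
  so do the pieces, and one maps each piece to its partner by equality of parameters. That this new
  bijection induces an isomorphism rests on two facts about a set covered by charts.

  \<^item> The two-dimensional variation is comparable with the largest one-dimensional variation of the
    function along the charts (\<open>var_le_chart\<close> and \<open>var_le_piecewise\<close>). One inequality
    holds because a line meets a convex graph in at most two crossings. For the other, the steps of a
    list inside one piece overlap at each parameter value at most \<open>vf\<close> times, and a step between
    different pieces changes sides of one of finitely many lines. Such lines exist: boundary lines of
    half-planes that intersect in the polygons, normals to the tangents at the cut points, and lines
    separating disjoint compact pieces.

  \<^item> A function belongs to \<open>AC\<close> as soon as it is, along each chart, a limit in variation of
    polynomials of the parameter (\<open>approx_piecewise\<close>). A polynomial that interpolates at the cut points
    reduces this to functions vanishing at the ends of one piece, and these are limits of functions
    vanishing near the ends, where a C1 cutoff separates the piece from the rest of the set.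

  By the second fact it is enough that the two coordinates of the partner point are limits of
  polynomials in the parameter, that is, that a continuous convex function on an interval is such a
  limit. Its sliding means are C1, and the difference from a sliding mean is monotone and uniformly
  small (\<open>unit_interval_approx_convex_right\<close>). The decomposition into graphs holds because a convex
  arc meets each line parallel to the imaginary axis at most twice, unless the line supports the arc
  (\<open>convex_arc_cuttable\<close>).\<close>

section \<open>Variation along lists of points\<close>

definition tvar :: "('a \<Rightarrow> complex) \<Rightarrow> 'a list \<Rightarrow> real" where
  "tvar f S = (\<Sum>i<length S - 1. norm (f (S ! Suc i) - f (S ! i)))"

lemma cvar_eq_tvar: "cvar = tvar"
  by (simp add: fun_eq_iff cvar_def tvar_def)

lemma tvar_map: "tvar f (map g S) = tvar (\<lambda>x. f (g x)) S"
  unfolding tvar_def by (intro sum.cong) auto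

lemma tvar_mono_dominated:
  assumes "\<And>x y. x \<in> set S \<Longrightarrow> y \<in> set S \<Longrightarrow> norm (g x - g y) \<le> L * norm (f x - f y)"
  shows "tvar g S \<le> L * tvar f S"
  unfolding tvar_def sum_distrib_left
  by (intro sum_mono assms) auto

lemma tvar_add: "tvar (\<lambda>x. f x + g x) S \<le> tvar f S + tvar g S"
proof -
  have "norm (f x + g x - (f y + g y)) \<le> norm (f x - f y) + norm (g x - g y)" for x y
    using norm_triangle_ineq[of "f x - f y" "g x - g y"] by (simp add: algebra_simps)
  then show ?thesis
    unfolding tvar_def sum.distrib[symmetric] by (intro sum_mono)
qed

lemma tvar_mult:
  assumes f: "\<And>x. x \<in> set S \<Longrightarrow> norm (f x) \<le> A" and g: "\<And>x. x \<in> set S \<Longrightarrow> norm (g x) \<le> B"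
  shows "tvar (\<lambda>x. f x * g x) S \<le> A * tvar g S + B * tvar f S"
proof -
  have "norm (f x * g x - f y * g y) \<le> A * norm (g x - g y) + B * norm (f x - f y)"
    if "x \<in> set S" "y \<in> set S" for x y
  proof -
    have "f x * g x - f y * g y = f x * (g x - g y) + g y * (f x - f y)" by (simp add: algebra_simps)
    also have "norm \<dots> \<le> norm (f x) * norm (g x - g y) + norm (g y) * norm (f x - f y)"
      by (metis norm_mult norm_triangle_ineq)
    also have "\<dots> \<le> A * norm (g x - g y) + B * norm (f x - f y)"
      using that by (intro add_mono mult_right_mono f g) auto
    finally show ?thesis .
  qed
  then show ?thesis
    unfolding tvar_def sum_distrib_left sum.distrib[symmetric] by (intro sum_mono) auto
qed

text \<open>Each increment \<open>\<phi> (t i) - \<phi> (s i)\<close> is a sum over the elementary intervals between consecutive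
  endpoints, and no elementary interval is used more than \<open>k\<close> times. In the applications the numbers
  \<open>s i\<close>, \<open>t i\<close> are the values of a linear functional along a list, and \<open>k\<close> is its variation factor.\<close>

lemma overlapping_increments:
  fixes \<phi> :: "real \<Rightarrow> complex" and s t :: "'i \<Rightarrow> real"
  assumes fin: "finite I"
    and st: "\<And>i. i \<in> I \<Longrightarrow> s i \<in> {a..b} \<and> t i \<in> {a..b}"
    and var: "\<And>ts. sorted_wrt (<) ts \<Longrightarrow> set ts \<subseteq> {a..b} \<Longrightarrow> tvar \<phi> ts \<le> K"
    and mult: "\<And>c. card {i \<in> I. s i < c \<and> c < t i \<or> t i < c \<and> c < s i} \<le> k"
  shows "(\<Sum>i\<in>I. norm (\<phi> (t i) - \<phi> (s i))) \<le> K * real k"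
proof -
  define es where "es = sorted_list_of_set (s ` I \<union> t ` I)"
  define d where "d m = norm (\<phi> (es ! Suc m) - \<phi> (es ! m))" for m
  define cov where "cov i = {m. m < length es - 1 \<and> min (s i) (t i) \<le> es ! m \<and> es ! Suc m \<le> max (s i) (t i)}" for i
  have set_es: "set es = s ` I \<union> t ` I" using fin by (simp add: es_def)
  have srt: "sorted_wrt (<) es" by (simp add: es_def)
  have nth_mono: "es ! i < es ! j" if "i < j" "j < length es" for i j
    using sorted_wrt_nth_less[OF srt that] .
  have tele: "norm (\<phi> (es ! q) - \<phi> (es ! p)) \<le> (\<Sum>m\<in>{p..<q}. d m)" if "p \<le> q" for p q
  proof -
    have "\<phi> (es ! q) - \<phi> (es ! p) = (\<Sum>m\<in>{p..<q}. \<phi> (es ! Suc m) - \<phi> (es ! m))"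
      using sum_Suc_diff'[OF that, of "\<lambda>m. \<phi> (es ! m)"] by simp
    then show ?thesis unfolding d_def by (simp add: norm_sum)
  qed
  have ordered: "norm (\<phi> (es ! q) - \<phi> (es ! p)) \<le> (\<Sum>m\<in>{m. m < length es - 1 \<and> es ! p \<le> es ! m \<and> es ! Suc m \<le> es ! q}. d m)"
    if "p \<le> q" "q < length es" for p q
  proof (rule order_trans[OF tele[OF that(1)]], rule sum_mono2)
    show "{p..<q} \<subseteq> {m. m < length es - 1 \<and> es ! p \<le> es ! m \<and> es ! Suc m \<le> es ! q}"
    proof
      fix m assume m: "m \<in> {p..<q}"
      have "es ! p \<le> es ! m" using nth_mono[of p m] m that by (cases "p = m") auto
      moreover have "es ! Suc m \<le> es ! q" using nth_mono[of "Suc m" q] m that by (cases "Suc m = q") auto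
      ultimately show "m \<in> {m. m < length es - 1 \<and> es ! p \<le> es ! m \<and> es ! Suc m \<le> es ! q}"
        using m that by auto
    qed
  qed (auto simp: d_def)
  have step: "norm (\<phi> (t i) - \<phi> (s i)) \<le> (\<Sum>m\<in>cov i. d m)" if "i \<in> I" for i
  proof -
    have "s i \<in> set es" "t i \<in> set es" using that unfolding set_es by auto
    then obtain p q where p: "p < length es" "es ! p = s i" and q: "q < length es" "es ! q = t i"
      unfolding in_set_conv_nth by blast
    show ?thesis
    proof (cases "p \<le> q")
      case True
      then have "s i \<le> t i" using nth_mono[of p q] p q by (cases "p = q") auto
      with ordered[OF True q(1)] show ?thesis
        by (simp add: p q cov_def min_def max_def)
    next
      case False
      then have qp: "q \<le> p" by simp
      have "t i < s i" using nth_mono[of q p] p q False by auto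
      with ordered[OF qp p(1)] show ?thesis
        by (simp add: p q cov_def min_def max_def norm_minus_commute)
    qed
  qed
  have covcard: "card {i \<in> I. m \<in> cov i} \<le> k" if "m < length es - 1" for m
  proof -
    \<comment> \<open>an increment that covers an elementary interval passes over its midpoint\<close>
    let ?c = "(es ! m + es ! Suc m) / 2"
    have lt: "es ! m < es ! Suc m" using that by (intro nth_mono) auto
    have "{i \<in> I. m \<in> cov i} \<subseteq> {i \<in> I. s i < ?c \<and> ?c < t i \<or> t i < ?c \<and> ?c < s i}"
      using lt by (auto simp: cov_def min_def max_def split: if_splits)
    then have "card {i \<in> I. m \<in> cov i} \<le> card {i \<in> I. s i < ?c \<and> ?c < t i \<or> t i < ?c \<and> ?c < s i}"
      using fin by (intro card_mono) auto
    also have "\<dots> \<le> k" by (rule mult)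
    finally show ?thesis .
  qed
  have "(\<Sum>i\<in>I. norm (\<phi> (t i) - \<phi> (s i))) \<le> (\<Sum>i\<in>I. \<Sum>m\<in>cov i. d m)"
    by (intro sum_mono step)
  also have "\<dots> = (\<Sum>i\<in>I. \<Sum>m<length es - 1. if m \<in> cov i then d m else 0)"
  proof (rule sum.cong[OF refl])
    fix i
    have "cov i = {..<length es - 1} \<inter> cov i" by (auto simp: cov_def)
    then show "(\<Sum>m\<in>cov i. d m) = (\<Sum>m<length es - 1. if m \<in> cov i then d m else 0)"
      using sum.inter_restrict[of "{..<length es - 1}" d "cov i"] by simp
  qed
  also have "\<dots> = (\<Sum>m<length es - 1. \<Sum>i\<in>I. if m \<in> cov i then d m else 0)"
    by (rule sum.swap)
  also have "\<dots> = (\<Sum>m<length es - 1. d m * real (card {i \<in> I. m \<in> cov i}))"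
    using fin by (intro sum.cong refl) (simp add: sum.inter_filter[symmetric])
  also have "\<dots> \<le> (\<Sum>m<length es - 1. d m * real k)"
    using covcard by (intro sum_mono mult_left_mono) (auto simp: d_def)
  also have "\<dots> = tvar \<phi> es * real k" by (simp add: tvar_def d_def sum_distrib_right)
  also have "\<dots> \<le> K * real k"
    using st set_es by (intro mult_right_mono var srt) auto
  finally show ?thesis .
qed

lemma tvar_monotone:
  fixes \<phi> :: "real \<Rightarrow> real"
  assumes mono: "\<And>x y. a \<le> x \<Longrightarrow> x \<le> y \<Longrightarrow> y \<le> b \<Longrightarrow> \<phi> x \<le> \<phi> y"
    and ts: "sorted_wrt (<) ts" "set ts \<subseteq> {a..b}" and ab: "a \<le> b"
  shows "tvar (\<lambda>x. of_real (\<phi> x)) ts \<le> \<phi> b - \<phi> a"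
proof (cases "ts = []")
  case True then show ?thesis using mono ab by (simp add: tvar_def)
next
  case False
  have in_ab: "ts ! i \<in> {a..b}" if "i < length ts" for i using ts that nth_mem by blast
  have le: "ts ! i \<le> ts ! Suc i" if "i < length ts - 1" for i
    using sorted_wrt_nth_less[OF ts(1), of i "Suc i"] that by (simp add: less_diff_conv less_imp_le)
  have "tvar (\<lambda>x. of_real (\<phi> x)) ts = (\<Sum>i<length ts - 1. \<phi> (ts ! Suc i) - \<phi> (ts ! i))"
    unfolding tvar_def
  proof (intro sum.cong refl)
    fix i assume i: "i \<in> {..<length ts - 1}"
    have "\<phi> (ts ! i) \<le> \<phi> (ts ! Suc i)" using in_ab[of i] in_ab[of "Suc i"] le i by (intro mono) auto
    then show "norm (complex_of_real (\<phi> (ts ! Suc i)) - of_real (\<phi> (ts ! i))) = \<phi> (ts ! Suc i) - \<phi> (ts ! i)"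
      by (metis abs_of_nonneg diff_ge_0_iff_ge norm_of_real of_real_diff)
  qed
  also have "\<dots> = \<phi> (ts ! (length ts - 1)) - \<phi> (ts ! 0)"
    by (rule sum_lessThan_telescope)
  also have "\<dots> \<le> \<phi> b - \<phi> a"
    using mono[of "ts ! (length ts - 1)" b] mono[of a "ts ! 0"] in_ab[of 0] in_ab[of "length ts - 1"] False ab
    by fastforce
  finally show ?thesis .
qed

lemma vf_line_le_vf: "a \<noteq> 0 \<Longrightarrow> vf_line S a b \<le> vf S"
  unfolding vf_def by (intro Max_ge finite_vf_lines) auto

text \<open>A line through the first point is crossed. Hence the quotients in the definition of \<^const>\<open>var\<close>
  never have the denominator 0.\<close>

lemma vf_pos:
  assumes "S \<noteq> []" shows "1 \<le> vf S"
proof -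
  have "1 \<le> vf_line S 1 (1 \<bullet> (S ! 0))"
  proof (cases "length S = 1")
    case True then show ?thesis by (simp add: vf_line_def)
  next
    case False
    then have "length S - 1 > 0" using assms by (cases S) auto
    then have "{0} \<subseteq> {i. i < length S - 1 \<and> crossing 1 (1 \<bullet> (S ! 0)) S i}"
      by (auto simp: crossing_def)
    then have "card {0::nat} \<le> card {i. i < length S - 1 \<and> crossing 1 (1 \<bullet> (S ! 0)) S i}"
      by (intro card_mono) auto
    with False show ?thesis by (simp add: vf_line_def)
  qed
  also have "\<dots> \<le> vf S" by (rule vf_line_le_vf) simp
  finally show ?thesis .
qed

text \<open>This is how the variation factor is used below: it bounds the number of steps over a line.\<close>

lemma card_strictly_opposite_le_vf:
  assumes "a \<noteq> 0"
  shows "card {i. i < length S - 1 \<and> strictly_opposite a b (S ! i) (S ! Suc i)} \<le> vf S"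
proof (cases "length S = 1")
  case False
  have "card {i. i < length S - 1 \<and> strictly_opposite a b (S ! i) (S ! Suc i)} \<le> vf_line S a b"
    using False by (auto simp: vf_line_def crossing_def intro!: card_mono)
  also have "\<dots> \<le> vf S" by (rule vf_line_le_vf[OF assms])
  finally show ?thesis .
qed auto

text \<open>Two instances are needed: lists in a plane set, weighted by the variation factor, and increasing
  lists in the unit interval with weight 1. The basic estimates are the same for both.\<close>

locale weighted_lists =
  fixes X :: "'a set" and \<S> :: "('a list \<times> nat) set"
  assumes X_nonempty: "X \<noteq> {}"
    and lists_in: "(S, w) \<in> \<S> \<Longrightarrow> set S \<subseteq> X"
begin

definition var_le :: "('a \<Rightarrow> complex) \<Rightarrow> real \<Rightarrow> bool" where
  "var_le f K \<longleftrightarrow> (\<forall>x\<in>X. norm (f x) \<le> K) \<and> (\<forall>(S, w)\<in>\<S>. tvar f S \<le> K * real w)"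

lemma var_leI:
  assumes "\<And>x. x \<in> X \<Longrightarrow> norm (f x) \<le> K" "\<And>S w. (S, w) \<in> \<S> \<Longrightarrow> tvar f S \<le> K * real w"
  shows "var_le f K"
  using assms unfolding var_le_def by auto

lemma var_leD:
  assumes "var_le f K"
  shows "x \<in> X \<Longrightarrow> norm (f x) \<le> K" "(S, w) \<in> \<S> \<Longrightarrow> tvar f S \<le> K * real w"
  using assms unfolding var_le_def by auto

lemma var_le_nonneg: "var_le f K \<Longrightarrow> 0 \<le> K"
  using X_nonempty unfolding var_le_def by (metis ex_in_conv norm_ge_zero order_trans)

lemma var_le_cong:
  assumes "\<And>x. x \<in> X \<Longrightarrow> f x = g x"
  shows "var_le f K \<longleftrightarrow> var_le g K"
proof -
  have "tvar f S = tvar g S" if "(S, w) \<in> \<S>" for S w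
    unfolding tvar_def using lists_in[OF that] assms by (intro sum.cong refl) (auto simp: subset_iff)
  with assms show ?thesis unfolding var_le_def by (intro conj_cong ball_cong refl) auto
qed

lemma var_le_mono: "var_le f K \<Longrightarrow> K \<le> L \<Longrightarrow> var_le f L"
  unfolding var_le_def by (fastforce intro: order_trans mult_right_mono)

lemma var_le_const: "var_le (\<lambda>_. c) (norm c)"
  by (auto simp: var_le_def tvar_def)

text \<open>A Lipschitz function of \<open>f\<close> has variation at most the Lipschitz constant times that of \<open>f\<close>; stated
  through differences, it covers changes between real and complex values.\<close>

lemma var_le_dominated:
  assumes f: "var_le f K" and L: "0 \<le> L"
    and d: "\<And>x y. x \<in> X \<Longrightarrow> y \<in> X \<Longrightarrow> norm (g x - g y) \<le> L * norm (f x - f y)"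
    and M: "\<And>x. x \<in> X \<Longrightarrow> norm (g x) \<le> M" "0 \<le> M"
  shows "var_le g (M + L * K)"
proof (rule var_leI)
  fix x assume "x \<in> X"
  then show "norm (g x) \<le> M + L * K"
    using M(1)[of x] mult_nonneg_nonneg[OF L var_le_nonneg[OF f]] by linarith
next
  fix S w assume S: "(S, w) \<in> \<S>"
  have "tvar g S \<le> L * tvar f S"
    using lists_in[OF S] by (intro tvar_mono_dominated d) auto
  also have "\<dots> \<le> L * (K * real w)"
    using var_leD(2)[OF f S] L by (rule mult_left_mono)
  also have "\<dots> \<le> (M + L * K) * real w"
    using \<open>0 \<le> M\<close> by (simp add: algebra_simps)
  finally show "tvar g S \<le> (M + L * K) * real w" .
qed

lemma var_le_uminus:
  assumes "var_le f K" shows "var_le (\<lambda>x. - f x) K"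
proof -
  have "tvar (\<lambda>x. - f x) S = tvar f S" for S
    unfolding tvar_def minus_diff_minus norm_minus_cancel ..
  with assms show ?thesis by (simp add: var_le_def)
qed

lemma var_le_add:
  assumes "var_le f K" "var_le g L"
  shows "var_le (\<lambda>x. f x + g x) (K + L)"
proof (rule var_leI)
  fix x assume "x \<in> X"
  then show "norm (f x + g x) \<le> K + L"
    using var_leD(1)[OF assms(1)] var_leD(1)[OF assms(2)] by (meson add_mono norm_triangle_le)
next
  fix S w assume S: "(S, w) \<in> \<S>"
  then show "tvar (\<lambda>x. f x + g x) S \<le> (K + L) * real w"
    using tvar_add[of f g S] var_leD(2)[OF assms(1)] var_leD(2)[OF assms(2)]
    by (fastforce simp: algebra_simps)
qed

lemma var_le_mult:
  assumes "var_le f K" "var_le g L"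
  shows "var_le (\<lambda>x. f x * g x) (2 * K * L)"
proof (rule var_leI)
  have KL: "0 \<le> K" "0 \<le> L" using assms var_le_nonneg by auto
  fix x assume "x \<in> X"
  then have "norm (f x * g x) \<le> K * L"
    using var_leD(1)[OF assms(1)] var_leD(1)[OF assms(2)] KL by (simp add: norm_mult mult_mono)
  then show "norm (f x * g x) \<le> 2 * K * L" using mult_nonneg_nonneg[OF KL] by linarith
next
  have KL: "0 \<le> K" "0 \<le> L" using assms var_le_nonneg by auto
  fix S w assume S: "(S, w) \<in> \<S>"
  have "tvar (\<lambda>x. f x * g x) S \<le> K * tvar g S + L * tvar f S"
    using lists_in[OF S] var_leD(1)[OF assms(1)] var_leD(1)[OF assms(2)] by (intro tvar_mult) auto
  also have "\<dots> \<le> K * (L * real w) + L * (K * real w)"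
    using KL var_leD(2)[OF assms(1) S] var_leD(2)[OF assms(2) S] by (intro add_mono mult_left_mono) auto
  finally show "tvar (\<lambda>x. f x * g x) S \<le> 2 * K * L * real w" by (simp add: algebra_simps)
qed

end

text \<open>\<open>P\<close> is an algebra of functions of bounded variation, polynomials in both instances, and \<open>approx\<close>
  below is membership in its closure.\<close>

locale function_algebra_closure = weighted_lists X \<S> for X :: "'a set" and \<S> +
  fixes P :: "('a \<Rightarrow> complex) set"
  assumes P_const: "(\<lambda>_. c) \<in> P"
    and P_add: "f \<in> P \<Longrightarrow> g \<in> P \<Longrightarrow> (\<lambda>x. f x + g x) \<in> P"
    and P_mult: "f \<in> P \<Longrightarrow> g \<in> P \<Longrightarrow> (\<lambda>x. f x * g x) \<in> P"
    and P_var: "f \<in> P \<Longrightarrow> \<exists>K. var_le f K"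
begin

definition approx :: "('a \<Rightarrow> complex) \<Rightarrow> bool" where
  "approx f \<longleftrightarrow> (\<forall>\<epsilon>>0. \<exists>p\<in>P. var_le (\<lambda>x. f x - p x) \<epsilon>)"

lemma approx_cong:
  assumes "\<And>x. x \<in> X \<Longrightarrow> f x = g x"
  shows "approx f \<longleftrightarrow> approx g"
  using var_le_cong[of "\<lambda>x. f x - p x" "\<lambda>x. g x - p x" for p] assms unfolding approx_def by simp

lemma approx_P: "f \<in> P \<Longrightarrow> approx f"
  unfolding approx_def using var_le_mono[OF var_le_const[of 0]] by (auto intro!: bexI[of _ f])

lemma approx_const: "approx (\<lambda>_. c)"
  by (rule approx_P[OF P_const])

lemma approx_var:
  assumes "approx f" shows "\<exists>K. var_le f K"
proof -
  obtain p where p: "p \<in> P" "var_le (\<lambda>x. f x - p x) 1" using assms unfolding approx_def by (meson zero_less_one)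
  obtain K where "var_le p K" using P_var[OF p(1)] by blast
  from var_le_add[OF p(2) this] show ?thesis by auto
qed

lemma approx_closed:
  assumes "\<And>\<epsilon>. \<epsilon> > 0 \<Longrightarrow> \<exists>g. approx g \<and> var_le (\<lambda>x. f x - g x) \<epsilon>"
  shows "approx f"
  unfolding approx_def
proof (intro allI impI)
  fix \<epsilon> :: real assume "\<epsilon> > 0"
  then obtain g where g: "approx g" "var_le (\<lambda>x. f x - g x) (\<epsilon> / 2)" using assms[of "\<epsilon> / 2"] by auto
  then obtain p where p: "p \<in> P" "var_le (\<lambda>x. g x - p x) (\<epsilon> / 2)"
    using \<open>\<epsilon> > 0\<close> unfolding approx_def by (meson half_gt_zero)
  from var_le_add[OF g(2) p(2)] p(1) show "\<exists>p\<in>P. var_le (\<lambda>x. f x - p x) \<epsilon>" by auto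
qed

lemma approx_add:
  assumes "approx f" "approx g" shows "approx (\<lambda>x. f x + g x)"
  unfolding approx_def
proof (intro allI impI)
  fix \<epsilon> :: real assume "\<epsilon> > 0"
  then obtain p q where p: "p \<in> P" "var_le (\<lambda>x. f x - p x) (\<epsilon> / 2)"
    and q: "q \<in> P" "var_le (\<lambda>x. g x - q x) (\<epsilon> / 2)"
    using assms unfolding approx_def by (meson half_gt_zero)
  have "var_le (\<lambda>x. f x + g x - (p x + q x)) \<epsilon>"
    using var_le_add[OF p(2) q(2)] by (simp add: algebra_simps)
  with P_add[OF p(1) q(1)] show "\<exists>p\<in>P. var_le (\<lambda>x. f x + g x - p x) \<epsilon>" by (intro bexI)
qed

lemma approx_mult:
  assumes "approx f" "approx g" shows "approx (\<lambda>x. f x * g x)"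
  unfolding approx_def
proof (intro allI impI)
  fix \<epsilon> :: real assume e: "\<epsilon> > 0"
  obtain K L where KL: "var_le f K" "var_le g L" using approx_var assms by blast
  have KL0: "0 \<le> K" "0 \<le> L" using KL var_le_nonneg by auto
  define \<eta> where "\<eta> = min 1 (\<epsilon> / (2 * (K + L + 1)))"
  have \<eta>: "0 < \<eta>" "\<eta> \<le> 1" "2 * (K + L + 1) * \<eta> \<le> \<epsilon>"
  proof -
    have "0 < 2 * (K + L + 1)" using KL0 by simp
    moreover from this have "2 * (K + L + 1) * \<eta> \<le> 2 * (K + L + 1) * (\<epsilon> / (2 * (K + L + 1)))"
      by (intro mult_left_mono) (auto simp: \<eta>_def)
    ultimately show "0 < \<eta>" "\<eta> \<le> 1" "2 * (K + L + 1) * \<eta> \<le> \<epsilon>"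
      using e by (auto simp: \<eta>_def)
  qed
  obtain p q where p: "p \<in> P" "var_le (\<lambda>x. f x - p x) \<eta>"
    and q: "q \<in> P" "var_le (\<lambda>x. g x - q x) \<eta>"
    using assms \<eta> unfolding approx_def by meson
  have p': "var_le p (K + 1)"
  proof -
    have "var_le (\<lambda>x. - (f x - p x)) \<eta>"
      by (rule var_le_uminus[OF p(2)])
    from var_le_add[OF KL(1) this] have "var_le p (K + \<eta>)" by simp
    from var_le_mono[OF this] \<eta> show ?thesis by simp
  qed
  have "var_le (\<lambda>x. (f x - p x) * g x + p x * (g x - q x)) (2 * \<eta> * L + 2 * (K + 1) * \<eta>)"
    by (intro var_le_add var_le_mult p q p' KL)
  then have "var_le (\<lambda>x. f x * g x - p x * q x) (2 * \<eta> * L + 2 * (K + 1) * \<eta>)"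
    by (simp add: algebra_simps)
  then have "var_le (\<lambda>x. f x * g x - p x * q x) \<epsilon>"
    by (rule var_le_mono) (use \<eta> in \<open>simp add: algebra_simps\<close>)
  with P_mult[OF p(1) q(1)] show "\<exists>p\<in>P. var_le (\<lambda>x. f x * g x - p x) \<epsilon>" by (intro bexI)
qed

lemma approx_diff:
  assumes "approx f" "approx g" shows "approx (\<lambda>x. f x - g x)"
  using approx_add[OF assms(1) approx_mult[OF approx_const[of "- 1"] assms(2)]] by simp

lemma approx_power: "approx f \<Longrightarrow> approx (\<lambda>x. f x ^ n)"
  by (induction n) (auto intro: approx_const approx_mult)

lemma approx_sum: "(\<And>i. i \<in> I \<Longrightarrow> approx (f i)) \<Longrightarrow> approx (\<lambda>x. \<Sum>i\<in>I. f i x)"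
  by (induction I rule: infinite_finite_induct) (auto intro: approx_const approx_add)

lemma approx_poly: "approx f \<Longrightarrow> approx (\<lambda>x. poly q (f x))"
  by (induction q) (auto intro: approx_const approx_add approx_mult)

text \<open>On \<open>{a..b}\<close> the derivative of \<open>\<theta>\<close> is a uniform limit of polynomials, so \<open>\<theta>\<close> is a limit of polynomials
  for which the error is Lipschitz with a small constant, and composition with \<open>u\<close> keeps its variation
  small.\<close>

lemma approx_C1:
  assumes u: "approx (\<lambda>x. of_real (u x))" and ab: "\<And>x. x \<in> X \<Longrightarrow> u x \<in> {a..b}"
    and \<theta>: "\<And>t. t \<in> {a..b} \<Longrightarrow> (\<theta> has_real_derivative \<theta>' t) (at t within {a..b})"
    and cont: "continuous_on {a..b} \<theta>'"
  shows "approx (\<lambda>x. of_real (\<theta> (u x)))"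
proof (rule approx_closed)
  fix \<epsilon> :: real assume e: "\<epsilon> > 0"
  obtain K where K: "var_le (\<lambda>x. of_real (u x)) K" using approx_var[OF u] by blast
  have K0: "0 \<le> K" using K var_le_nonneg by auto
  have "a \<le> b" using X_nonempty ab by fastforce
  \<comment> \<open>The sup norm of the error is at most \<open>\<eta> * (b - a)\<close> and its variation at most \<open>\<eta> * K\<close>.\<close>
  define \<eta> where "\<eta> = \<epsilon> / (K + (b - a) + 1)"
  have \<eta>: "0 < \<eta>" "\<eta> * (b - a) + \<eta> * K \<le> \<epsilon>"
  proof -
    have pos: "0 < K + (b - a) + 1" using K0 \<open>a \<le> b\<close> by simp
    then show "0 < \<eta>" using e by (simp add: \<eta>_def)
    then have "\<eta> * (b - a) + \<eta> * K \<le> \<eta> * (K + (b - a) + 1)" by (simp add: algebra_simps)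
    also have "\<dots> = \<epsilon>" using pos by (simp add: \<eta>_def)
    finally show "\<eta> * (b - a) + \<eta> * K \<le> \<epsilon>" .
  qed
  obtain r where "real_polynomial_function r" and r: "\<And>t. t \<in> {a..b} \<Longrightarrow> \<bar>\<theta>' t - r t\<bar> < \<eta>"
    using Stone_Weierstrass_real_polynomial_function[OF _ cont \<eta>(1)] by auto
  then obtain c n where rc: "r = (\<lambda>t. \<Sum>i\<le>n. c i * t ^ i)"
    unfolding real_polynomial_function_iff_sum by blast
  define Q where "Q t = \<theta> a + (\<Sum>i\<le>n. c i / real (Suc i) * (t ^ Suc i - a ^ Suc i))" for t
  have Q: "(Q has_real_derivative r t) (at t within {a..b})" for t
  proof -
    have "((\<lambda>t. c i / real (Suc i) * (t ^ Suc i - a ^ Suc i)) has_real_derivative c i * t ^ i) (at t within {a..b})" for i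
    proof -
      have "((\<lambda>t. c i / real (Suc i) * (t ^ Suc i - a ^ Suc i)) has_real_derivative
          c i / real (Suc i) * (real (Suc i) * (1 * t ^ (Suc i - Suc 0)) - 0)) (at t within {a..b})"
        by (intro DERIV_cmult DERIV_diff DERIV_const DERIV_power DERIV_ident)
      then show ?thesis by (simp del: of_nat_Suc power_Suc)
    qed
    then have "(Q has_real_derivative 0 + (\<Sum>i\<le>n. c i * t ^ i)) (at t within {a..b})"
      unfolding Q_def by (intro DERIV_add DERIV_const DERIV_sum)
    then show ?thesis by (simp add: rc)
  qed
  define D where "D t = \<theta> t - Q t" for t
  have D: "(D has_real_derivative (\<theta>' t - r t)) (at t within {a..b})" if "t \<in> {a..b}" for t
    unfolding D_def by (intro derivative_intros \<theta> Q that)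
  have lip: "\<bar>D s - D t\<bar> \<le> \<eta> * \<bar>s - t\<bar>" if "s \<in> {a..b}" "t \<in> {a..b}" for s t
  proof -
    have "norm (D s - D t) \<le> \<eta> * norm (s - t)"
    proof (rule field_differentiable_bound)
      show "convex {a..b}" by simp
      show "(D has_real_derivative (\<theta>' t - r t)) (at t within {a..b})" if "t \<in> {a..b}" for t
        using that by (rule D)
      show "norm (\<theta>' t - r t) \<le> \<eta>" if "t \<in> {a..b}" for t
        using r[OF that] by simp
    qed (use that in auto)
    then show ?thesis by simp
  qed
  have "D a = 0" by (simp add: D_def Q_def)
  have "var_le (\<lambda>x. of_real (D (u x))) (\<eta> * (b - a) + \<eta> * K)"
  proof (rule var_le_dominated[OF K])
    fix x assume "x \<in> X"
    have "\<bar>D (u x)\<bar> \<le> \<eta> * \<bar>u x - a\<bar>"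
      using lip[of "u x" a] ab[OF \<open>x \<in> X\<close>] \<open>D a = 0\<close> by auto
    also have "\<dots> \<le> \<eta> * (b - a)" using ab[OF \<open>x \<in> X\<close>] \<eta> by auto
    finally show "norm (complex_of_real (D (u x))) \<le> \<eta> * (b - a)" by simp
  next
    fix x y assume "x \<in> X" "y \<in> X"
    then show "norm (complex_of_real (D (u x)) - of_real (D (u y))) \<le> \<eta> * norm (complex_of_real (u x) - of_real (u y))"
      using lip[of "u x" "u y"] ab by (metis norm_of_real of_real_diff)
  qed (use \<eta> \<open>a \<le> b\<close> in auto)
  from var_le_mono[OF this \<eta>(2)]
  have "var_le (\<lambda>x. of_real (\<theta> (u x)) - of_real (Q (u x))) \<epsilon>"
    by (simp add: D_def)
  moreover have "approx (\<lambda>x. of_real (Q (u x)))"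
    unfolding Q_def of_real_add of_real_sum of_real_mult of_real_diff of_real_power
    by (intro approx_add approx_sum approx_mult approx_diff approx_const approx_power u)
  ultimately show "\<exists>g. approx g \<and> var_le (\<lambda>x. of_real (\<theta> (u x)) - g x) \<epsilon>" by blast
qed

end

section \<open>Polynomials in two variables and the algebra AC\<close>

lemma has_derivative_square_pos_part:
  "((\<lambda>t. (max 0 t)\<^sup>2) has_real_derivative 2 * max 0 t) (at t)" for t :: real
proof -
  consider "t < 0" | "t = 0" | "t > 0" by linarith
  then show ?thesis
  proof cases
    case 1
    have "((\<lambda>_. 0) has_real_derivative 2 * max 0 t) (at t)" using 1 by simp
    then show ?thesis
      by (rule has_field_derivative_transform_within_open[of _ _ _ "{..<0}"]) (use 1 in auto)
  next
    case 2
    have "isCont (\<lambda>z::real. max 0 z) 0" by (intro continuous_intros)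
    moreover have "(max 0 z)\<^sup>2 - (max 0 0)\<^sup>2 = max 0 z * (z - 0)" for z :: real
      by (auto simp: max_def power2_eq_square)
    ultimately show ?thesis
      unfolding DERIV_caratheodory_within[of _ _ _ UNIV, simplified] 2 by (intro exI[of _ "\<lambda>z. max 0 z"]) auto
  next
    case 3
    have "((\<lambda>t. t\<^sup>2) has_real_derivative 2 * max 0 t) (at t)"
      using 3 by (auto intro!: derivative_eq_intros)
    then show ?thesis
      by (rule has_field_derivative_transform_within_open[of _ _ _ "{0<..}"]) (use 3 in auto)
  qed
qed

context function_algebra_closure
begin

lemma approx_range:
  assumes "approx (\<lambda>x. of_real (u x))"
  obtains M where "M > 0" "\<And>x. x \<in> X \<Longrightarrow> u x \<in> {-M..M}"
proof -
  obtain K where K: "var_le (\<lambda>x. of_real (u x)) K" using approx_var[OF assms] by blast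
  have "u x \<in> {-(max K 1)..max K 1}" if "x \<in> X" for x
    using var_leD(1)[OF K that] by auto
  with that[of "max K 1"] show ?thesis by force
qed

lemma approx_square_pos_part:
  assumes "approx (\<lambda>x. of_real (u x))"
  shows "approx (\<lambda>x. of_real ((max 0 (u x))\<^sup>2))"
proof -
  obtain M where M: "\<And>x. x \<in> X \<Longrightarrow> u x \<in> {-M..M}" using approx_range[OF assms] by blast
  show ?thesis
  proof (rule approx_C1[OF assms M])
    show "((\<lambda>t. (max 0 t)\<^sup>2) has_real_derivative 2 * max 0 t) (at t within {-M..M})" for t
      by (rule has_field_derivative_at_within[OF has_derivative_square_pos_part])
  qed (auto intro!: continuous_intros)
qed

lemma approx_inverse:
  assumes u: "approx (\<lambda>x. of_real (u x))" and \<delta>: "\<delta> > 0" "\<And>x. x \<in> X \<Longrightarrow> \<delta> \<le> u x"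
  shows "approx (\<lambda>x. of_real (inverse (u x)))"
proof -
  obtain M where M: "\<And>x. x \<in> X \<Longrightarrow> u x \<in> {-M..M}" using approx_range[OF u] by blast
  show ?thesis
  proof (rule approx_C1[OF u, of \<delta> M])
    show "u x \<in> {\<delta>..M}" if "x \<in> X" for x using M[OF that] \<delta>(2)[OF that] by auto
    show "(inverse has_real_derivative - (inverse t ^ Suc (Suc 0))) (at t within {\<delta>..M})" if "t \<in> {\<delta>..M}" for t
      using that \<delta>(1) by (intro DERIV_inverse) auto
    show "continuous_on {\<delta>..M} (\<lambda>t. - (inverse t ^ Suc (Suc 0)))"
      using \<delta>(1) by (intro continuous_intros) auto
  qed
qed

text \<open>The thresholds leave room for a polynomial \<open>u\<close> within 1/4 of a function that is 0 on one set
  and 1 on another.\<close>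

lemma approx_cutoff:
  assumes u: "approx (\<lambda>x. of_real (u x))"
  shows "\<exists>\<kappa>. approx (\<lambda>x. of_real (\<kappa> x)) \<and> (\<forall>x\<in>X. u x \<le> 1/4 \<longrightarrow> \<kappa> x = 0) \<and> (\<forall>x\<in>X. 3/4 \<le> u x \<longrightarrow> \<kappa> x = 1)"
proof -
  \<comment> \<open>The cutoff is \<open>A / (A + B)\<close>; at every point \<open>A\<close> or \<open>B\<close> is at least 1/16.\<close>
  define A where "A x = (max 0 (u x - 1/4))\<^sup>2" for x
  define B where "B x = (max 0 (3/4 - u x))\<^sup>2" for x
  have A: "approx (\<lambda>x. of_real (A x))"
    unfolding A_def using approx_diff[OF u approx_const[of "of_real (1/4)"]]
    by (intro approx_square_pos_part) (simp only: of_real_diff)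
  have B: "approx (\<lambda>x. of_real (B x))"
    unfolding B_def using approx_diff[OF approx_const[of "of_real (3/4)"] u]
    by (intro approx_square_pos_part) (simp only: of_real_diff)
  have AB: "approx (\<lambda>x. of_real (A x + B x))" using approx_add[OF A B] by simp
  have "1/16 \<le> A x + B x" for x
  proof (cases "u x \<ge> 1/2")
    case True
    then have "(1/4)\<^sup>2 \<le> (max 0 (u x - 1/4))\<^sup>2" by (intro power_mono) auto
    then show ?thesis by (simp add: A_def B_def power2_eq_square add_increasing2)
  next
    case False
    then have "(1/4)\<^sup>2 \<le> (max 0 (3/4 - u x))\<^sup>2" by (intro power_mono) auto
    then show ?thesis by (simp add: A_def B_def power2_eq_square add_increasing)
  qed
  then have "approx (\<lambda>x. of_real (inverse (A x + B x)))"
    by (intro approx_inverse[OF AB, of "1/16"]) auto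
  from approx_mult[OF A this] have "approx (\<lambda>x. of_real (A x * inverse (A x + B x)))" by simp
  moreover have "A x * inverse (A x + B x) = 0" if "u x \<le> 1/4" for x using that by (simp add: A_def)
  moreover have "A x * inverse (A x + B x) = 1" if "3/4 \<le> u x" for x
  proof -
    have "B x = 0" using that by (simp add: B_def)
    with \<open>1/16 \<le> A x + B x\<close> show ?thesis by simp
  qed
  ultimately show ?thesis by (intro exI[of _ "\<lambda>x. A x * inverse (A x + B x)"]) auto
qed

end

definition plane_poly :: "(complex \<Rightarrow> complex) set" where
  "plane_poly = {\<lambda>z. \<Sum>n\<le>N. \<Sum>m\<le>N. c n m * of_real (Re z) ^ n * of_real (Im z) ^ m
                 | (c :: nat \<Rightarrow> nat \<Rightarrow> complex) (N :: nat). True}"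

lemma plane_poly_monom: "(\<lambda>z. a * of_real (Re z) ^ k * of_real (Im z) ^ l) \<in> plane_poly"
proof -
  define c where "c n m = (if n = k \<and> m = l then a else 0)" for n m
  have "(\<Sum>n\<le>k + l. \<Sum>m\<le>k + l. c n m * of_real (Re z) ^ n * of_real (Im z) ^ m) = a * of_real (Re z) ^ k * of_real (Im z) ^ l" for z
  proof -
    let ?T = "a * complex_of_real (Re z) ^ k * of_real (Im z) ^ l"
    have "(\<Sum>m\<le>k + l. c n m * of_real (Re z) ^ n * of_real (Im z) ^ m) = (if n = k then ?T else 0)" for n
    proof (cases "n = k")
      case True
      then have "(\<Sum>m\<le>k + l. c n m * of_real (Re z) ^ n * of_real (Im z) ^ m) = (\<Sum>m\<le>k + l. if m = l then ?T else 0)"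
        by (intro sum.cong refl) (simp add: c_def)
      then show ?thesis using True by simp
    qed (simp add: c_def)
    then show ?thesis by simp
  qed
  then show ?thesis unfolding plane_poly_def by (intro CollectI exI[of _ c] exI[of _ "k + l"]) auto
qed

text \<open>The two coefficient arrays are padded with zeros to a common size.\<close>

lemma plane_poly_add:
  assumes "f \<in> plane_poly" "g \<in> plane_poly" shows "(\<lambda>z. f z + g z) \<in> plane_poly"
proof -
  obtain c N where f: "f = (\<lambda>z. \<Sum>n\<le>N. \<Sum>m\<le>N. c n m * of_real (Re z) ^ n * of_real (Im z) ^ m)"
    using assms(1) unfolding plane_poly_def by blast
  obtain d M where g: "g = (\<lambda>z. \<Sum>n\<le>M. \<Sum>m\<le>M. d n m * of_real (Re z) ^ n * of_real (Im z) ^ m)"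
    using assms(2) unfolding plane_poly_def by blast
  have pad: "(\<Sum>n\<le>N. \<Sum>m\<le>N. h n m) = (\<Sum>n\<le>L. \<Sum>m\<le>L. if n \<le> N \<and> m \<le> N then h n m else 0)" if "N \<le> L"
    for h :: "nat \<Rightarrow> nat \<Rightarrow> complex" and N L
  proof -
    have inner: "(\<Sum>m\<le>L. if n \<le> N \<and> m \<le> N then h n m else 0) = (if n \<le> N then \<Sum>m\<le>N. h n m else 0)" for n
      using that by (auto intro!: sum.mono_neutral_cong_right split: if_splits)
    show ?thesis unfolding inner using that by (intro sum.mono_neutral_cong_left) auto
  qed
  define L where "L = max N M"
  define e where "e n m = (if n \<le> N \<and> m \<le> N then c n m else 0) + (if n \<le> M \<and> m \<le> M then d n m else 0)" for n m
  have "f z + g z = (\<Sum>n\<le>L. \<Sum>m\<le>L. e n m * of_real (Re z) ^ n * of_real (Im z) ^ m)" for z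
    unfolding f g pad[of N L, unfolded L_def, OF max.cobounded1, folded L_def] pad[of M L, unfolded L_def, OF max.cobounded2, folded L_def]
      sum.distrib[symmetric]
    by (intro sum.cong refl) (auto simp: e_def algebra_simps)
  then show ?thesis unfolding plane_poly_def by auto
qed

lemma plane_poly_sum: "(\<And>i. i \<in> I \<Longrightarrow> f i \<in> plane_poly) \<Longrightarrow> (\<lambda>z. \<Sum>i\<in>I. f i z) \<in> plane_poly"
proof (induction I rule: infinite_finite_induct)
  case (insert x I)
  then show ?case by (simp add: plane_poly_add)
qed (use plane_poly_monom[of 0 0 0] in simp_all)

lemma plane_poly_const: "(\<lambda>z. c) \<in> plane_poly"
  using plane_poly_monom[of c 0 0] by simp

lemma plane_poly_Re: "(\<lambda>z. of_real (Re z)) \<in> plane_poly"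
  using plane_poly_monom[of 1 1 0] by simp

lemma plane_poly_Im: "(\<lambda>z. of_real (Im z)) \<in> plane_poly"
  using plane_poly_monom[of 1 0 1] by simp

lemma plane_poly_mult:
  assumes "f \<in> plane_poly" "g \<in> plane_poly" shows "(\<lambda>z. f z * g z) \<in> plane_poly"
proof -
  obtain c N where f: "f = (\<lambda>z. \<Sum>n\<le>N. \<Sum>m\<le>N. c n m * of_real (Re z) ^ n * of_real (Im z) ^ m)"
    using assms(1) unfolding plane_poly_def by blast
  obtain d M where g: "g = (\<lambda>z. \<Sum>n\<le>M. \<Sum>m\<le>M. d n m * of_real (Re z) ^ n * of_real (Im z) ^ m)"
    using assms(2) unfolding plane_poly_def by blast
  have "f z * g z = (\<Sum>n\<le>N. \<Sum>k\<le>M. \<Sum>m\<le>N. \<Sum>l\<le>M. c n m * d k l * of_real (Re z) ^ (n + k) * of_real (Im z) ^ (m + l))" for z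
    unfolding f g sum_product by (simp add: power_add mult_ac)
  then have "(\<lambda>z. f z * g z) = (\<lambda>z. \<Sum>n\<le>N. \<Sum>k\<le>M. \<Sum>m\<le>N. \<Sum>l\<le>M. c n m * d k l * of_real (Re z) ^ (n + k) * of_real (Im z) ^ (m + l))"
    by blast
  then show ?thesis by (simp only:) (intro plane_poly_sum plane_poly_monom)
qed

lemma plane_poly_cnj:
  assumes "f \<in> plane_poly" shows "(\<lambda>z. cnj (f z)) \<in> plane_poly"
proof -
  obtain c N where f: "f = (\<lambda>z. \<Sum>n\<le>N. \<Sum>m\<le>N. c n m * of_real (Re z) ^ n * of_real (Im z) ^ m)"
    using assms unfolding plane_poly_def by blast
  show ?thesis unfolding f by (simp, intro plane_poly_sum plane_poly_monom)
qed

text \<open>This gives access to the Stone-Weierstrass theorem, which is stated for this notion of polynomial.\<close>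

lemma plane_poly_real_polynomial:
  "real_polynomial_function g \<Longrightarrow> (\<lambda>z. of_real (g z)) \<in> plane_poly"
proof (induction rule: real_polynomial_function.induct)
  case (linear f)
  have "f z = Re z * f 1 + Im z * f \<i>" for z
  proof -
    have "z = Re z *\<^sub>R 1 + Im z *\<^sub>R \<i>" by (simp add: complex_eq_iff)
    then have "f z = f (Re z *\<^sub>R 1 + Im z *\<^sub>R \<i>)" by simp
    also have "\<dots> = Re z * f 1 + Im z * f \<i>"
      using linear by (simp add: linear_add linear_scale bounded_linear.linear)
    finally show ?thesis .
  qed
  then have "(\<lambda>z. complex_of_real (f z)) = (\<lambda>z. of_real (Re z) * of_real (f 1) + of_real (Im z) * of_real (f \<i>))"
    by (metis of_real_add of_real_mult)
  then show ?case
    by (simp only:) (intro plane_poly_add plane_poly_mult plane_poly_Re plane_poly_Im plane_poly_const)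
qed (auto intro: plane_poly_const plane_poly_add plane_poly_mult)

lemma continuous_on_plane_poly: "f \<in> plane_poly \<Longrightarrow> continuous_on A f"
  unfolding plane_poly_def by (auto intro!: continuous_intros)

context weighted_lists
begin

lemma ex_var_le_mult: "\<exists>K. var_le f K \<Longrightarrow> \<exists>K. var_le g K \<Longrightarrow> \<exists>K. var_le (\<lambda>x. f x * g x) K"
  using var_le_mult by blast

lemma ex_var_le_power: "\<exists>K. var_le f K \<Longrightarrow> \<exists>K. var_le (\<lambda>x. f x ^ n) K"
proof (induction n)
  case 0
  then show ?case using var_le_const[of 1] by auto
next
  case (Suc n)
  then show ?case unfolding power_Suc by (intro ex_var_le_mult) auto
qed

lemma ex_var_le_sum: "(\<And>i. i \<in> I \<Longrightarrow> \<exists>K. var_le (f i) K) \<Longrightarrow> \<exists>K. var_le (\<lambda>x. \<Sum>i\<in>I. f i x) K"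
proof (induction I rule: infinite_finite_induct)
  case (insert i I)
  obtain K where "var_le (f i) K" using insert(4)[of i] by auto
  moreover obtain L where "var_le (\<lambda>x. \<Sum>i\<in>I. f i x) L" using insert(3,4) by auto
  ultimately have "var_le (\<lambda>x. f i x + (\<Sum>i\<in>I. f i x)) (K + L)" by (rule var_le_add)
  with insert(1,2) show ?case by auto
qed (use var_le_const[of 0] in auto)

end

definition weighted_plane_lists :: "complex set \<Rightarrow> (complex list \<times> nat) set" where
  "weighted_plane_lists \<sigma> = {(S, vf S) | S. S \<in> admissible_lists \<sigma>}"

locale compact_plane_set =
  fixes \<sigma> :: "complex set"
  assumes compact: "compact \<sigma>" and nonempty: "\<sigma> \<noteq> {}"
begin

sublocale weighted_lists \<sigma> "weighted_plane_lists \<sigma>"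
  by standard (use nonempty in \<open>auto simp: weighted_plane_lists_def admissible_lists_def\<close>)

text \<open>The values of a linear functional along a list cross a level exactly when the list crosses the
  corresponding line, which happens at most \<open>vf S\<close> times.\<close>

lemma var_le_inner: "\<exists>K. var_le (\<lambda>z. of_real (a \<bullet> z)) K"
proof (cases "a = 0")
  case True
  then show ?thesis using var_le_const[of 0] by auto
next
  case False
  obtain R where "\<And>z. z \<in> \<sigma> \<Longrightarrow> norm z \<le> R" using compact_imp_bounded[OF compact] unfolding bounded_iff by auto
  then have R: "a \<bullet> z \<in> {- (norm a * R)..norm a * R}" if "z \<in> \<sigma>" for z
    using Cauchy_Schwarz_ineq2[of a z] mult_left_mono[of "norm z" R "norm a"] that by fastforce
  define K where "K = norm a * R"
  have K0: "0 \<le> K" using R nonempty unfolding K_def by fastforce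
  show ?thesis
  proof (intro exI var_leI)
    fix z assume "z \<in> \<sigma>"
    then show "norm (complex_of_real (a \<bullet> z)) \<le> 2 * K" using R[of z] K0 unfolding K_def[symmetric] by auto
  next
    fix S w assume "(S, w) \<in> weighted_plane_lists \<sigma>"
    then have S: "set S \<subseteq> \<sigma>" "w = vf S" by (auto simp: weighted_plane_lists_def admissible_lists_def)
    have "(\<Sum>i<length S - 1. norm (complex_of_real (a \<bullet> (S ! Suc i)) - of_real (a \<bullet> (S ! i)))) \<le> (2 * K) * real (vf S)"
    proof (rule overlapping_increments)
      show "a \<bullet> (S ! i) \<in> {-K..K} \<and> a \<bullet> (S ! Suc i) \<in> {-K..K}" if "i \<in> {..<length S - 1}" for i
        using R S that unfolding K_def by (auto simp: subset_iff)
      show "tvar complex_of_real ts \<le> 2 * K" if "sorted_wrt (<) ts" "set ts \<subseteq> {-K..K}" for ts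
        using tvar_monotone[of "-K" K "\<lambda>x. x" ts] that K0 by simp
      show "card {i \<in> {..<length S - 1}. a \<bullet> (S ! i) < c \<and> c < a \<bullet> (S ! Suc i) \<or> a \<bullet> (S ! Suc i) < c \<and> c < a \<bullet> (S ! i)} \<le> vf S" for c
        using card_strictly_opposite_le_vf[OF False, of S c] by (simp add: strictly_opposite_def)
    qed auto
    then show "tvar (\<lambda>z. of_real (a \<bullet> z)) S \<le> 2 * K * real w" by (simp add: tvar_def S)
  qed
qed

sublocale function_algebra_closure \<sigma> "weighted_plane_lists \<sigma>" plane_poly
proof
  fix f assume "f \<in> plane_poly"
  then obtain c N where f: "f = (\<lambda>z. \<Sum>n\<le>N. \<Sum>m\<le>N. c n m * of_real (Re z) ^ n * of_real (Im z) ^ m)"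
    unfolding plane_poly_def by blast
  have "\<exists>K. var_le (\<lambda>z. of_real (Re z)) K" "\<exists>K. var_le (\<lambda>z. of_real (Im z)) K"
    using var_le_inner[of 1] var_le_inner[of \<i>] by (simp_all add: inner_complex_def)
  then show "\<exists>K. var_le f K"
    unfolding f by (intro ex_var_le_sum ex_var_le_mult ex_var_le_power) (use var_le_const in auto)
qed (auto intro: plane_poly_const plane_poly_add plane_poly_mult)

lemma var_le_imp_BV_norm:
  assumes "var_le f K" shows "BV_norm \<sigma> f \<le> ennreal (2 * K)"
proof -
  have K: "0 \<le> K" using assms by (rule var_le_nonneg)
  have "(SUP x\<in>\<sigma>. ennreal (norm (f x))) \<le> ennreal K"
    using var_leD(1)[OF assms] by (intro SUP_least ennreal_leI) auto
  moreover have "var \<sigma> f \<le> ennreal K"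
    unfolding var_def
  proof (intro SUP_least ennreal_leI)
    fix S assume S: "S \<in> admissible_lists \<sigma>"
    then have "(S, vf S) \<in> weighted_plane_lists \<sigma>" by (auto simp: weighted_plane_lists_def)
    then have "tvar f S \<le> K * real (vf S)" by (rule var_leD(2)[OF assms])
    moreover have "1 \<le> vf S" using S by (intro vf_pos) (auto simp: admissible_lists_def)
    ultimately show "cvar f S / real (vf S) \<le> K" by (simp add: cvar_eq_tvar field_simps)
  qed
  ultimately have "BV_norm \<sigma> f \<le> ennreal K + ennreal K" unfolding BV_norm_def by (rule add_mono)
  then show ?thesis using K by (simp flip: ennreal_plus)
qed

lemma BV_norm_imp_var_le:
  assumes "BV_norm \<sigma> f \<le> ennreal K" "0 \<le> K" shows "var_le f K"
proof (rule var_leI)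
  fix x assume "x \<in> \<sigma>"
  then have "ennreal (norm (f x)) \<le> (SUP x\<in>\<sigma>. ennreal (norm (f x)))" by (rule SUP_upper)
  also have "\<dots> \<le> BV_norm \<sigma> f" by (simp add: BV_norm_def)
  also have "\<dots> \<le> ennreal K" by fact
  finally show "norm (f x) \<le> K" using assms(2) by simp
next
  fix S w assume "(S, w) \<in> weighted_plane_lists \<sigma>"
  then have S: "S \<in> admissible_lists \<sigma>" "w = vf S" by (auto simp: weighted_plane_lists_def)
  have "ennreal (cvar f S / real (vf S)) \<le> var \<sigma> f" unfolding var_def by (rule SUP_upper[OF S(1)])
  also have "\<dots> \<le> BV_norm \<sigma> f" by (simp add: BV_norm_def)
  also have "\<dots> \<le> ennreal K" by fact
  finally have "cvar f S / real (vf S) \<le> K" using assms(2) by simp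
  moreover have "1 \<le> vf S" using S by (intro vf_pos) (auto simp: admissible_lists_def)
  ultimately show "tvar f S \<le> K * real w" by (simp add: cvar_eq_tvar field_simps S)
qed

lemma BV_iff: "f \<in> BV \<sigma> \<longleftrightarrow> (\<forall>z. z \<notin> \<sigma> \<longrightarrow> f z = 0) \<and> (\<exists>K. var_le f K)"
proof -
  have "BV_norm \<sigma> f < \<infinity> \<longleftrightarrow> (\<exists>K. var_le f K)"
  proof
    assume "BV_norm \<sigma> f < \<infinity>"
    then have "BV_norm \<sigma> f \<le> ennreal (enn2real (BV_norm \<sigma> f))" by simp
    from BV_norm_imp_var_le[OF this] show "\<exists>K. var_le f K" by auto
  next
    assume "\<exists>K. var_le f K"
    then obtain K where "var_le f K" ..
    from le_less_trans[OF var_le_imp_BV_norm[OF this]] show "BV_norm \<sigma> f < \<infinity>" by simp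
  qed
  then show ?thesis by (simp add: BV_def)
qed

lemma var_le_BV_dist:
  assumes "f \<in> BV \<sigma>" "g \<in> BV \<sigma>" shows "var_le (\<lambda>z. f z - g z) (BV_dist \<sigma> f g)"
  using BV_norm_diff_finite[OF assms] by (intro BV_norm_imp_var_le) (auto simp: BV_dist_def)

lemma BV_dist_le:
  assumes "var_le (\<lambda>z. f z - g z) K" shows "BV_dist \<sigma> f g \<le> 2 * K"
  using enn2real_mono[OF var_le_imp_BV_norm[OF assms]] var_le_nonneg[OF assms] by (simp add: BV_dist_def)

text \<open>From here on membership in \<^const>\<open>AC\<close> is used only in this form, which is free of extended norms
  and topologies. Passing between the norm and \<open>var_le\<close> costs at most a factor 2.\<close>

lemma AC_iff: "f \<in> AC \<sigma> \<longleftrightarrow> (\<forall>z. z \<notin> \<sigma> \<longrightarrow> f z = 0) \<and> approx f"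
proof -
  interpret BV: Metric_space "BV \<sigma>" "BV_dist \<sigma>" by (rule Metric_space_BV)
  have poly_eq: "poly_restrictions \<sigma> = {\<lambda>z. if z \<in> \<sigma> then p z else 0 | p. p \<in> plane_poly}"
  proof (intro subset_antisym subsetI)
    fix f assume "f \<in> poly_restrictions \<sigma>"
    then obtain c N where f: "f = (\<lambda>z. if z \<in> \<sigma> then (\<Sum>n\<le>N. \<Sum>m\<le>N. c n m * of_real (Re z) ^ n * of_real (Im z) ^ m) else 0)"
      unfolding poly_restrictions_def by blast
    define p where "p = (\<lambda>z. \<Sum>n\<le>N. \<Sum>m\<le>N. c n m * of_real (Re z) ^ n * of_real (Im z) ^ m)"
    have "f = (\<lambda>z. if z \<in> \<sigma> then p z else 0)" unfolding p_def by (rule f)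
    moreover have "p \<in> plane_poly" unfolding plane_poly_def p_def by blast
    ultimately show "f \<in> {\<lambda>z. if z \<in> \<sigma> then p z else 0 | p. p \<in> plane_poly}" by blast
  next
    fix f assume "f \<in> {\<lambda>z. if z \<in> \<sigma> then p z else 0 | p. p \<in> plane_poly}"
    then obtain p where p: "f = (\<lambda>z. if z \<in> \<sigma> then p z else 0)" "p \<in> plane_poly" by blast
    then obtain c N where "p = (\<lambda>z. \<Sum>n\<le>N. \<Sum>m\<le>N. c n m * of_real (Re z) ^ n * of_real (Im z) ^ m)"
      unfolding plane_poly_def by blast
    then show "f \<in> poly_restrictions \<sigma>" unfolding p(1) poly_restrictions_def by blast
  qed
  have restr: "var_le (\<lambda>z. f z - (if z \<in> \<sigma> then p z else 0)) K \<longleftrightarrow> var_le (\<lambda>z. f z - p z) K" for f p K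
    by (rule var_le_cong) auto
  have polyBV: "(\<lambda>z. if z \<in> \<sigma> then p z else 0) \<in> BV \<sigma>" if "p \<in> plane_poly" for p
  proof -
    obtain K where "var_le p K" using P_var \<open>p \<in> plane_poly\<close> by blast
    then have "var_le (\<lambda>z. if z \<in> \<sigma> then p z else 0) K" by (subst var_le_cong[of _ p]) auto
    then show ?thesis by (auto simp: BV_iff)
  qed
  show ?thesis
  proof
    assume "f \<in> AC \<sigma>"
    then have f: "f \<in> BV \<sigma>" and near: "\<And>r. r > 0 \<Longrightarrow> \<exists>p\<in>poly_restrictions \<sigma>. p \<in> BV.mball f r"
      unfolding AC_def BV_topology_def BV.metric_closure_of by auto
    have "\<exists>p\<in>plane_poly. var_le (\<lambda>z. f z - p z) \<epsilon>" if e: "\<epsilon> > 0" for \<epsilon>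
    proof -
      obtain p where p: "p \<in> plane_poly" and d: "BV_dist \<sigma> f (\<lambda>z. if z \<in> \<sigma> then p z else 0) < \<epsilon>"
        using near[OF e] unfolding poly_eq BV.in_mball by auto
      from var_le_mono[OF var_le_BV_dist[OF f polyBV[OF p]] less_imp_le[OF d]] p
      show ?thesis unfolding restr by blast
    qed
    with f show "(\<forall>z. z \<notin> \<sigma> \<longrightarrow> f z = 0) \<and> approx f" by (simp add: BV_iff approx_def)
  next
    assume R: "(\<forall>z. z \<notin> \<sigma> \<longrightarrow> f z = 0) \<and> approx f"
    then have f: "f \<in> BV \<sigma>" using approx_var by (simp add: BV_iff)
    have "\<exists>y\<in>poly_restrictions \<sigma>. y \<in> BV.mball f r" if "r > 0" for r
    proof -
      have "r / 3 > 0" using that by simp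
      then obtain p where p: "p \<in> plane_poly" "var_le (\<lambda>z. f z - p z) (r / 3)"
        using R unfolding approx_def by blast
      have "BV_dist \<sigma> f (\<lambda>z. if z \<in> \<sigma> then p z else 0) \<le> 2 * (r / 3)"
        using p(2) by (intro BV_dist_le) (simp only: restr)
      then have "BV_dist \<sigma> f (\<lambda>z. if z \<in> \<sigma> then p z else 0) < r" using that by simp
      with p(1) f polyBV show ?thesis unfolding poly_eq BV.in_mball by blast
    qed
    with f show "f \<in> AC \<sigma>" unfolding AC_def BV_topology_def BV.metric_closure_of by blast
  qed
qed

lemma approx_cnj:
  assumes "approx f" shows "approx (\<lambda>z. cnj (f z))"
  unfolding approx_def
proof (intro allI impI)
  fix \<epsilon> :: real assume "\<epsilon> > 0"
  then obtain p where p: "p \<in> plane_poly" "var_le (\<lambda>z. f z - p z) \<epsilon>" using assms unfolding approx_def by blast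
  have "norm (cnj a - cnj b - (cnj c - cnj d)) = norm (a - b - (c - d))" for a b c d
    by (metis complex_cnj_diff complex_mod_cnj)
  then have "tvar (\<lambda>z. cnj (f z) - cnj (p z)) S = tvar (\<lambda>z. f z - p z) S" for S
    by (simp add: tvar_def)
  moreover have "norm (cnj a - cnj b) = norm (a - b)" for a b by (metis complex_cnj_diff complex_mod_cnj)
  ultimately have "var_le (\<lambda>z. cnj (f z) - cnj (p z)) \<epsilon>"
    using p(2) by (simp add: var_le_def)
  with plane_poly_cnj[OF p(1)] show "\<exists>p\<in>plane_poly. var_le (\<lambda>z. cnj (f z) - p z) \<epsilon>" by (intro bexI)
qed

lemma approx_continuous:
  assumes "approx f" shows "continuous_on \<sigma> f"
proof -
  have "\<exists>p\<in>plane_poly. var_le (\<lambda>z. f z - p z) (inverse (real (Suc n)))" for n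
    using assms unfolding approx_def by simp
  then obtain p where p: "\<And>n. p n \<in> plane_poly" "\<And>n. var_le (\<lambda>z. f z - p n z) (inverse (real (Suc n)))" by metis
  have "\<forall>\<^sub>F n in sequentially. continuous_on \<sigma> (p n)" by (simp add: continuous_on_plane_poly p)
  moreover have "uniform_limit \<sigma> p f sequentially"
  proof (rule uniform_limitI)
    fix e :: real assume "e > 0"
    then obtain N where N: "inverse (real (Suc N)) < e" using reals_Archimedean by blast
    have "dist (p n x) (f x) < e" if "n \<ge> N" "x \<in> \<sigma>" for n x
    proof -
      have "dist (p n x) (f x) \<le> inverse (real (Suc n))"
        using var_leD(1)[OF p(2) that(2)] by (simp add: dist_norm norm_minus_commute)
      also have "\<dots> \<le> inverse (real (Suc N))" using that by (intro le_imp_inverse_le) auto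
      finally show ?thesis using N by simp
    qed
    then show "\<forall>\<^sub>F n in sequentially. \<forall>x\<in>\<sigma>. dist (p n x) (f x) < e"
      unfolding eventually_sequentially by blast
  qed
  ultimately show ?thesis by (rule uniform_limit_theorem) simp
qed

lemma approx_Re: "approx (\<lambda>z. of_real (Re z))" and approx_Im: "approx (\<lambda>z. of_real (Im z))"
  by (auto intro: approx_P plane_poly_Re plane_poly_Im)

lemma approx_inner: "approx (\<lambda>z. of_real (a \<bullet> z))"
  unfolding inner_complex_def of_real_add of_real_mult
  by (intro approx_add approx_mult approx_const approx_Re approx_Im)

lemma approx_id: "approx (\<lambda>z. z)"
proof -
  have "approx (\<lambda>z. of_real (Re z) + \<i> * of_real (Im z))"
    by (intro approx_add approx_mult approx_const approx_Re approx_Im)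
  then show ?thesis by (simp add: complex_eq[symmetric])
qed

text \<open>A continuous function that separates the two sets is close to a polynomial, and a cutoff of the
  polynomial is exactly 0 and exactly 1 where required.\<close>

lemma approx_separating:
  assumes "closed K" "closed R" "K \<inter> R = {}"
  shows "\<exists>\<kappa>. approx (\<lambda>z. of_real (\<kappa> z)) \<and> (\<forall>z\<in>\<sigma> \<inter> R. \<kappa> z = 0) \<and> (\<forall>z\<in>\<sigma> \<inter> K. \<kappa> z = 1)"
proof -
  obtain f :: "complex \<Rightarrow> real" where f: "continuous_on UNIV f" "\<And>x. x \<in> R \<Longrightarrow> f x = 0" "\<And>x. x \<in> K \<Longrightarrow> f x = 1"
    using Urysohn[OF assms(2,1), of "0::real" 1] assms(3) by (metis inf_commute)
  obtain g where "real_polynomial_function g" and g: "\<And>x. x \<in> \<sigma> \<Longrightarrow> \<bar>f x - g x\<bar> < 1/4"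
    using Stone_Weierstrass_real_polynomial_function[OF compact continuous_on_subset[OF f(1)], of "1/4"] by auto
  then have "approx (\<lambda>z. of_real (g z))" by (intro approx_P plane_poly_real_polynomial)
  from approx_cutoff[OF this] obtain \<kappa> where \<kappa>: "approx (\<lambda>z. of_real (\<kappa> z))"
    "\<forall>x\<in>\<sigma>. g x \<le> 1/4 \<longrightarrow> \<kappa> x = 0" "\<forall>x\<in>\<sigma>. 3/4 \<le> g x \<longrightarrow> \<kappa> x = 1" by blast
  have "\<kappa> z = 0" if "z \<in> \<sigma> \<inter> R" for z using that \<kappa>(2) g[of z] f(2)[of z] by force
  moreover have "\<kappa> z = 1" if "z \<in> \<sigma> \<inter> K" for z using that \<kappa>(3) g[of z] f(3)[of z] by force
  ultimately show ?thesis using \<kappa>(1) by blast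
qed

end

section \<open>Characters of AC\<close>

context compact_plane_set
begin

definition one :: "complex \<Rightarrow> complex" where
  "one z = (if z \<in> \<sigma> then 1 else 0)"

lemma AC_restrict:
  assumes "approx f" shows "(\<lambda>z. if z \<in> \<sigma> then f z else 0) \<in> AC \<sigma>"
proof -
  have "approx (\<lambda>z. if z \<in> \<sigma> then f z else 0) \<longleftrightarrow> approx f"
    by (rule approx_cong) simp
  with assms show ?thesis unfolding AC_iff by simp
qed

lemma AC_one: "one \<in> AC \<sigma>"
  unfolding one_def[abs_def] by (rule AC_restrict[OF approx_const])

lemma AC_add: "f \<in> AC \<sigma> \<Longrightarrow> g \<in> AC \<sigma> \<Longrightarrow> (\<lambda>z. f z + g z) \<in> AC \<sigma>"
  by (simp add: AC_iff approx_add)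

lemma AC_mult: "f \<in> AC \<sigma> \<Longrightarrow> g \<in> AC \<sigma> \<Longrightarrow> (\<lambda>z. f z * g z) \<in> AC \<sigma>"
  by (simp add: AC_iff approx_mult)

lemma AC_scale: "f \<in> AC \<sigma> \<Longrightarrow> (\<lambda>z. c * f z) \<in> AC \<sigma>"
  by (simp add: AC_iff approx_mult approx_const)

lemma AC_cnj: "f \<in> AC \<sigma> \<Longrightarrow> (\<lambda>z. cnj (f z)) \<in> AC \<sigma>"
  by (simp add: AC_iff approx_cnj)

text \<open>If \<open>\<phi>\<close> were no evaluation, the kernel would contain for each \<open>x\<close> a function \<open>g x\<close> with \<open>g x x \<noteq> 0\<close>.
  By compactness finitely many of the functions \<open>|g x|\<^sup>2\<close>, again in the kernel, have a strictly positive
  sum; this sum is invertible, so it cannot be in the kernel of a homomorphism with \<open>\<phi> 1 = 1\<close>.\<close>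

lemma character_is_evaluation:
  fixes \<phi> :: "(complex \<Rightarrow> complex) \<Rightarrow> complex"
  assumes add: "\<And>f g. f \<in> AC \<sigma> \<Longrightarrow> g \<in> AC \<sigma> \<Longrightarrow> \<phi> (\<lambda>z. f z + g z) = \<phi> f + \<phi> g"
    and mult: "\<And>f g. f \<in> AC \<sigma> \<Longrightarrow> g \<in> AC \<sigma> \<Longrightarrow> \<phi> (\<lambda>z. f z * g z) = \<phi> f * \<phi> g"
    and scale: "\<And>f c. f \<in> AC \<sigma> \<Longrightarrow> \<phi> (\<lambda>z. c * f z) = c * \<phi> f"
    and one: "\<phi> one = 1"
  shows "\<exists>x\<in>\<sigma>. \<forall>f\<in>AC \<sigma>. \<phi> f = f x"
proof (rule ccontr)
  assume "\<not> ?thesis"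
  then obtain F where F: "\<And>x. x \<in> \<sigma> \<Longrightarrow> F x \<in> AC \<sigma>" "\<And>x. x \<in> \<sigma> \<Longrightarrow> \<phi> (F x) \<noteq> F x x" by metis
  define g where "g x z = F x z + (- \<phi> (F x)) * one z" for x z
  have g: "g x \<in> AC \<sigma>" if "x \<in> \<sigma>" for x
    unfolding g_def by (intro AC_add AC_scale AC_one F that)
  have \<phi>g: "\<phi> (g x) = 0" if "x \<in> \<sigma>" for x
  proof -
    have "g x = (\<lambda>z. F x z + (- \<phi> (F x)) * one z)" by (simp add: fun_eq_iff g_def)
    then have "\<phi> (g x) = \<phi> (F x) + (- \<phi> (F x)) * \<phi> one"
      by (simp only: add[OF F(1)[OF that] AC_scale[OF AC_one]] scale[OF AC_one])
    then show ?thesis using one by simp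
  qed
  have gx: "g x x \<noteq> 0" if "x \<in> \<sigma>" for x using F(2)[OF that] that by (simp add: g_def one_def)
  have cont: "continuous_on \<sigma> (g x)" if "x \<in> \<sigma>" for x
    using g[OF that] unfolding AC_iff by (intro approx_continuous) simp
  have "\<exists>U. open U \<and> U \<inter> \<sigma> = g x -` (- {0}) \<inter> \<sigma>" if "x \<in> \<sigma>" for x
    using cont[OF that] open_Compl[OF closed_singleton[of 0]] unfolding continuous_on_open_invariant by blast
  then obtain U where U: "\<And>x. x \<in> \<sigma> \<Longrightarrow> open (U x)" "\<And>x. x \<in> \<sigma> \<Longrightarrow> U x \<inter> \<sigma> = g x -` (- {0}) \<inter> \<sigma>" by metis
  have "\<sigma> \<subseteq> (\<Union>x\<in>\<sigma>. U x)" using U(2) gx by fastforce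
  then obtain D where D: "D \<subseteq> \<sigma>" "finite D" "\<sigma> \<subseteq> (\<Union>x\<in>D. U x)"
    using compactE_image[OF compact, of \<sigma> U] U(1) by blast
  define h where "h x z = g x z * cnj (g x z)" for x z
  have "(\<lambda>z. \<Sum>x\<in>D. h x z) \<in> AC \<sigma> \<and> \<phi> (\<lambda>z. \<Sum>x\<in>D. h x z) = 0"
    using D(2,1)
  proof (induction D rule: finite_induct)
    case empty
    then show ?case using AC_scale[OF AC_one, of 0] scale[OF AC_one, of 0] by simp
  next
    case (insert x D)
    have h: "h x \<in> AC \<sigma>" "\<phi> (h x) = 0"
      using AC_mult[OF g AC_cnj[OF g]] mult[OF g AC_cnj[OF g]] \<phi>g insert(4) by (auto simp: h_def[abs_def])
    then show ?case using insert AC_add[OF h(1)] add[OF h(1)] by simp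
  qed
  then have H: "(\<lambda>z. \<Sum>x\<in>D. h x z) \<in> AC \<sigma>" "\<phi> (\<lambda>z. \<Sum>x\<in>D. h x z) = 0" by auto
  define u where "u z = (\<Sum>x\<in>D. (norm (g x z))\<^sup>2)" for z
  have hu: "(\<Sum>x\<in>D. h x z) = of_real (u z)" for z
    by (simp add: h_def u_def complex_norm_square del: of_real_power)
  have "continuous_on \<sigma> u" unfolding u_def
    using D(1) by (intro continuous_on_sum continuous_on_power continuous_on_norm cont) auto
  moreover have "u z > 0" if z: "z \<in> \<sigma>" for z
  proof -
    obtain x where x: "x \<in> D" "z \<in> U x" using D(3) z by auto
    then have "g x z \<noteq> 0" using U(2)[of x] D(1) z by auto
    then show ?thesis unfolding u_def using D(2) x(1) by (intro sum_pos2[of _ x]) auto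
  qed
  ultimately obtain \<delta> where \<delta>: "\<delta> > 0" "\<And>z. z \<in> \<sigma> \<Longrightarrow> \<delta> \<le> u z"
    using continuous_attains_inf[OF compact nonempty, of u] by force
  have ap: "approx (\<lambda>z. of_real (u z))" using H(1) by (simp add: AC_iff hu)
  define k where "k z = (if z \<in> \<sigma> then complex_of_real (inverse (u z)) else 0)" for z
  have k: "k \<in> AC \<sigma>"
    unfolding k_def[abs_def] by (rule AC_restrict[OF approx_inverse[OF ap \<delta>]])
  have "(\<lambda>z. (\<Sum>x\<in>D. h x z) * k z) = one"
  proof
    fix z show "(\<Sum>x\<in>D. h x z) * k z = one z"
      using \<delta>(1) \<delta>(2)[of z] by (auto simp: hu k_def one_def simp flip: of_real_mult)
  qed
  with mult[OF H(1) k] H(2) one show False by simp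
qed

end

text \<open>For \<open>y \<in> \<tau>\<close> the map \<open>f \<mapsto> \<Phi> f y\<close> is a character, so \<open>\<Phi> f y = f (h y)\<close>. Taking for \<open>f\<close> the identity function
  shows that \<open>h\<close> is continuous. It is injective because the functions in \<open>AC \<tau>\<close> separate points, and
  surjective because a function vanishing on the compact image of \<open>h\<close> lies in the kernel of \<open>\<Phi>\<close>,
  which is trivial.\<close>

lemma compact_homeomorphic_if_AC_isomorphic:
  assumes "compact_plane_set \<sigma>" "compact_plane_set \<tau>" "AC_isomorphic \<sigma> \<tau>"
  shows "\<sigma> homeomorphic \<tau>"
proof -
  interpret S: compact_plane_set \<sigma> by fact
  interpret T: compact_plane_set \<tau> by fact
  have top: "topspace (AC_topology \<rho>) = AC \<rho>" for \<rho>
  proof -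
    show ?thesis unfolding AC_topology_def topspace_subtopology AC_def
      using closure_of_subset_topspace[of "BV_topology \<rho>" "poly_restrictions \<rho>"] by blast
  qed
  obtain \<Phi> where hom: "homeomorphic_map (AC_topology \<sigma>) (AC_topology \<tau>) \<Phi>"
    and add: "\<And>f g. f\<in>AC \<sigma> \<Longrightarrow> g\<in>AC \<sigma> \<Longrightarrow> \<Phi> (\<lambda>z. f z + g z) = (\<lambda>z. \<Phi> f z + \<Phi> g z)"
    and mult: "\<And>f g. f\<in>AC \<sigma> \<Longrightarrow> g\<in>AC \<sigma> \<Longrightarrow> \<Phi> (\<lambda>z. f z * g z) = (\<lambda>z. \<Phi> f z * \<Phi> g z)"
    and scale: "\<And>f c. f\<in>AC \<sigma> \<Longrightarrow> \<Phi> (\<lambda>z. c * f z) = (\<lambda>z. c * \<Phi> f z)"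
    using assms(3) unfolding AC_isomorphic_def by blast
  from hom have onto: "\<Phi> ` AC \<sigma> = AC \<tau>" and inj: "inj_on \<Phi> (AC \<sigma>)"
    using homeomorphic_imp_surjective_map[OF hom] homeomorphic_imp_injective_map[OF hom] by (simp_all add: top)
  have one: "\<Phi> S.one = T.one"
  proof -
    have "T.one \<in> \<Phi> ` AC \<sigma>" using T.AC_one onto by simp
    then obtain g where g: "g \<in> AC \<sigma>" "\<Phi> g = T.one" by auto
    have "(\<lambda>z. g z * S.one z) = g" using g(1) by (auto simp: S.one_def S.AC_iff)
    with mult[OF g(1) S.AC_one] g(2) have *: "T.one = (\<lambda>z. T.one z * \<Phi> S.one z)" by simp
    have "\<Phi> S.one \<in> AC \<tau>" using S.AC_one onto by blast
    then have "\<Phi> S.one y = T.one y" for y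
      using fun_cong[OF *, of y] by (cases "y \<in> \<tau>") (auto simp: T.AC_iff T.one_def)
    then show ?thesis by blast
  qed
  have "\<exists>x\<in>\<sigma>. \<forall>f\<in>AC \<sigma>. \<Phi> f y = f x" if "y \<in> \<tau>" for y
    by (rule S.character_is_evaluation) (use that in \<open>simp_all add: add mult scale one T.one_def\<close>)
  then obtain h where h: "\<And>y. y \<in> \<tau> \<Longrightarrow> h y \<in> \<sigma>" "\<And>y f. y \<in> \<tau> \<Longrightarrow> f \<in> AC \<sigma> \<Longrightarrow> \<Phi> f y = f (h y)" by metis
  have into: "\<Phi> f \<in> AC \<tau>" if "f \<in> AC \<sigma>" for f using onto that by blast
  have "continuous_on \<tau> h"
  proof -
    have "continuous_on \<tau> (\<Phi> (\<lambda>z. if z \<in> \<sigma> then z else 0))"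
      using into[OF S.AC_restrict[OF S.approx_id]] T.approx_continuous by (simp add: T.AC_iff)
    moreover have "\<Phi> (\<lambda>z. if z \<in> \<sigma> then z else 0) y = h y" if "y \<in> \<tau>" for y
      using h that S.AC_restrict[OF S.approx_id] by simp
    ultimately show ?thesis by (simp cong: continuous_on_cong)
  qed
  moreover have "inj_on h \<tau>"
  proof (rule inj_onI)
    fix y y' assume y: "y \<in> \<tau>" "y' \<in> \<tau>" "h y = h y'"
    have "(\<lambda>z. if z \<in> \<tau> then z else 0) \<in> \<Phi> ` AC \<sigma>"
      using T.AC_restrict[OF T.approx_id] onto by simp
    then obtain f where f: "f \<in> AC \<sigma>" "\<Phi> f = (\<lambda>z. if z \<in> \<tau> then z else 0)" by auto
    have "\<Phi> f y = \<Phi> f y'" using h(2) f(1) y by simp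
    then show "y = y'" using y by (simp add: f(2))
  qed
  moreover have "h ` \<tau> = \<sigma>"
  proof (rule ccontr)
    assume "h ` \<tau> \<noteq> \<sigma>"
    then obtain x where x: "x \<in> \<sigma>" "x \<notin> h ` \<tau>" using h(1) by blast
    have "closed (h ` \<tau>)"
      using compact_continuous_image[OF \<open>continuous_on \<tau> h\<close> T.compact] by (rule compact_imp_closed)
    then obtain \<kappa> where \<kappa>: "S.approx (\<lambda>z. of_real (\<kappa> z))" "\<forall>z\<in>\<sigma> \<inter> h ` \<tau>. \<kappa> z = 0" "\<kappa> x = 1"
      using S.approx_separating[of "{x}" "h ` \<tau>"] x by auto
    define f where "f z = (if z \<in> \<sigma> then complex_of_real (\<kappa> z) else 0)" for z
    have f: "f \<in> AC \<sigma>" unfolding f_def[abs_def] by (rule S.AC_restrict[OF \<kappa>(1)])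
    have "\<Phi> f y = 0" for y
    proof (cases "y \<in> \<tau>")
      case True
      with h f \<kappa>(2) show ?thesis by (simp add: f_def)
    next
      case False
      with into[OF f] show ?thesis by (simp add: T.AC_iff)
    qed
    then have "\<Phi> (\<lambda>z. 0 * f z) = \<Phi> f" using scale[OF f, of 0] by auto
    then have "(\<lambda>z. 0 * f z) = f" using inj_onD[OF inj _ S.AC_scale[OF f] f] by blast
    then have "f x = 0" by (metis mult_zero_left)
    then show False using x \<kappa>(3) by (simp add: f_def)
  qed
  ultimately have "\<tau> homeomorphic \<sigma>" using homeomorphic_compact[OF T.compact, of h \<sigma>] by simp
  then show ?thesis by (rule homeomorphic_sym[THEN iffD1])
qed

section \<open>Absolutely continuous functions on the unit interval\<close>

definition interval_lists :: "(real list \<times> nat) set" where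
  "interval_lists = {(ts, 1) | ts. sorted_wrt (<) ts \<and> set ts \<subseteq> {0..1}}"

definition interval_poly :: "(real \<Rightarrow> complex) set" where
  "interval_poly = {\<lambda>t. poly q (of_real t) | q. True}"

interpretation unit_interval: weighted_lists "{0..1::real}" interval_lists
  by standard (auto simp: interval_lists_def)

text \<open>For monotone functions variation is controlled by size. This is what makes the approximation of
  convex functions and the estimates for the functions \<open>soft\<close> elementary.\<close>

lemma unit_interval_var_le_monotone:
  assumes "\<And>x y. 0 \<le> x \<Longrightarrow> x \<le> y \<Longrightarrow> y \<le> 1 \<Longrightarrow> \<phi> x \<le> \<phi> y"
    and "\<And>x. x \<in> {0..1} \<Longrightarrow> \<bar>\<phi> x\<bar> \<le> K"
  shows "unit_interval.var_le (\<lambda>t. of_real (\<phi> t)) (2 * K)"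
proof (rule unit_interval.var_leI)
  have K: "0 \<le> K" using assms(2)[of 0] by auto
  show "norm (complex_of_real (\<phi> x)) \<le> 2 * K" if "x \<in> {0..1}" for x
    using assms(2)[OF that] K by simp
  fix S w assume "(S, w) \<in> interval_lists"
  then have S: "sorted_wrt (<) S" "set S \<subseteq> {0..1}" "w = 1" by (auto simp: interval_lists_def)
  have "tvar (\<lambda>t. complex_of_real (\<phi> t)) S \<le> \<phi> 1 - \<phi> 0"
    by (rule tvar_monotone) (use assms S in auto)
  also have "\<dots> \<le> 2 * K" using assms(2)[of 0] assms(2)[of 1] by auto
  finally show "tvar (\<lambda>t. complex_of_real (\<phi> t)) S \<le> 2 * K * real w" using S by simp
qed

interpretation unit_interval: function_algebra_closure "{0..1::real}" interval_lists interval_poly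
proof
  show "(\<lambda>_. c) \<in> interval_poly" for c
    unfolding interval_poly_def by (intro CollectI exI[of _ "[:c:]"]) auto
  fix f g assume "f \<in> interval_poly" "g \<in> interval_poly"
  then obtain p q where pq: "f = (\<lambda>t. poly p (of_real t))" "g = (\<lambda>t. poly q (of_real t))"
    unfolding interval_poly_def by blast
  show "(\<lambda>t. f t + g t) \<in> interval_poly"
    unfolding interval_poly_def pq by (intro CollectI exI[of _ "p + q"]) auto
  show "(\<lambda>t. f t * g t) \<in> interval_poly"
    unfolding interval_poly_def pq by (intro CollectI exI[of _ "p * q"]) auto
next
  fix f assume "f \<in> interval_poly"
  then obtain q where q: "f = (\<lambda>t. poly q (of_real t))" unfolding interval_poly_def by blast
  have id: "unit_interval.var_le (\<lambda>t. of_real t) 2"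
    using unit_interval_var_le_monotone[of "\<lambda>t. t" 1] by simp
  show "\<exists>K. unit_interval.var_le f K"
    unfolding q
  proof (induction q)
    case 0
    then show ?case using unit_interval.var_le_const[of 0] by auto
  next
    case (pCons a q)
    then obtain K where "unit_interval.var_le (\<lambda>t. poly q (of_real t)) K" by blast
    from unit_interval.var_le_add[OF unit_interval.var_le_const[of a] unit_interval.var_le_mult[OF id this]]
    show ?case by auto
  qed
qed

lemma unit_interval_approx_id: "unit_interval.approx (\<lambda>t. of_real t)"
  by (rule unit_interval.approx_P) (auto simp: interval_poly_def intro!: exI[of _ "[:0, 1:]"])

lemma tvar_rev: "tvar f (rev S) = tvar f S"
proof -
  have "tvar f (rev S) = (\<Sum>i<length S - 1. norm (f (S ! (length S - 1 - Suc i)) - f (S ! Suc (length S - 1 - Suc i))))"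
    unfolding tvar_def by (intro sum.cong) (auto simp: rev_nth Suc_diff_Suc)
  also have "\<dots> = (\<Sum>i<length S - 1. norm (f (S ! i) - f (S ! Suc i)))"
    by (rule sum.nat_diff_reindex)
  finally show ?thesis by (simp add: tvar_def norm_minus_commute)
qed

lemma sorted_wrt_rev_reflect: "sorted_wrt (<) ts \<Longrightarrow> sorted_wrt (<) (rev (map (\<lambda>t::real. 1 - t) ts))"
  by (simp add: sorted_wrt_rev sorted_wrt_map)

lemma unit_interval_approx_reflect:
  assumes "unit_interval.approx f"
  shows "unit_interval.approx (\<lambda>t. f (1 - t))"
  unfolding unit_interval.approx_def
proof (intro allI impI)
  fix \<epsilon> :: real assume "\<epsilon> > 0"
  then obtain p where p: "p \<in> interval_poly" "unit_interval.var_le (\<lambda>t. f t - p t) \<epsilon>"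
    using assms unfolding unit_interval.approx_def by blast
  then obtain q where "p = (\<lambda>t. poly q (of_real t))" unfolding interval_poly_def by blast
  with p have q: "unit_interval.var_le (\<lambda>t. f t - poly q (of_real t)) \<epsilon>" by simp
  have "unit_interval.var_le (\<lambda>t. f (1 - t) - poly q (of_real (1 - t))) \<epsilon>"
  proof (rule unit_interval.var_leI)
    show "norm (f (1 - t) - poly q (of_real (1 - t))) \<le> \<epsilon>" if "t \<in> {0..1}" for t
      using unit_interval.var_leD(1)[OF q, of "1 - t"] that by auto
    fix S w assume "(S, w) \<in> interval_lists"
    then have "(rev (map (\<lambda>t. 1 - t) S), w) \<in> interval_lists"
      using sorted_wrt_rev_reflect by (auto simp: interval_lists_def)
    from unit_interval.var_leD(2)[OF q this]
    show "tvar (\<lambda>t. f (1 - t) - poly q (of_real (1 - t))) S \<le> \<epsilon> * real w"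
      by (simp add: tvar_rev tvar_map)
  qed
  moreover have "(\<lambda>t. poly q (of_real (1 - t))) \<in> interval_poly"
    unfolding interval_poly_def
    by (intro CollectI exI[of _ "pcompose q [:1, -1:]"]) (auto simp: poly_pcompose)
  ultimately show "\<exists>p\<in>interval_poly. unit_interval.var_le (\<lambda>t. f (1 - t) - p t) \<epsilon>" by (intro bexI)
qed

text \<open>Both \<open>t'\<close> and \<open>t + s\<close> lie between \<open>t\<close> and \<open>t' + s\<close>, with complementary weights.\<close>

lemma convex_on_increment_mono:
  fixes g :: "real \<Rightarrow> real"
  assumes g: "convex_on A g" and tt: "t \<le> t'" "0 \<le> s" and A: "t \<in> A" "t' + s \<in> A"
  shows "g t' + g (t + s) \<le> g t + g (t' + s)"
proof (cases "t' - t + s = 0")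
  case True
  then have "t' = t" "s = 0" using tt by auto
  then show ?thesis by simp
next
  case False
  then have pos: "t' - t + s > 0" using tt by auto
  define \<mu> where "\<mu> = (t' - t) / (t' - t + s)"
  have \<mu>: "0 \<le> \<mu>" "\<mu> \<le> 1" using pos tt by (auto simp: \<mu>_def)
  have e: "\<mu> * (t' - t + s) = t' - t" using pos by (simp add: \<mu>_def)
  have a: "t' = (1 - \<mu>) * t + \<mu> * (t' + s)" using e by (simp add: algebra_simps)
  have b: "t + s = (1 - (1 - \<mu>)) * t + (1 - \<mu>) * (t' + s)" using e by (simp add: algebra_simps)
  have "g t' \<le> (1 - \<mu>) * g t + \<mu> * g (t' + s)"
    using convex_onD[OF g, of \<mu> t "t' + s"] \<mu> A a by simp
  moreover have "g (t + s) \<le> \<mu> * g t + (1 - \<mu>) * g (t' + s)"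
    using convex_onD[OF g, of "1 - \<mu>" t "t' + s"] \<mu> A b by simp
  ultimately show ?thesis by (simp add: algebra_simps)
qed

text \<open>The sliding mean \<open>\<psi> t = (1 / h) * (\<integral> g over {t..t + h})\<close> is C1. Since increments of a convex function
  increase, \<open>\<psi> - g\<close> is increasing, so its variation is at most twice its size, which tends to 0 with \<open>h\<close>.
  Room to the right of 1 is needed for the mean; at 0 the slope may be infinite.\<close>

lemma unit_interval_approx_convex_right:
  fixes g :: "real \<Rightarrow> real"
  assumes conv: "convex_on {0..b} g" and cont: "continuous_on {0..b} g" and b: "1 < b"
  shows "unit_interval.approx (\<lambda>t. of_real (g t))"
proof (rule unit_interval.approx_closed)
  fix \<epsilon> :: real assume \<epsilon>: "\<epsilon> > 0"
  have "uniformly_continuous_on {0..b} g" using compact_uniformly_continuous[OF cont] by auto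
  then obtain d where d: "d > 0" "\<And>x y. x \<in> {0..b} \<Longrightarrow> y \<in> {0..b} \<Longrightarrow> dist y x < d \<Longrightarrow> dist (g y) (g x) < \<epsilon> / 2"
    using \<epsilon> unfolding uniformly_continuous_on_def by (meson half_gt_zero)
  \<comment> \<open>\<open>\<psi>\<close> is the mean of \<open>g\<close> over an interval of length \<open>h\<close> starting at the point\<close>
  define h where "h = min (d / 2) (b - 1)"
  have h: "0 < h" "h < d" "1 + h \<le> b" using d b by (auto simp: h_def)
  obtain \<Phi> where \<Phi>: "\<And>x. x \<in> {0..b} \<Longrightarrow> (\<Phi> has_real_derivative g x) (at x within {0..b})"
    using antiderivative_continuous[OF cont] unfolding has_real_derivative_iff_has_vector_derivative by blast
  define \<psi> where "\<psi> t = (\<Phi> (t + h) - \<Phi> t) / h" for t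
  have h\<psi>: "h * \<psi> t = \<Phi> (t + h) - \<Phi> t" for t using h by (simp add: \<psi>_def)
  have shift: "((\<lambda>s. \<Phi> (c + s)) has_real_derivative g (c + t)) (at t within {0..l})"
    if "0 \<le> c" "c + l \<le> b" "t \<in> {0..l}" for c l t
  proof -
    have "(\<Phi> has_real_derivative g (c + t)) (at (c + t) within (\<lambda>s. c + s) ` {0..l})"
      by (rule DERIV_subset[OF \<Phi>]) (use that in auto)
    moreover have "((\<lambda>s. c + s) has_real_derivative 1) (at t within {0..l})"
      by (auto intro!: derivative_eq_intros)
    ultimately show ?thesis using DERIV_image_chain[of \<Phi> "g (c + t)" "\<lambda>s. c + s" t "{0..l}" 1] by (simp add: o_def)
  qed
  have \<psi>: "unit_interval.approx (\<lambda>t. of_real (\<psi> t))"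
  proof (rule unit_interval.approx_C1[OF unit_interval_approx_id, of 0 1 \<psi> "\<lambda>t. (g (h + t) - g (0 + t)) / h"])
    show "(\<psi> has_real_derivative (g (h + t) - g (0 + t)) / h) (at t within {0..1})" if "t \<in> {0..1}" for t
      unfolding \<psi>_def using shift[of h 1 t] shift[of 0 1 t] that h
      by (intro DERIV_cdivide DERIV_diff) (auto simp: add.commute)
    show "continuous_on {0..1} (\<lambda>t. (g (h + t) - g (0 + t)) / h)"
      by (intro continuous_intros continuous_on_compose2[OF cont]) (use h in auto)
  qed auto
  define D where "D t = \<psi> t - g t" for t
  have mono: "D t \<le> D t'" if t: "0 \<le> t" "t \<le> t'" "t' \<le> 1" for t t'
  proof -
    define E where "E s = \<Phi> (t' + s) - \<Phi> (t + s) - (g t' - g t) * s" for s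
    have "E 0 \<le> E h"
    proof (rule DERIV_nonneg_imp_increasing_open[of 0 h E])
      have der: "(E has_real_derivative g (t' + s) - g (t + s) - (g t' - g t)) (at s within {0..h})" if "s \<in> {0..h}" for s
        unfolding E_def using shift[of t' h s] shift[of t h s] t h that
        by (intro DERIV_diff DERIV_cmult_Id) auto
      then show "continuous_on {0..h} E" by (rule DERIV_continuous_on)
      fix s assume s: "0 < s" "s < h"
      have "0 \<le> g (t' + s) - g (t + s) - (g t' - g t)"
        using convex_on_increment_mono[OF conv t(2), of s] t h s by auto
      moreover have "DERIV E s :> g (t' + s) - g (t + s) - (g t' - g t)"
        using der[of s] s by (simp add: at_within_Icc_at)
      ultimately show "\<exists>y. DERIV E s :> y \<and> 0 \<le> y" by blast
    qed (use h in auto)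
    then have "h * (D t' - D t) \<ge> 0" by (simp add: E_def D_def h\<psi> right_diff_distrib algebra_simps)
    then show ?thesis using h by (simp add: zero_le_mult_iff)
  qed
  have small: "\<bar>D t\<bar> \<le> \<epsilon> / 2" if t: "t \<in> {0..1}" for t
  proof -
    define E where "E s = \<Phi> (t + s) - g t * s" for s
    have "norm (E h - E 0) \<le> \<epsilon> / 2 * norm (h - 0)"
    proof (rule field_differentiable_bound)
      show "(E has_real_derivative g (t + s) - g t) (at s within {0..h})" if "s \<in> {0..h}" for s
        unfolding E_def using shift[of t h s] t h that by (intro DERIV_diff DERIV_cmult_Id) auto
      show "norm (g (t + s) - g t) \<le> \<epsilon> / 2" if "s \<in> {0..h}" for s
        using d(2)[of t "t + s"] t h that by (auto simp: dist_real_def)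
    qed (use h in auto)
    moreover have "E h - E 0 = h * D t" by (simp add: E_def D_def h\<psi> right_diff_distrib algebra_simps)
    ultimately show ?thesis using h by (simp add: abs_mult)
  qed
  have "unit_interval.var_le (\<lambda>t. of_real (D t)) (2 * (\<epsilon> / 2))"
    by (rule unit_interval_var_le_monotone[OF mono small])
  from unit_interval.var_le_uminus[OF this] have "unit_interval.var_le (\<lambda>t. of_real (g t) - of_real (\<psi> t)) \<epsilon>"
    by (simp add: D_def)
  with \<psi> show "\<exists>p. unit_interval.approx p \<and> unit_interval.var_le (\<lambda>t. of_real (g t) - p t) \<epsilon>" by blast
qed

lemma unit_interval_approx_convex:
  fixes g :: "real \<Rightarrow> real"
  assumes conv: "convex_on {a..b} g" and cont: "continuous_on {a..b} g"
    and ab: "a \<le> 0" "1 \<le> b" "a < 0 \<or> 1 < b"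
  shows "unit_interval.approx (\<lambda>t. of_real (g t))"
proof (cases "1 < b")
  case True
  then show ?thesis using ab
    by (intro unit_interval_approx_convex_right[of b] convex_on_subset[OF conv] continuous_on_subset[OF cont]) auto
next
  case False
  have "convex_on {0..1 - a} (\<lambda>t. g (1 - t))"
  proof (rule convex_onI)
    fix \<mu> x y :: real assume h: "0 < \<mu>" "\<mu> < 1" "x \<in> {0..1 - a}" "y \<in> {0..1 - a}"
    have "1 - ((1 - \<mu>) * x + \<mu> * y) = (1 - \<mu>) * (1 - x) + \<mu> * (1 - y)" by (simp add: algebra_simps)
    then show "g (1 - ((1 - \<mu>) *\<^sub>R x + \<mu> *\<^sub>R y)) \<le> (1 - \<mu>) * g (1 - x) + \<mu> * g (1 - y)"
      using convex_onD[OF conv, of \<mu> "1 - x" "1 - y"] h ab by auto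
  qed simp
  moreover have "continuous_on {0..1 - a} (\<lambda>t. g (1 - t))"
    by (intro continuous_on_compose2[OF cont] continuous_intros) (use ab in auto)
  ultimately have "unit_interval.approx (\<lambda>t. of_real (g (1 - t)))"
    using False ab by (intro unit_interval_approx_convex_right[of "1 - a"]) auto
  from unit_interval_approx_reflect[OF this] show ?thesis by simp
qed

section \<open>Variation on a set covered by charts\<close>

text \<open>A step that leaves a line without crossing it strictly becomes a strict crossing after a small
  parallel shift of the line.\<close>

lemma card_weak_crossing_le_vf:
  assumes a: "a \<noteq> 0"
  shows "card {i. i < length S - 1 \<and> (a \<bullet> (S ! i) \<le> b \<and> b < a \<bullet> (S ! Suc i) \<or> a \<bullet> (S ! Suc i) \<le> b \<and> b < a \<bullet> (S ! i))} \<le> vf S"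
proof -
  \<comment> \<open>All points of \<open>S\<close> strictly above the line stay strictly above after a shift by \<open>\<epsilon>\<close>.\<close>
  define W where "W = insert 1 ((\<lambda>z. a \<bullet> z - b) ` {z \<in> set S. b < a \<bullet> z})"
  have W: "finite W" "W \<noteq> {}" "\<forall>w\<in>W. 0 < w" by (auto simp: W_def)
  define \<epsilon> where "\<epsilon> = Min W / 2"
  have \<epsilon>0: "0 < \<epsilon>" using W by (simp add: \<epsilon>_def)
  have \<epsilon>: "b + \<epsilon> < a \<bullet> z" if "z \<in> set S" "b < a \<bullet> z" for z
  proof -
    have "a \<bullet> z - b \<in> W" using that by (auto simp: W_def)
    then have "Min W \<le> a \<bullet> z - b" using W by simp
    then show ?thesis using \<epsilon>0 by (simp add: \<epsilon>_def)
  qed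
  have "card {i. i < length S - 1 \<and> (a \<bullet> (S ! i) \<le> b \<and> b < a \<bullet> (S ! Suc i) \<or> a \<bullet> (S ! Suc i) \<le> b \<and> b < a \<bullet> (S ! i))}
      \<le> card {i. i < length S - 1 \<and> strictly_opposite a (b + \<epsilon>) (S ! i) (S ! Suc i)}"
  proof (rule card_mono)
    show "{i. i < length S - 1 \<and> (a \<bullet> (S ! i) \<le> b \<and> b < a \<bullet> (S ! Suc i) \<or> a \<bullet> (S ! Suc i) \<le> b \<and> b < a \<bullet> (S ! i))}
       \<subseteq> {i. i < length S - 1 \<and> strictly_opposite a (b + \<epsilon>) (S ! i) (S ! Suc i)}"
    proof
      fix i assume i: "i \<in> {i. i < length S - 1 \<and> (a \<bullet> (S ! i) \<le> b \<and> b < a \<bullet> (S ! Suc i) \<or> a \<bullet> (S ! Suc i) \<le> b \<and> b < a \<bullet> (S ! i))}"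
      then have "S ! i \<in> set S" "S ! Suc i \<in> set S" by auto
      with i \<epsilon>[of "S ! i"] \<epsilon>[of "S ! Suc i"] \<epsilon>0
      show "i \<in> {i. i < length S - 1 \<and> strictly_opposite a (b + \<epsilon>) (S ! i) (S ! Suc i)}"
        by (auto simp: strictly_opposite_def)
    qed
  qed auto
  also have "\<dots> \<le> vf S" by (rule card_strictly_opposite_le_vf[OF a])
  finally show ?thesis .
qed

lemma card_sign_change_le_vf:
  assumes a: "a \<noteq> 0"
  shows "card {i. i < length S - 1 \<and> sgn (a \<bullet> (S ! i) - b) \<noteq> sgn (a \<bullet> (S ! Suc i) - b)} \<le> 2 * vf S"
proof -
  let ?up = "{i. i < length S - 1 \<and> (a \<bullet> (S ! i) \<le> b \<and> b < a \<bullet> (S ! Suc i) \<or> a \<bullet> (S ! Suc i) \<le> b \<and> b < a \<bullet> (S ! i))}"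
  let ?dn = "{i. i < length S - 1 \<and> ((- a) \<bullet> (S ! i) \<le> - b \<and> - b < (- a) \<bullet> (S ! Suc i) \<or> (- a) \<bullet> (S ! Suc i) \<le> - b \<and> - b < (- a) \<bullet> (S ! i))}"
  have "{i. i < length S - 1 \<and> sgn (a \<bullet> (S ! i) - b) \<noteq> sgn (a \<bullet> (S ! Suc i) - b)} \<subseteq> ?up \<union> ?dn"
    by (auto simp: sgn_if split: if_splits)
  then have "card {i. i < length S - 1 \<and> sgn (a \<bullet> (S ! i) - b) \<noteq> sgn (a \<bullet> (S ! Suc i) - b)} \<le> card (?up \<union> ?dn)"
    by (intro card_mono) auto
  also have "\<dots> \<le> card ?up + card ?dn" by (rule card_Un_le)
  also have "\<dots> \<le> vf S + vf S"
    by (intro add_mono card_weak_crossing_le_vf) (use a in auto)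
  finally show ?thesis by simp
qed

text \<open>Points on the same side of all lines lie in the same face of the arrangement of lines; the value
  \<open>sgn = 0\<close>, for points on a line, counts as a side of its own.\<close>

definition same_side :: "(complex \<times> real) set \<Rightarrow> complex \<Rightarrow> complex \<Rightarrow> bool" where
  "same_side \<L> x y \<longleftrightarrow> (\<forall>(a, b)\<in>\<L>. sgn (a \<bullet> x - b) = sgn (a \<bullet> y - b))"

text \<open>A chart parametrises a piece of a curve by the affine function \<open>a \<bullet> z - c\<close>, normalised to the unit
  interval. The last three conditions are what remains of convexity: increasing lists have bounded
  variation factor, and the coordinates are absolutely continuous in the parameter.\<close>

definition chart :: "complex \<Rightarrow> real \<Rightarrow> (real \<Rightarrow> complex) \<Rightarrow> bool" where
  "chart a c r \<longleftrightarrow> (\<forall>t\<in>{0..1}. a \<bullet> r t - c = t) \<and> continuous_on {0..1} r \<and>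
     (\<forall>ts. sorted_wrt (<) ts \<and> set ts \<subseteq> {0..1} \<and> ts \<noteq> [] \<longrightarrow> vf (map r ts) \<le> 2) \<and>
     unit_interval.approx (\<lambda>t. of_real (Re (r t))) \<and> unit_interval.approx (\<lambda>t. of_real (Im (r t)))"

lemma chartD:
  assumes "chart a c r"
  shows "t \<in> {0..1} \<Longrightarrow> a \<bullet> r t - c = t" "continuous_on {0..1} r"
    "unit_interval.approx (\<lambda>t. of_real (Re (r t)))" "unit_interval.approx (\<lambda>t. of_real (Im (r t)))"
    "sorted_wrt (<) ts \<Longrightarrow> set ts \<subseteq> {0..1} \<Longrightarrow> ts \<noteq> [] \<Longrightarrow> vf (map r ts) \<le> 2"
  using assms unfolding chart_def by auto

lemma chart_normal_nonzero: "chart a c r \<Longrightarrow> a \<noteq> 0"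
  using chartD(1)[of a c r 0] chartD(1)[of a c r 1] by auto

lemma chart_inj:
  assumes "chart a c r" shows "inj_on r {0..1}"
proof (rule inj_onI)
  fix s t :: real assume st: "s \<in> {0..1}" "t \<in> {0..1}" "r s = r t"
  have "s = a \<bullet> r s - c" by (rule chartD(1)[OF assms st(1), symmetric])
  also have "\<dots> = t" unfolding st(3) by (rule chartD(1)[OF assms st(2)])
  finally show "s = t" .
qed

lemma chart_approx: "chart a c r \<Longrightarrow> unit_interval.approx r"
proof -
  assume "chart a c r"
  then have "unit_interval.approx (\<lambda>t. of_real (Re (r t)) + \<i> * of_real (Im (r t)))"
    by (intro unit_interval.approx_add unit_interval.approx_mult unit_interval.approx_const chartD)
  then show ?thesis by (simp add: complex_eq[symmetric])
qed

lemma (in compact_plane_set) var_le_chart: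
  assumes "chart a c r" "r ` {0..1} \<subseteq> \<sigma>" "var_le f K"
  shows "unit_interval.var_le (\<lambda>t. f (r t)) (2 * K)"
proof (rule unit_interval.var_leI)
  have K: "0 \<le> K" using assms(3) by (rule var_le_nonneg)
  show "norm (f (r t)) \<le> 2 * K" if "t \<in> {0..1}" for t
    using var_leD(1)[OF assms(3), of "r t"] assms(2) that K by (auto simp: image_subset_iff)
  fix ts w assume "(ts, w) \<in> interval_lists"
  then have ts: "sorted_wrt (<) ts" "set ts \<subseteq> {0..1}" "w = 1" by (auto simp: interval_lists_def)
  show "tvar (\<lambda>t. f (r t)) ts \<le> 2 * K * real w"
  proof (cases "ts = []")
    case True
    then show ?thesis using K by (simp add: tvar_def ts)
  next
    case False
    have "distinct_adj (map r ts)"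
    proof -
      have "distinct ts" using ts(1) by (simp add: strict_sorted_iff)
      then have "distinct (map r ts)"
        using inj_on_subset[OF chart_inj[OF assms(1)] ts(2)] by (simp add: distinct_map)
      from nth_eq_iff_index_eq[OF this] show ?thesis
        unfolding distinct_adj_conv_nth by (metis Suc_lessD n_not_Suc_n)
    qed
    then have "map r ts \<in> admissible_lists \<sigma>"
      using ts(2) assms(2) False by (auto simp: admissible_lists_def)
    then have "(map r ts, vf (map r ts)) \<in> weighted_plane_lists \<sigma>" by (auto simp: weighted_plane_lists_def)
    then have "tvar f (map r ts) \<le> K * real (vf (map r ts))" by (rule var_leD(2)[OF assms(3)])
    also have "\<dots> \<le> K * real 2"
      using chartD(5)[OF assms(1) ts(1,2) False] K by (intro mult_left_mono of_nat_mono) auto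
    finally show ?thesis by (simp add: tvar_map ts)
  qed
qed

text \<open>Charts overlap only at their ends, and finitely many lines separate points without a common chart.\<close>

locale charted_set = compact_plane_set +
  fixes \<B> :: "(complex \<times> real \<times> (real \<Rightarrow> complex)) set" and \<L> :: "(complex \<times> real) set"
  assumes finite_charts: "finite \<B>" and charts: "(a, c, r) \<in> \<B> \<Longrightarrow> chart a c r"
    and cover: "\<sigma> = (\<Union>(a, c, r)\<in>\<B>. r ` {0..1})"
    and interiors: "(a, c, r) \<in> \<B> \<Longrightarrow> (a', c', r') \<in> \<B> \<Longrightarrow> t \<in> {0<..<1} \<Longrightarrow> r t \<in> r' ` {0..1} \<Longrightarrow> (a, c, r) = (a', c', r')"
    and finite_lines: "finite \<L>" and lines: "(a, b) \<in> \<L> \<Longrightarrow> a \<noteq> 0"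
    and separation: "x \<in> \<sigma> \<Longrightarrow> y \<in> \<sigma> \<Longrightarrow> same_side \<L> x y \<Longrightarrow> \<exists>(a, c, r)\<in>\<B>. x \<in> r ` {0..1} \<and> y \<in> r ` {0..1}"
begin

lemma chart_image_subset:
  assumes "(a, c, r) \<in> \<B>" shows "r ` {0..1} \<subseteq> \<sigma>"
proof
  fix x assume "x \<in> r ` {0..1}"
  then have "x \<in> (case (a, c, r) of (a, c, r) \<Rightarrow> r ` {0..1})" by simp
  then have "x \<in> (\<Union>(a, c, r)\<in>\<B>. r ` {0..1})" by (rule UN_I[OF assms])
  then show "x \<in> \<sigma>" by (simp only: cover[symmetric])
qed

lemma in_cover:
  assumes "z \<in> \<sigma>" obtains a c r t where "(a, c, r) \<in> \<B>" "t \<in> {0..1}" "z = r t"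
proof -
  have "z \<in> (\<Union>(a, c, r)\<in>\<B>. r ` {0..1})" using assms by (simp only: cover[symmetric])
  then obtain b where "b \<in> \<B>" "z \<in> (case b of (a, c, r) \<Rightarrow> r ` {0..1})" by (rule UN_E)
  then show thesis using that by (cases b) auto
qed

lemma chart_inverse:
  assumes "(a, c, r) \<in> \<B>" "z \<in> r ` {0..1}"
  shows "a \<bullet> z - c \<in> {0..1} \<and> r (a \<bullet> z - c) = z"
proof -
  obtain t where "t \<in> {0..1}" "z = r t" using assms(2) by blast
  with chartD(1)[OF charts[OF assms(1)], of t] show ?thesis by simp
qed

lemma sum_increments_on_chart:
  assumes B: "(a, c, r) \<in> \<B>" and f: "unit_interval.var_le (\<lambda>t. f (r t)) M" and S: "set S \<subseteq> \<sigma>"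
  shows "(\<Sum>i | i < length S - 1 \<and> S ! i \<in> r ` {0..1} \<and> S ! Suc i \<in> r ` {0..1}. norm (f (S ! Suc i) - f (S ! i))) \<le> M * real (vf S)"
    (is "sum _ ?I \<le> _")
proof -
  have "(\<Sum>i\<in>?I. norm (f (r (a \<bullet> (S ! Suc i) - c)) - f (r (a \<bullet> (S ! i) - c)))) \<le> M * real (vf S)"
  proof (rule overlapping_increments)
    show "a \<bullet> (S ! i) - c \<in> {0..1} \<and> a \<bullet> (S ! Suc i) - c \<in> {0..1}" if "i \<in> ?I" for i
      using chart_inverse[OF B] that by auto
    show "tvar (\<lambda>t. f (r t)) ts \<le> M" if "sorted_wrt (<) ts" "set ts \<subseteq> {0..1}" for ts
      using unit_interval.var_leD(2)[OF f, of ts 1] that by (auto simp: interval_lists_def)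
    fix t
    have "{i \<in> ?I. a \<bullet> (S ! i) - c < t \<and> t < a \<bullet> (S ! Suc i) - c \<or> a \<bullet> (S ! Suc i) - c < t \<and> t < a \<bullet> (S ! i) - c}
        \<subseteq> {i. i < length S - 1 \<and> strictly_opposite a (c + t) (S ! i) (S ! Suc i)}"
      by (auto simp: strictly_opposite_def algebra_simps)
    then have "card {i \<in> ?I. a \<bullet> (S ! i) - c < t \<and> t < a \<bullet> (S ! Suc i) - c \<or> a \<bullet> (S ! Suc i) - c < t \<and> t < a \<bullet> (S ! i) - c}
        \<le> card {i. i < length S - 1 \<and> strictly_opposite a (c + t) (S ! i) (S ! Suc i)}"
      by (intro card_mono) auto
    also have "\<dots> \<le> vf S" by (rule card_strictly_opposite_le_vf[OF chart_normal_nonzero[OF charts[OF B]]])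
    finally show "card {i \<in> ?I. a \<bullet> (S ! i) - c < t \<and> t < a \<bullet> (S ! Suc i) - c \<or> a \<bullet> (S ! Suc i) - c < t \<and> t < a \<bullet> (S ! i) - c} \<le> vf S" .
  qed auto
  moreover have "f (r (a \<bullet> (S ! Suc i) - c)) = f (S ! Suc i)" "f (r (a \<bullet> (S ! i) - c)) = f (S ! i)" if "i \<in> ?I" for i
    using chart_inverse[OF B] that by auto
  ultimately show ?thesis by simp
qed

definition variation_constant :: real where
  "variation_constant = real (card \<B>) + 4 * real (card \<L>) + 1"

lemma variation_constant_pos: "variation_constant > 0"
  by (simp add: variation_constant_def add_nonneg_pos)

text \<open>A step of a list either stays on one chart, where the overlap estimate applies, or changes sides
  of one of the lines and contributes at most \<open>2 * M\<close>. A line is responsible for at most \<open>2 * vf S\<close> steps.\<close>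

theorem var_le_piecewise:
  assumes f: "\<And>a c r. (a, c, r) \<in> \<B> \<Longrightarrow> unit_interval.var_le (\<lambda>t. f (r t)) M"
  shows "var_le f (variation_constant * M)"
proof (rule var_leI)
  have "\<B> \<noteq> {}" using nonempty cover by auto
  then obtain a0 c0 r0 where "(a0, c0, r0) \<in> \<B>" by (metis ex_in_conv prod_cases3)
  then have M: "0 \<le> M" using f unit_interval.var_le_nonneg by blast
  have sup: "norm (f x) \<le> M" if x: "x \<in> \<sigma>" for x
  proof -
    obtain a c r t where B: "(a, c, r) \<in> \<B>" "t \<in> {0..1}" "x = r t" using in_cover[OF x] .
    then show ?thesis using unit_interval.var_leD(1)[OF f[OF B(1)] B(2)] by simp
  qed
  show "norm (f x) \<le> variation_constant * M" if "x \<in> \<sigma>" for x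
  proof -
    have "1 * M \<le> variation_constant * M" using M by (intro mult_right_mono) (simp_all add: variation_constant_def)
    with sup[OF that] show ?thesis by simp
  qed
  fix S w assume "(S, w) \<in> weighted_plane_lists \<sigma>"
  then have S: "set S \<subseteq> \<sigma>" "w = vf S" by (auto simp: weighted_plane_lists_def admissible_lists_def)
  let ?n = "length S - 1"
  define \<delta> where "\<delta> i = norm (f (S ! Suc i) - f (S ! i))" for i
  define on where "on b i \<longleftrightarrow> S ! i \<in> snd (snd b) ` {0..1} \<and> S ! Suc i \<in> snd (snd b) ` {0..1}" for b :: "complex \<times> real \<times> (real \<Rightarrow> complex)" and i
  define change where "change l i \<longleftrightarrow> sgn (fst l \<bullet> (S ! i) - snd l) \<noteq> sgn (fst l \<bullet> (S ! Suc i) - snd l)" for l :: "complex \<times> real" and i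
  have step: "\<delta> i \<le> (\<Sum>b\<in>\<B>. if on b i then \<delta> i else 0) + (\<Sum>l\<in>\<L>. if change l i then 2 * M else 0)" if i: "i < ?n" for i
  proof -
    have xy: "S ! i \<in> \<sigma>" "S ! Suc i \<in> \<sigma>" using S(1) i by (auto simp: subset_iff)
    have nn: "0 \<le> (\<Sum>b\<in>\<B>. if on b i then \<delta> i else 0)" "0 \<le> (\<Sum>l\<in>\<L>. if change l i then 2 * M else 0)"
      using M by (auto intro!: sum_nonneg simp: \<delta>_def)
    show ?thesis
    proof (cases "same_side \<L> (S ! i) (S ! Suc i)")
      case True
      then obtain b where b: "b \<in> \<B>" "on b i" using separation[OF xy] by (force simp: on_def)
      then have "\<delta> i \<le> (\<Sum>b\<in>\<B>. if on b i then \<delta> i else 0)"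
        using member_le_sum[of b \<B> "\<lambda>b. if on b i then \<delta> i else 0"] finite_charts by (auto simp: \<delta>_def)
      with nn show ?thesis by linarith
    next
      case False
      then obtain l where l: "l \<in> \<L>" "change l i" by (auto simp: same_side_def change_def)
      have "\<delta> i \<le> norm (f (S ! Suc i)) + norm (f (S ! i))" unfolding \<delta>_def by (rule norm_triangle_ineq4)
      also have "\<dots> \<le> 2 * M" using sup[OF xy(1)] sup[OF xy(2)] by simp
      also have "2 * M \<le> (\<Sum>l\<in>\<L>. if change l i then 2 * M else 0)"
        using member_le_sum[of l \<L> "\<lambda>l. if change l i then 2 * M else 0"] l finite_lines M by auto
      finally show ?thesis using nn by linarith
    qed
  qed
  have charts_sum: "(\<Sum>i<?n. if on b i then \<delta> i else 0) \<le> M * real (vf S)" if "b \<in> \<B>" for b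
  proof -
    obtain a c r where b: "b = (a, c, r)" by (cases b)
    have "(\<Sum>i<?n. if on b i then \<delta> i else 0) = (\<Sum>i | i < ?n \<and> S ! i \<in> r ` {0..1} \<and> S ! Suc i \<in> r ` {0..1}. \<delta> i)"
      by (simp add: sum.inter_filter[symmetric] on_def b lessThan_def)
    also have "\<dots> \<le> M * real (vf S)"
    proof -
      have B: "(a, c, r) \<in> \<B>" using that b by simp
      show ?thesis unfolding \<delta>_def by (rule sum_increments_on_chart[OF B f[OF B] S(1)])
    qed
    finally show ?thesis .
  qed
  have lines_sum: "(\<Sum>i<?n. if change l i then 2 * M else 0) \<le> 4 * M * real (vf S)" if "l \<in> \<L>" for l
  proof -
    have l: "fst l \<noteq> 0" using lines[of "fst l" "snd l"] that by simp
    have "(\<Sum>i<?n. if change l i then 2 * M else 0) = 2 * M * real (card {i. i < ?n \<and> change l i})"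
      by (simp add: sum.inter_filter[symmetric] lessThan_def)
    also have "\<dots> \<le> 2 * M * real (2 * vf S)"
      unfolding change_def using card_sign_change_le_vf[OF l] M by (intro mult_left_mono of_nat_mono) auto
    finally show ?thesis by simp
  qed
  have "tvar f S = (\<Sum>i<?n. \<delta> i)" by (simp add: tvar_def \<delta>_def)
  also have "\<dots> \<le> (\<Sum>i<?n. (\<Sum>b\<in>\<B>. if on b i then \<delta> i else 0) + (\<Sum>l\<in>\<L>. if change l i then 2 * M else 0))"
    by (intro sum_mono step) auto
  also have "\<dots> = (\<Sum>b\<in>\<B>. \<Sum>i<?n. if on b i then \<delta> i else 0) + (\<Sum>l\<in>\<L>. \<Sum>i<?n. if change l i then 2 * M else 0)"
    unfolding sum.distrib by (intro arg_cong2[of _ _ _ _ "(+)"] sum.swap)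
  also have "\<dots> \<le> (\<Sum>b\<in>\<B>. M * real (vf S)) + (\<Sum>l\<in>\<L>. 4 * M * real (vf S))"
    by (intro add_mono sum_mono charts_sum lines_sum)
  also have "\<dots> = (real (card \<B>) + 4 * real (card \<L>)) * M * real (vf S)"
    by (simp add: algebra_simps)
  also have "\<dots> \<le> variation_constant * M * real w"
    unfolding S(2) using M by (intro mult_right_mono) (auto simp: variation_constant_def)
  finally show "tvar f S \<le> variation_constant * M * real w" .
qed

end

section \<open>Functions that are absolutely continuous along every chart\<close>

lemma ex_interpolating_poly:
  fixes f :: "complex \<Rightarrow> complex"
  assumes "finite V"
  shows "\<exists>Q. \<forall>v\<in>V. poly Q v = f v"
  using assms
proof induction
  case empty
  then show ?case by simp
next
  case (insert v V)
  then obtain Q where Q: "\<forall>w\<in>V. poly Q w = f w" by blast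
  define N where "N = (\<Prod>w\<in>V. [:- w, 1:])"
  have N0: "poly N w = 0" if "w \<in> V" for w
    using insert(1) that by (auto simp: N_def poly_prod)
  have Nv: "poly N v \<noteq> 0" using insert(1,2) by (auto simp: N_def poly_prod)
  have "poly (Q + smult ((f v - poly Q v) / poly N v) N) w = f w" if "w \<in> insert v V" for w
    using that Nv N0 Q by (cases "w = v") auto
  then show ?case by blast
qed

text \<open>A C1 function that vanishes for \<open>t \<le> \<eta>\<close> and differs from the identity by an increasing function of
  size at most \<open>2 * \<eta>\<close>, hence with small variation. Its derivative is 0 up to \<open>\<eta>\<close>, then rises linearly
  to 1 at \<open>2 * \<eta>\<close>.\<close>

definition soft :: "real \<Rightarrow> real \<Rightarrow> real" where
  "soft \<eta> t = ((max 0 (t - \<eta>))\<^sup>2 - (max 0 (t - 2 * \<eta>))\<^sup>2) / (2 * \<eta>)"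

lemma soft_eq_0: "0 < \<eta> \<Longrightarrow> t \<le> \<eta> \<Longrightarrow> soft \<eta> t = 0"
  by (simp add: soft_def max_def)

lemma soft_at_1:
  assumes "0 < \<eta>" "\<eta> \<le> 1/4" shows "soft \<eta> 1 = 1 - 3/2 * \<eta>"
proof -
  have "(1 - \<eta>)\<^sup>2 - (1 - 2 * \<eta>)\<^sup>2 = (1 - 3/2 * \<eta>) * (2 * \<eta>)"
    by (simp add: power2_eq_square algebra_simps)
  then show ?thesis using assms by (simp add: soft_def)
qed

lemma has_derivative_soft:
  assumes "0 < \<eta>"
  shows "(soft \<eta> has_real_derivative (max 0 (t - \<eta>) - max 0 (t - 2 * \<eta>)) / \<eta>) (at t)"
proof -
  have "((\<lambda>t. (max 0 (t - c))\<^sup>2) has_real_derivative 2 * max 0 (t - c)) (at t)" for c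
  proof -
    have "((\<lambda>t. t - c) has_real_derivative 1) (at t)" by (auto intro!: derivative_eq_intros)
    from DERIV_chain2[where f = "\<lambda>t. (max 0 t)\<^sup>2" and g = "\<lambda>t. t - c", OF has_derivative_square_pos_part this]
    show ?thesis by simp
  qed
  then have "(soft \<eta> has_real_derivative (2 * max 0 (t - \<eta>) - 2 * max 0 (t - 2 * \<eta>)) / (2 * \<eta>)) (at t)"
    unfolding soft_def by (intro DERIV_cdivide DERIV_diff)
  moreover have "(2 * a - 2 * b) / (2 * \<eta>) = (a - b) / \<eta>" for a b
    using assms by (simp add: field_simps)
  ultimately show ?thesis by simp
qed

lemma soft_mono:
  assumes "0 < \<eta>" "s \<le> t" shows "soft \<eta> s \<le> soft \<eta> t"
proof (rule DERIV_nonneg_imp_nondecreasing[OF assms(2)])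
  fix x :: real
  have "0 \<le> (max 0 (x - \<eta>) - max 0 (x - 2 * \<eta>)) / \<eta>"
    using assms(1) by (intro divide_nonneg_pos) (auto simp: max_def)
  with has_derivative_soft[OF assms(1), of x]
  show "\<exists>y. (soft \<eta> has_real_derivative y) (at x) \<and> 0 \<le> y" by blast
qed

lemma soft_defect_mono:
  assumes "0 < \<eta>" "s \<le> t" shows "s - soft \<eta> s \<le> t - soft \<eta> t"
proof (rule DERIV_nonneg_imp_nondecreasing[OF assms(2)])
  fix x :: real
  have "((\<lambda>x. x - soft \<eta> x) has_real_derivative 1 - (max 0 (x - \<eta>) - max 0 (x - 2 * \<eta>)) / \<eta>) (at x)"
    by (intro DERIV_diff DERIV_ident has_derivative_soft assms)
  moreover have "0 \<le> 1 - (max 0 (x - \<eta>) - max 0 (x - 2 * \<eta>)) / \<eta>"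
    using assms(1) by (auto simp: field_simps max_def)
  ultimately show "\<exists>y. ((\<lambda>x. x - soft \<eta> x) has_real_derivative y) (at x) \<and> 0 \<le> y" by blast
qed

lemma soft_bounds:
  assumes "0 < \<eta>" "\<eta> \<le> 1/4" "t \<in> {0..1}"
  shows "0 \<le> soft \<eta> t" "soft \<eta> t \<le> 1" "0 \<le> t - soft \<eta> t" "t - soft \<eta> t \<le> 2 * \<eta>"
  using soft_mono[OF assms(1), of 0 t] soft_mono[OF assms(1), of t 1]
    soft_defect_mono[OF assms(1), of 0 t] soft_defect_mono[OF assms(1), of t 1]
    soft_eq_0[OF assms(1), of 0] soft_at_1[OF assms(1,2)] assms by auto

lemma unit_interval_var_le_antimono:
  assumes "\<And>x y. 0 \<le> x \<Longrightarrow> x \<le> y \<Longrightarrow> y \<le> 1 \<Longrightarrow> \<phi> y \<le> \<phi> x"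
    and "\<And>x. x \<in> {0..1} \<Longrightarrow> \<bar>\<phi> x\<bar> \<le> K"
  shows "unit_interval.var_le (\<lambda>t. of_real (\<phi> t)) (2 * K)"
proof -
  have "unit_interval.var_le (\<lambda>t. of_real (- \<phi> t)) (2 * K)"
    by (rule unit_interval_var_le_monotone) (use assms in auto)
  from unit_interval.var_le_uminus[OF this] show ?thesis by simp
qed

lemma soft_bump_var_le:
  assumes \<eta>: "0 < \<eta>" "\<eta> \<le> 1/4"
  shows "unit_interval.var_le (\<lambda>t. of_real (t * (1 - t)) - of_real (soft \<eta> t * soft \<eta> (1 - t))) (32 * \<eta>)"
proof -
  have a: "unit_interval.var_le (\<lambda>t. of_real (t - soft \<eta> t)) (2 * (2 * \<eta>))"
    by (rule unit_interval_var_le_monotone) (use soft_defect_mono soft_bounds \<eta> in auto)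
  have b: "unit_interval.var_le (\<lambda>t. of_real (1 - t)) (2 * 1)"
    by (rule unit_interval_var_le_antimono) auto
  have c: "unit_interval.var_le (\<lambda>t. of_real (soft \<eta> t)) (2 * 1)"
    by (rule unit_interval_var_le_monotone) (use soft_mono soft_bounds \<eta> in auto)
  have d: "unit_interval.var_le (\<lambda>t. of_real ((1 - t) - soft \<eta> (1 - t))) (2 * (2 * \<eta>))"
  proof (rule unit_interval_var_le_antimono)
    show "1 - y - soft \<eta> (1 - y) \<le> 1 - x - soft \<eta> (1 - x)" if "x \<le> y" for x y
      using soft_defect_mono[OF \<eta>(1), of "1 - y" "1 - x"] that by simp
    show "\<bar>1 - x - soft \<eta> (1 - x)\<bar> \<le> 2 * \<eta>" if "x \<in> {0..1}" for x
      using soft_bounds(3,4)[OF \<eta>, of "1 - x"] that by auto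
  qed
  have "unit_interval.var_le (\<lambda>t. of_real (t - soft \<eta> t) * of_real (1 - t) + of_real (soft \<eta> t) * of_real ((1 - t) - soft \<eta> (1 - t)))
      (2 * (2 * (2 * \<eta>)) * (2 * 1) + 2 * (2 * 1) * (2 * (2 * \<eta>)))"
    by (intro unit_interval.var_le_add unit_interval.var_le_mult a b c d)
  then show ?thesis by (simp add: algebra_simps)
qed

context charted_set
begin

definition extend0 :: "complex \<times> real \<times> (real \<Rightarrow> complex) \<Rightarrow> (real \<Rightarrow> complex) \<Rightarrow> complex \<Rightarrow> complex" where
  "extend0 b g z = (case b of (a, c, r) \<Rightarrow> if z \<in> r ` {0..1} then g (a \<bullet> z - c) else 0)"

lemma extend0_on_chart: "(a, c, r) \<in> \<B> \<Longrightarrow> t \<in> {0..1} \<Longrightarrow> extend0 (a, c, r) g (r t) = g t"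
  using chartD(1)[OF charts, of a c r t] by (simp add: extend0_def)

lemma extend0_diff: "extend0 b (\<lambda>t. g t - h t) z = extend0 b g z - extend0 b h z"
  by (cases b) (simp add: extend0_def)

text \<open>Therefore a function extended by zero from one chart vanishes on all other charts, provided that it
  vanishes at both ends.\<close>

lemma point_on_other_chart:
  assumes B: "(a, c, r) \<in> \<B>" "(a', c', r') \<in> \<B>" "(a, c, r) \<noteq> (a', c', r')"
    and t: "t \<in> {0..1}" "r' t \<in> r ` {0..1}"
  shows "r' t = r 0 \<or> r' t = r 1"
proof -
  obtain s where s: "s \<in> {0..1}" "r' t = r s" using t(2) by blast
  have "s \<notin> {0<..<1}" using interiors[OF B(1,2), of s] B(3) s t(1) by (metis imageI)
  with s show ?thesis by (auto simp: less_eq_real_def)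
qed

lemma extend0_var_le:
  assumes B: "(a, c, r) \<in> \<B>" and g: "unit_interval.var_le g \<delta>" "g 0 = 0" "g 1 = 0"
  shows "var_le (extend0 (a, c, r) g) (variation_constant * \<delta>)"
proof (rule var_le_piecewise)
  fix a' c' r' assume B': "(a', c', r') \<in> \<B>"
  show "unit_interval.var_le (\<lambda>t. extend0 (a, c, r) g (r' t)) \<delta>"
  proof (cases "(a', c', r') = (a, c, r)")
    case True
    then have "unit_interval.var_le (\<lambda>t. extend0 (a, c, r) g (r' t)) \<delta> \<longleftrightarrow> unit_interval.var_le g \<delta>"
      using extend0_on_chart[OF B] by (intro unit_interval.var_le_cong) auto
    with g(1) show ?thesis by simp
  next
    case False
    have "extend0 (a, c, r) g (r' t) = 0" if "t \<in> {0..1}" for t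
    proof (cases "r' t \<in> r ` {0..1}")
      case True
      with point_on_other_chart[OF B B' False[symmetric] that] extend0_on_chart[OF B, of 0] extend0_on_chart[OF B, of 1] g
      show ?thesis by auto
    qed (simp add: extend0_def)
    then have "unit_interval.var_le (\<lambda>t. extend0 (a, c, r) g (r' t)) \<delta> \<longleftrightarrow> unit_interval.var_le (\<lambda>_. 0) \<delta>"
      by (intro unit_interval.var_le_cong) auto
    moreover have "unit_interval.var_le (\<lambda>_. 0) \<delta>"
      using unit_interval.var_le_mono[OF unit_interval.var_le_const[of 0]] unit_interval.var_le_nonneg[OF g(1)] by simp
    ultimately show ?thesis by simp
  qed
qed

lemma approx_soft:
  assumes "approx (\<lambda>z. of_real (u z))" shows "approx (\<lambda>z. of_real (soft \<eta> (u z)))"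
proof -
  have "approx (\<lambda>z. of_real ((max 0 (u z - s))\<^sup>2))" for s
    by (rule approx_square_pos_part) (use approx_diff[OF assms approx_const[of "of_real s"]] in simp)
  from approx_mult[OF approx_diff[OF this[of \<eta>] this[of "2 * \<eta>"]] approx_const[of "of_real (1 / (2 * \<eta>))"]]
  show ?thesis by (simp add: soft_def)
qed

lemma approx_coordinate: "approx (\<lambda>z. of_real (a \<bullet> z - c))"
  using approx_diff[OF approx_inner[of a] approx_const[of "of_real c"]] by simp

text \<open>The product \<open>soft \<eta> t * soft \<eta> (1 - t)\<close> vanishes outside the compact part \<open>K\<close> of the piece. It may
  therefore be multiplied by a function in the closure that is 1 on \<open>K\<close> and 0 off the piece, and the
  result is the extension by zero.\<close>

lemma approx_extend0_soft_bump:
  assumes B: "(a, c, r) \<in> \<B>" and \<eta>: "0 < \<eta>" "\<eta> \<le> 1/4"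
  shows "approx (extend0 (a, c, r) (\<lambda>t. of_real (soft \<eta> t * soft \<eta> (1 - t))))"
proof -
  define K where "K = r ` {\<eta>..1 - \<eta>}"
  define R where "R = insert (r 0) (insert (r 1) (\<Union>(a', c', r')\<in>\<B> - {(a, c, r)}. r' ` {0..1}))"
  have "compact (r' ` A)" if "(a', c', r') \<in> \<B>" "compact A" "A \<subseteq> {0..1}" for a' c' r' and A :: "real set"
    using that chartD(2)[OF charts[OF that(1)]] by (meson compact_continuous_image continuous_on_subset)
  then have closed_im: "closed (r' ` A)" if "(a', c', r') \<in> \<B>" "compact A" "A \<subseteq> {0..1}" for a' c' r' and A :: "real set"
    using that compact_imp_closed by blast
  have "closed K" unfolding K_def using \<eta> by (intro closed_im[OF B]) auto
  moreover have "closed R"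
    unfolding R_def using finite_charts closed_im
    by (intro closed_insert closed_UN) auto
  moreover have "K \<inter> R = {}"
  proof -
    have "r t \<notin> R" if t: "t \<in> {\<eta>..1 - \<eta>}" for t
    proof -
      have "r t \<noteq> r 0" "r t \<noteq> r 1"
        using inj_onD[OF chart_inj[OF charts[OF B]], of t 0] inj_onD[OF chart_inj[OF charts[OF B]], of t 1] t \<eta> by auto
      moreover have "r t \<notin> r' ` {0..1}" if "(a', c', r') \<in> \<B>" "(a', c', r') \<noteq> (a, c, r)" for a' c' r'
        using interiors[OF B that(1), of t] that(2) t \<eta> by auto
      ultimately show ?thesis unfolding R_def by auto
    qed
    then show ?thesis unfolding K_def by blast
  qed
  ultimately obtain \<kappa> where \<kappa>: "approx (\<lambda>z. of_real (\<kappa> z))" "\<forall>z\<in>\<sigma> \<inter> R. \<kappa> z = 0" "\<forall>z\<in>\<sigma> \<inter> K. \<kappa> z = 1"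
    using approx_separating by blast
  define u where "u z = a \<bullet> z - c" for z
  have "approx (\<lambda>z. of_real (soft \<eta> (u z)) * of_real (soft \<eta> (1 - u z)) * of_real (\<kappa> z))"
    unfolding u_def using approx_diff[OF approx_const[of 1] approx_coordinate[of a c]]
    by (intro approx_mult \<kappa>(1) approx_soft approx_coordinate) simp
  moreover have "extend0 (a, c, r) (\<lambda>t. of_real (soft \<eta> t * soft \<eta> (1 - t))) z
      = of_real (soft \<eta> (u z)) * of_real (soft \<eta> (1 - u z)) * of_real (\<kappa> z)" if z: "z \<in> \<sigma>" for z
  proof (cases "z \<in> r ` {0..1}")
    case True
    then obtain t where t: "t \<in> {0..1}" "z = r t" by blast
    then have u: "u z = t" using chartD(1)[OF charts[OF B]] by (simp add: u_def)
    have "soft \<eta> t * soft \<eta> (1 - t) = soft \<eta> t * soft \<eta> (1 - t) * \<kappa> z"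
    proof (cases "t \<in> {\<eta>..1 - \<eta>}")
      case True
      then have "\<kappa> z = 1" using \<kappa>(3) z t(2) by (simp add: K_def)
      then show ?thesis by simp
    next
      case False
      then have "soft \<eta> t = 0 \<or> soft \<eta> (1 - t) = 0" using soft_eq_0[OF \<eta>(1)] by auto
      then show ?thesis by auto
    qed
    then have "complex_of_real (soft \<eta> t * soft \<eta> (1 - t)) = complex_of_real (soft \<eta> t * soft \<eta> (1 - t) * \<kappa> z)" by (rule arg_cong)
    then show ?thesis using extend0_on_chart[OF B t(1)] u t(2) by simp
  next
    case False
    obtain a' c' r' t where "(a', c', r') \<in> \<B>" "t \<in> {0..1}" "z = r' t" using in_cover[OF z] .
    with False have "z \<in> R" unfolding R_def by force
    with \<kappa>(2) z False show ?thesis by (simp add: extend0_def)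
  qed
  ultimately show ?thesis by (subst approx_cong) auto
qed

lemma approx_extend0_bump:
  assumes B: "(a, c, r) \<in> \<B>"
  shows "approx (extend0 (a, c, r) (\<lambda>t. of_real (t * (1 - t))))"
proof (rule approx_closed)
  fix \<epsilon> :: real assume "\<epsilon> > 0"
  define \<eta> where "\<eta> = min (1/4) (\<epsilon> / (32 * variation_constant))"
  have \<eta>: "0 < \<eta>" "\<eta> \<le> 1/4" using \<open>\<epsilon> > 0\<close> variation_constant_pos by (auto simp: \<eta>_def)
  have "32 * variation_constant * \<eta> \<le> 32 * variation_constant * (\<epsilon> / (32 * variation_constant))"
    using variation_constant_pos by (intro mult_left_mono) (auto simp: \<eta>_def)
  then have le: "variation_constant * (32 * \<eta>) \<le> \<epsilon>" using variation_constant_pos by simp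
  have "var_le (extend0 (a, c, r) (\<lambda>t. of_real (t * (1 - t)) - of_real (soft \<eta> t * soft \<eta> (1 - t)))) (variation_constant * (32 * \<eta>))"
    using \<eta> by (intro extend0_var_le[OF B soft_bump_var_le]) (auto simp: soft_eq_0)
  from var_le_mono[OF this le]
  have "var_le (\<lambda>z. extend0 (a, c, r) (\<lambda>t. of_real (t * (1 - t))) z - extend0 (a, c, r) (\<lambda>t. of_real (soft \<eta> t * soft \<eta> (1 - t))) z) \<epsilon>"
    unfolding extend0_diff[abs_def] .
  with approx_extend0_soft_bump[OF B \<eta>]
  show "\<exists>g. approx g \<and> var_le (\<lambda>z. extend0 (a, c, r) (\<lambda>t. of_real (t * (1 - t))) z - g z) \<epsilon>" by blast
qed

text \<open>A polynomial with roots 0 and 1 is a multiple of \<open>t * (1 - t)\<close>, and the cofactor may be taken as a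
  polynomial in \<open>a \<bullet> z - c\<close> on the whole plane.\<close>

lemma approx_extend0_poly:
  assumes B: "(a, c, r) \<in> \<B>" and q: "poly q 0 = 0" "poly q 1 = 0"
  shows "approx (extend0 (a, c, r) (\<lambda>t. poly q (of_real t)))"
proof -
  obtain q1 where q1: "q = [:0, 1:] * q1" using q(1) poly_eq_0_iff_dvd[of q 0] by (auto elim: dvdE)
  have "poly q1 1 = 0" using q(2) q1 by simp
  then obtain s where s: "q1 = [:- 1, 1:] * s" using poly_eq_0_iff_dvd[of q1 1] by (auto elim: dvdE)
  have "poly q (of_real t) = poly (- s) (of_real t) * of_real (t * (1 - t))" for t :: real
    by (simp add: q1 s algebra_simps)
  then have "extend0 (a, c, r) (\<lambda>t. poly q (of_real t)) = (\<lambda>z. poly (- s) (of_real (a \<bullet> z - c)) * extend0 (a, c, r) (\<lambda>t. of_real (t * (1 - t))) z)"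
    by (simp add: extend0_def fun_eq_iff)
  then show ?thesis
    by (simp only:) (intro approx_mult approx_poly approx_coordinate approx_extend0_bump[OF B])
qed

lemma approx_extend0:
  assumes B: "(a, c, r) \<in> \<B>" and \<phi>: "unit_interval.approx \<phi>" "\<phi> 0 = 0" "\<phi> 1 = 0"
  shows "approx (extend0 (a, c, r) \<phi>)"
proof (rule approx_closed)
  fix \<epsilon> :: real assume "\<epsilon> > 0"
  define \<delta> where "\<delta> = \<epsilon> / (10 * variation_constant)"
  have \<delta>: "0 < \<delta>" "variation_constant * (10 * \<delta>) = \<epsilon>"
    using \<open>\<epsilon> > 0\<close> variation_constant_pos by (auto simp: \<delta>_def)
  obtain p where p: "p \<in> interval_poly" "unit_interval.var_le (\<lambda>t. \<phi> t - p t) \<delta>"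
    using \<phi>(1) \<delta>(1) unfolding unit_interval.approx_def by blast
  then obtain q where q: "p = (\<lambda>t. poly q (of_real t))" unfolding interval_poly_def by blast
  \<comment> \<open>Subtracting the affine function \<open>l\<close> makes the approximation vanish at both ends.\<close>
  define l where "l = [:poly q 0, poly q 1 - poly q 0:]"
  have q0: "norm (poly q 0) \<le> \<delta>" and q1: "norm (poly q 1) \<le> \<delta>"
    using unit_interval.var_leD(1)[OF p(2), of 0] unit_interval.var_leD(1)[OF p(2), of 1] \<phi>(2,3) by (simp_all add: q)
  have id: "unit_interval.var_le (\<lambda>t. of_real t) (2 * 1)"
    by (rule unit_interval_var_le_monotone) auto
  have "unit_interval.var_le (\<lambda>t. poly q 0 + (poly q 1 - poly q 0) * of_real t)
      (norm (poly q 0) + 2 * norm (poly q 1 - poly q 0) * (2 * 1))"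
    by (intro unit_interval.var_le_add unit_interval.var_le_mult unit_interval.var_le_const id)
  moreover have "norm (poly q 0) + 2 * norm (poly q 1 - poly q 0) * (2 * 1) \<le> 9 * \<delta>"
    using norm_triangle_ineq4[of "poly q 1" "poly q 0"] q0 q1 by simp
  ultimately have l: "unit_interval.var_le (\<lambda>t. poly l (of_real t)) (9 * \<delta>)"
    using unit_interval.var_le_mono by (fastforce simp: l_def mult.commute)
  have "unit_interval.var_le (\<lambda>t. \<phi> t - poly (q - l) (of_real t)) (10 * \<delta>)"
    using unit_interval.var_le_add[OF p(2) l] by (simp add: q algebra_simps)
  from extend0_var_le[OF B this]
  have "var_le (\<lambda>z. extend0 (a, c, r) \<phi> z - extend0 (a, c, r) (\<lambda>t. poly (q - l) (of_real t)) z) \<epsilon>"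
    using \<phi>(2,3) \<delta>(2) by (simp add: extend0_diff[abs_def] l_def)
  moreover have "approx (extend0 (a, c, r) (\<lambda>t. poly (q - l) (of_real t)))"
    by (rule approx_extend0_poly[OF B]) (simp_all add: l_def)
  ultimately show "\<exists>g. approx g \<and> var_le (\<lambda>z. extend0 (a, c, r) \<phi> z - g z) \<epsilon>" by blast
qed

text \<open>After subtraction of a polynomial that interpolates \<open>f\<close> at the ends of the charts, \<open>f\<close> is the sum of
  its restrictions to the charts, each extended by zero.\<close>

theorem approx_piecewise:
  assumes f: "\<And>a c r. (a, c, r) \<in> \<B> \<Longrightarrow> unit_interval.approx (\<lambda>t. f (r t))"
  shows "approx f"
proof -
  define V where "V = (\<Union>(a, c, r)\<in>\<B>. {r 0, r 1})"
  have "finite V" unfolding V_def using finite_charts by auto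
  then obtain Q where Q: "\<forall>v\<in>V. poly Q v = f v" using ex_interpolating_poly by blast
  define g where "g z = f z - poly Q z" for z
  have gV: "g (r 0) = 0" "g (r 1) = 0" if "(a, c, r) \<in> \<B>" for a c r
    using that Q by (force simp: g_def V_def)+
  define F where "F b = extend0 b (\<lambda>t. g (snd (snd b) t))" for b :: "complex \<times> real \<times> (real \<Rightarrow> complex)"
  have Fap: "approx (F b)" if b: "b \<in> \<B>" for b
  proof -
    obtain a c r where abc: "b = (a, c, r)" by (cases b)
    have B: "(a, c, r) \<in> \<B>" using b abc by simp
    have "unit_interval.approx (\<lambda>t. g (r t))" unfolding g_def
      by (intro unit_interval.approx_diff f[OF B] unit_interval.approx_poly chart_approx[OF charts[OF B]])
    then show ?thesis unfolding F_def abc by (intro approx_extend0[OF B]) (auto simp: gV[OF B])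
  qed
  have Fval: "F (a, c, r) z = (if z \<in> r ` {0..1} then g z else 0)" if "(a, c, r) \<in> \<B>" for a c r z
    using chart_inverse[OF that, of z] by (auto simp: F_def extend0_def)
  have "f z = (\<Sum>b\<in>\<B>. F b z) + poly Q z" if z: "z \<in> \<sigma>" for z
  proof -
    obtain a c r t where B: "(a, c, r) \<in> \<B>" "t \<in> {0..1}" "z = r t" using in_cover[OF z] .
    have "(\<Sum>b\<in>\<B>. F b z) = (\<Sum>b\<in>\<B>. if b = (a, c, r) then g z else 0)"
    proof (rule sum.cong[OF refl])
      fix b assume b: "b \<in> \<B>"
      obtain a' c' r' where b': "b = (a', c', r')" by (cases b)
      show "F b z = (if b = (a, c, r) then g z else 0)"
      proof (cases "g z = 0")
        case True
        then show ?thesis using Fval b b' by auto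
      next
        case False
        then have "t \<in> {0<..<1}" using gV[OF B(1)] B by (auto simp: less_eq_real_def)
        with interiors[OF B(1), of a' c' r' t] b b' B Fval show ?thesis by auto
      qed
    qed
    also have "\<dots> = g z" using finite_charts B(1) by simp
    finally show ?thesis by (simp add: g_def)
  qed
  moreover have "approx (\<lambda>z. (\<Sum>b\<in>\<B>. F b z) + poly Q z)"
    by (intro approx_add approx_sum Fap approx_poly approx_id)
  ultimately show ?thesis by (subst approx_cong) auto
qed

end

abbreviation plane_var_le :: "complex set \<Rightarrow> (complex \<Rightarrow> complex) \<Rightarrow> real \<Rightarrow> bool" where
  "plane_var_le \<sigma> \<equiv> weighted_lists.var_le \<sigma> (weighted_plane_lists \<sigma>)"

abbreviation plane_approx :: "complex set \<Rightarrow> (complex \<Rightarrow> complex) \<Rightarrow> bool" where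
  "plane_approx \<sigma> \<equiv> function_algebra_closure.approx \<sigma> (weighted_plane_lists \<sigma>) plane_poly"

text \<open>The bound passes through the variation along charts, which \<open>k\<close> preserves. For the closure it then
  suffices to treat polynomials, and hence the two coordinates of \<open>k\<close>; along the charts these are the
  coordinates of the charts of \<open>\<sigma>\<close>.\<close>

theorem charted_transport:
  assumes S: "charted_set \<sigma> \<B> \<L>" and T: "charted_set \<tau> \<B>' \<L>'"
    and k: "\<And>a' c' r'. (a', c', r') \<in> \<B>' \<Longrightarrow> \<exists>a c r. (a, c, r) \<in> \<B> \<and> (\<forall>t\<in>{0..1}. k (r' t) = r t)"
  shows "\<exists>C>0. \<forall>f K. plane_var_le \<sigma> f K \<longrightarrow> plane_var_le \<tau> (\<lambda>z. f (k z)) (C * K)"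
    and "plane_approx \<sigma> f \<Longrightarrow> plane_approx \<tau> (\<lambda>z. f (k z))"
proof -
  interpret S: charted_set \<sigma> \<B> \<L> by (rule S)
  interpret T: charted_set \<tau> \<B>' \<L>' by (rule T)
  have bound: "T.var_le (\<lambda>z. f (k z)) (T.variation_constant * (2 * K))" if f: "S.var_le f K" for f K
  proof (rule T.var_le_piecewise)
    fix a' c' r' assume "(a', c', r') \<in> \<B>'"
    then obtain a c r where B: "(a, c, r) \<in> \<B>" and kr: "\<And>t. t \<in> {0..1} \<Longrightarrow> k (r' t) = r t" using k by blast
    have "unit_interval.var_le (\<lambda>t. f (r t)) (2 * K)"
      by (rule S.var_le_chart[OF S.charts[OF B] S.chart_image_subset[OF B] f])
    moreover have "unit_interval.var_le (\<lambda>t. f (k (r' t))) (2 * K) \<longleftrightarrow> unit_interval.var_le (\<lambda>t. f (r t)) (2 * K)"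
      by (rule unit_interval.var_le_cong) (simp add: kr)
    ultimately show "unit_interval.var_le (\<lambda>t. f (k (r' t))) (2 * K)" by simp
  qed
  then show "\<exists>C>0. \<forall>f K. S.var_le f K \<longrightarrow> T.var_le (\<lambda>z. f (k z)) (C * K)"
    using T.variation_constant_pos by (intro exI[of _ "T.variation_constant * 2"]) (auto simp: mult.assoc)
  assume f: "S.approx f"
  have coord: "T.approx (\<lambda>z. of_real (Re (k z)))" "T.approx (\<lambda>z. of_real (Im (k z)))"
  proof -
    have "unit_interval.approx (\<lambda>t. of_real (Re (k (r' t))))" "unit_interval.approx (\<lambda>t. of_real (Im (k (r' t))))"
      if B': "(a', c', r') \<in> \<B>'" for a' c' r'
    proof -
      obtain a c r where B: "(a, c, r) \<in> \<B>" and kr: "\<And>t. t \<in> {0..1} \<Longrightarrow> k (r' t) = r t" using k[OF B'] by blast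
      have "unit_interval.approx (\<lambda>t. of_real (Re (k (r' t)))) \<longleftrightarrow> unit_interval.approx (\<lambda>t. of_real (Re (r t)))"
        "unit_interval.approx (\<lambda>t. of_real (Im (k (r' t)))) \<longleftrightarrow> unit_interval.approx (\<lambda>t. of_real (Im (r t)))"
        by (rule unit_interval.approx_cong; simp add: kr)+
      with chartD(3,4)[OF S.charts[OF B]]
      show "unit_interval.approx (\<lambda>t. of_real (Re (k (r' t))))" "unit_interval.approx (\<lambda>t. of_real (Im (k (r' t))))" by auto
    qed
    then show "T.approx (\<lambda>z. of_real (Re (k z)))" "T.approx (\<lambda>z. of_real (Im (k z)))"
      by (blast intro: T.approx_piecewise)+
  qed
  show "T.approx (\<lambda>z. f (k z))"
  proof (rule T.approx_closed)
    fix \<epsilon> :: real assume "\<epsilon> > 0"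
    define \<delta> where "\<delta> = \<epsilon> / (2 * T.variation_constant)"
    have \<delta>: "0 < \<delta>" "T.variation_constant * (2 * \<delta>) = \<epsilon>"
      using \<open>\<epsilon> > 0\<close> T.variation_constant_pos by (auto simp: \<delta>_def)
    obtain p where p: "p \<in> plane_poly" "S.var_le (\<lambda>z. f z - p z) \<delta>" using f \<delta>(1) unfolding S.approx_def by blast
    from p(1) obtain c N where c: "p = (\<lambda>z. \<Sum>n\<le>N. \<Sum>m\<le>N. c n m * of_real (Re z) ^ n * of_real (Im z) ^ m)"
      unfolding plane_poly_def by blast
    have "T.approx (\<lambda>z. p (k z))" unfolding c
      by (intro T.approx_sum T.approx_mult T.approx_power T.approx_const coord)
    with bound[OF p(2)] \<delta>(2) show "\<exists>g. T.approx g \<and> T.var_le (\<lambda>z. f (k z) - g z) \<epsilon>" by auto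
  qed
qed


lemma topspace_BV_topology: "topspace (BV_topology \<rho>) = BV \<rho>"
proof -
  interpret BV: Metric_space "BV \<rho>" "BV_dist \<rho>" by (rule Metric_space_BV)
  show ?thesis by (simp add: BV_topology_def)
qed

lemma AC_subset_BV: "AC \<rho> \<subseteq> BV \<rho>"
  unfolding AC_def topspace_BV_topology[symmetric] by (rule closure_of_subset_topspace)

lemma topspace_AC_topology: "topspace (AC_topology \<rho>) = AC \<rho>"
  unfolding AC_topology_def topspace_subtopology topspace_BV_topology using AC_subset_BV by blast

lemma continuous_map_transport:
  assumes S: "charted_set \<sigma> \<B> \<L>" and T: "charted_set \<tau> \<B>' \<L>'"
    and k: "\<And>a' c' r'. (a', c', r') \<in> \<B>' \<Longrightarrow> \<exists>a c r. (a, c, r) \<in> \<B> \<and> (\<forall>t\<in>{0..1}. k (r' t) = r t)"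
  shows "continuous_map (AC_topology \<sigma>) (AC_topology \<tau>) (\<lambda>f z. if z \<in> \<tau> then f (k z) else 0)"
proof -
  interpret S: charted_set \<sigma> \<B> \<L> by (rule S)
  interpret T: charted_set \<tau> \<B>' \<L>' by (rule T)
  interpret BS: Metric_space "BV \<sigma>" "BV_dist \<sigma>" by (rule Metric_space_BV)
  let ?\<Phi> = "\<lambda>f z. if z \<in> \<tau> then f (k z) else 0"
  obtain C where C: "C > 0" "\<And>f K. S.var_le f K \<Longrightarrow> T.var_le (\<lambda>z. f (k z)) (C * K)"
    using charted_transport(1)[OF S T, of k] k by blast
  have restr: "T.var_le (?\<Phi> f) K \<longleftrightarrow> T.var_le (\<lambda>z. f (k z)) K" for f :: "complex \<Rightarrow> complex" and K
    by (rule T.var_le_cong) simp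
  have restr2: "T.var_le (\<lambda>z. ?\<Phi> f z - ?\<Phi> g z) K \<longleftrightarrow> T.var_le (\<lambda>z. f (k z) - g (k z)) K" for f g :: "complex \<Rightarrow> complex" and K
    by (rule T.var_le_cong) simp
  have into: "?\<Phi> f \<in> BV \<tau>" if f: "f \<in> BV \<sigma>" for f
  proof -
    obtain K where "S.var_le f K" using f unfolding S.BV_iff by blast
    from C(2)[OF this] show ?thesis unfolding T.BV_iff restr by auto
  qed
  have "continuous_map (BV_topology \<sigma>) (BV_topology \<tau>) ?\<Phi>"
    unfolding BV_topology_def BS.metric_continuous_map[OF Metric_space_BV]
  proof (intro conjI ballI allI impI)
    show "?\<Phi> ` BV \<sigma> \<subseteq> BV \<tau>" using into by blast
    fix f \<epsilon> assume f: "f \<in> BV \<sigma>" and \<epsilon>: "(\<epsilon> :: real) > 0"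
    have "BV_dist \<tau> (?\<Phi> f) (?\<Phi> g) < \<epsilon>" if g: "g \<in> BV \<sigma>" "BV_dist \<sigma> f g < \<epsilon> / (2 * C)" for g
    proof -
      have "T.var_le (\<lambda>z. ?\<Phi> f z - ?\<Phi> g z) (C * BV_dist \<sigma> f g)"
        unfolding restr2 by (rule C(2)[OF S.var_le_BV_dist[OF f g(1)]])
      then have "BV_dist \<tau> (?\<Phi> f) (?\<Phi> g) \<le> 2 * (C * BV_dist \<sigma> f g)" by (rule T.BV_dist_le)
      also have "\<dots> < \<epsilon>" using g(2) C(1) by (simp add: field_simps)
      finally show ?thesis .
    qed
    moreover have "\<epsilon> / (2 * C) > 0" using \<epsilon> C(1) by simp
    ultimately show "\<exists>\<delta>>0. \<forall>g. g \<in> BV \<sigma> \<and> BV_dist \<sigma> f g < \<delta> \<longrightarrow> BV_dist \<tau> (?\<Phi> f) (?\<Phi> g) < \<epsilon>"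
      by blast
  qed
  moreover have "?\<Phi> f \<in> AC \<tau>" if "f \<in> AC \<sigma>" for f
  proof (rule T.AC_restrict)
    have "S.approx f" using that by (simp add: S.AC_iff)
    then show "T.approx (\<lambda>z. f (k z))" using charted_transport(2)[OF S T, of k f] k by blast
  qed
  ultimately show ?thesis
    unfolding AC_topology_def continuous_map_in_subtopology
    using topspace_AC_topology[of \<sigma>] by (auto simp: AC_topology_def intro: continuous_map_from_subtopology)
qed

theorem AC_isomorphic_if_chart_bijection:
  assumes S: "charted_set \<sigma> \<B> \<L>" and T: "charted_set \<tau> \<B>' \<L>'"
    and k: "\<And>a' c' r'. (a', c', r') \<in> \<B>' \<Longrightarrow> \<exists>a c r. (a, c, r) \<in> \<B> \<and> (\<forall>t\<in>{0..1}. k (r' t) = r t)"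
    and h: "\<And>a c r. (a, c, r) \<in> \<B> \<Longrightarrow> \<exists>a' c' r'. (a', c', r') \<in> \<B>' \<and> (\<forall>t\<in>{0..1}. h (r t) = r' t)"
    and kh: "\<And>z. z \<in> \<sigma> \<Longrightarrow> h z \<in> \<tau> \<and> k (h z) = z" and hk: "\<And>z. z \<in> \<tau> \<Longrightarrow> k z \<in> \<sigma> \<and> h (k z) = z"
  shows "AC_isomorphic \<sigma> \<tau>"
proof -
  interpret S: charted_set \<sigma> \<B> \<L> by (rule S)
  interpret T: charted_set \<tau> \<B>' \<L>' by (rule T)
  let ?\<Phi> = "\<lambda>(f :: complex \<Rightarrow> complex) z. if z \<in> \<tau> then f (k z) else 0"
  let ?\<Psi> = "\<lambda>(f :: complex \<Rightarrow> complex) z. if z \<in> \<sigma> then f (h z) else 0"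
  have "homeomorphic_maps (AC_topology \<sigma>) (AC_topology \<tau>) ?\<Phi> ?\<Psi>"
    unfolding homeomorphic_maps_def topspace_AC_topology
  proof (intro conjI ballI)
    show "continuous_map (AC_topology \<sigma>) (AC_topology \<tau>) ?\<Phi>"
      by (rule continuous_map_transport[OF S T k])
    show "continuous_map (AC_topology \<tau>) (AC_topology \<sigma>) ?\<Psi>"
      by (rule continuous_map_transport[OF T S h])
    show "?\<Psi> (?\<Phi> f) = f" if "f \<in> AC \<sigma>" for f
      using that kh by (auto simp: S.AC_iff fun_eq_iff)
    show "?\<Phi> (?\<Psi> f) = f" if "f \<in> AC \<tau>" for f
      using that hk by (auto simp: T.AC_iff fun_eq_iff)
  qed
  then have "homeomorphic_map (AC_topology \<sigma>) (AC_topology \<tau>) ?\<Phi>" by (rule homeomorphic_maps_imp_map)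
  then show ?thesis
    unfolding AC_isomorphic_def by (intro exI[of _ ?\<Phi>]) (simp add: fun_eq_iff)
qed

section \<open>Convex graphs are charts\<close>

lemma vf_leI:
  assumes "\<And>a b. a \<noteq> 0 \<Longrightarrow> vf_line S a b \<le> m" shows "vf S \<le> m"
  unfolding vf_def
proof (rule Max.boundedI[OF finite_vf_lines])
  have "vf_line S 1 0 \<in> {vf_line S a b | a b. a \<noteq> 0}"
    by (intro CollectI exI[of _ "1::complex"] exI[of _ "0::real"]) simp
  then show "{vf_line S a b | a b. a \<noteq> 0} \<noteq> {}" by blast
qed (use assms in auto)

lemma vf_line_uminus: "vf_line S (- a) (- b) = vf_line S a b"
proof -
  have "crossing (- a) (- b) S i = crossing a b S i" for i
    by (auto simp: crossing_def strictly_opposite_def)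
  then show ?thesis by (simp add: vf_line_def)
qed

text \<open>Along a convex sequence of signed distances to the line the sign pattern is positive, then
  nonpositive, then positive. So there is at most one crossing downwards, where starting on the line
  counts as such, and at most one upwards.\<close>

lemma vf_line_convex_list:
  assumes conv: "\<And>i j k. i < j \<Longrightarrow> j < k \<Longrightarrow> k < length S \<Longrightarrow>
      \<exists>l. 0 < l \<and> l < 1 \<and> a \<bullet> (S ! j) - b \<le> (1 - l) * (a \<bullet> (S ! i) - b) + l * (a \<bullet> (S ! k) - b)"
  shows "vf_line S a b \<le> 2"
proof (cases "length S = 1")
  case False
  define w where "w i = a \<bullet> (S ! i) - b" for i
  have up: "0 < w k" if ijk: "i < j" "j < k" "k < length S" "w i \<le> 0 \<and> 0 < w j \<or> w i < 0 \<and> 0 \<le> w j" for i j k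
  proof (rule ccontr)
    assume k: "\<not> 0 < w k"
    obtain l where l: "0 < l" "l < 1" "w j \<le> (1 - l) * w i + l * w k"
      using conv[OF ijk(1-3)] unfolding w_def by blast
    have "l * w k \<le> 0" using l k by (simp add: mult_nonneg_nonpos)
    moreover have "w i \<le> 0 \<Longrightarrow> (1 - l) * w i \<le> 0" "w i < 0 \<Longrightarrow> (1 - l) * w i < 0"
      using l by (simp_all add: mult_nonneg_nonpos mult_pos_neg)
    ultimately show False using l(3) ijk(4) by linarith
  qed
  define Dn where "Dn = {i. i < length S - 1 \<and> (0 < w i \<and> w (Suc i) \<le> 0 \<or> i = 0 \<and> w 0 = 0)}"
  define Up where "Up = {i. i < length S - 1 \<and> w i < 0 \<and> 0 \<le> w (Suc i)}"
  have Dn: "False" if ij: "i \<in> Dn" "j \<in> Dn" "i < j" for i j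
  proof -
    have j: "0 < w j" "w (Suc j) \<le> 0" "Suc j < length S" using ij by (auto simp: Dn_def)
    show False
    proof (cases "0 < w i")
      case True
      then have "w (Suc i) \<le> 0" using ij by (auto simp: Dn_def)
      then have "Suc i \<noteq> j" using j by auto
      then have "Suc i < j" using ij by simp
      with up[of "Suc i" j "Suc j"] j \<open>w (Suc i) \<le> 0\<close> show False by auto
    next
      case False
      with up[of i j "Suc j"] j ij show False by (auto simp: Dn_def)
    qed
  qed
  have Up: "False" if ij: "i \<in> Up" "j \<in> Up" "i < j" for i j
  proof -
    have "Suc i \<noteq> j" using ij by (auto simp: Up_def)
    then have "Suc i < j" using ij by simp
    moreover have "j < length S" using ij by (auto simp: Up_def)
    ultimately show False using up[of i "Suc i" j] ij by (auto simp: Up_def)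
  qed
  have fin: "finite Dn" "finite Up" by (auto simp: Dn_def Up_def)
  have "card Dn \<le> Suc 0" unfolding card_le_Suc0_iff_eq[OF fin(1)] using Dn by (metis linorder_neqE_nat)
  moreover have "card Up \<le> Suc 0" unfolding card_le_Suc0_iff_eq[OF fin(2)] using Up by (metis linorder_neqE_nat)
  moreover have "{i. i < length S - 1 \<and> crossing a b S i} \<subseteq> Dn \<union> Up"
    by (auto simp: crossing_def strictly_opposite_def Dn_def Up_def w_def)
  then have "card {i. i < length S - 1 \<and> crossing a b S i} \<le> card (Dn \<union> Up)" using fin by (intro card_mono) auto
  moreover have "card (Dn \<union> Up) \<le> card Dn + card Up" by (rule card_Un_le)
  ultimately show ?thesis using False by (simp add: vf_line_def)
qed (simp add: vf_line_def)

lemma vf_convex_graph: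
  assumes conv: "\<And>a. convex_on {0..1::real} (\<lambda>t. a \<bullet> r t) \<or> convex_on {0..1} (\<lambda>t. - (a \<bullet> r t))"
    and ts: "sorted_wrt (<) ts" "set ts \<subseteq> {0..1}"
  shows "vf (map r ts) \<le> 2"
proof (rule vf_leI)
  fix a :: complex and b :: real
  have *: "vf_line (map r ts) a b \<le> 2" if c: "convex_on {0..1} (\<lambda>t. a \<bullet> r t)" for a b
  proof (rule vf_line_convex_list)
    fix i j k assume ijk: "i < j" "j < k" "k < length (map r ts)"
    define x y z where "x = ts ! i" and "y = ts ! j" and "z = ts ! k"
    have "x \<in> set ts" "z \<in> set ts" using ijk by (auto simp: x_def z_def)
    then have "x \<in> {0..1}" "z \<in> {0..1}" using ts(2) by blast+
    moreover have "x < y" unfolding x_def y_def by (rule sorted_wrt_nth_less[OF ts(1)]) (use ijk in simp_all)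
    moreover have "y < z" unfolding y_def z_def by (rule sorted_wrt_nth_less[OF ts(1)]) (use ijk in simp_all)
    ultimately have xyz: "x < y" "y < z" "x \<in> {0..1}" "z \<in> {0..1}" by blast+
    define l where "l = (y - x) / (z - x)"
    have zx: "0 < z - x" using xyz(1,2) by simp
    have l: "0 < l" "l < 1" using xyz(1,2) zx by (simp_all add: l_def)
    have "l * (z - x) = y - x" using zx by (simp add: l_def)
    then have y: "y = (1 - l) * x + l * z" by (simp add: algebra_simps)
    have "a \<bullet> r y \<le> (1 - l) * (a \<bullet> r x) + l * (a \<bullet> r z)"
      using convex_onD[OF c, of l x z] l xyz y by simp
    then have "a \<bullet> r y - b \<le> (1 - l) * (a \<bullet> r x - b) + l * (a \<bullet> r z - b)" by (simp add: algebra_simps)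
    then show "\<exists>l. 0 < l \<and> l < 1 \<and> a \<bullet> (map r ts ! j) - b \<le> (1 - l) * (a \<bullet> (map r ts ! i) - b) + l * (a \<bullet> (map r ts ! k) - b)"
      using l ijk by (intro exI[of _ l]) (simp add: x_def y_def z_def)
  qed
  show "vf_line (map r ts) a b \<le> 2"
  proof (cases "convex_on {0..1} (\<lambda>t. a \<bullet> r t)")
    case True
    then show ?thesis by (rule *)
  next
    case False
    then have "convex_on {0..1} (\<lambda>t. (- a) \<bullet> r t)" using conv[of a] by simp
    from *[OF this, of "- b"] show ?thesis by (simp add: vf_line_uminus)
  qed
qed

lemma convex_on_three_slopes:
  fixes g :: "real \<Rightarrow> real"
  assumes "\<And>x u y. \<alpha> \<le> x \<Longrightarrow> x < u \<Longrightarrow> u < y \<Longrightarrow> y \<le> \<beta> \<Longrightarrow> (g u - g x) * (y - u) \<le> (g y - g u) * (u - x)"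
  shows "convex_on {\<alpha>..\<beta>} g"
proof (rule convex_on_linorderI)
  fix t x y :: real assume t: "0 < t" "t < 1" and xy: "x \<in> {\<alpha>..\<beta>}" "y \<in> {\<alpha>..\<beta>}" "x < y"
  define u where "u = (1 - t) * x + t * y"
  have ux: "u - x = t * (y - x)" and yu: "y - u = (1 - t) * (y - x)" by (simp_all add: u_def algebra_simps)
  have "0 < u - x" "0 < y - u" unfolding ux yu using t xy by auto
  then have "(g u - g x) * ((1 - t) * (y - x)) \<le> (g y - g u) * (t * (y - x))"
    using assms[of x u y] xy unfolding ux[symmetric] yu[symmetric] by auto
  then have "((g u - g x) * (1 - t)) * (y - x) \<le> ((g y - g u) * t) * (y - x)" by (simp add: mult.assoc)
  then have "(g u - g x) * (1 - t) \<le> (g y - g u) * t" using xy by simp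
  then show "g ((1 - t) *\<^sub>R x + t *\<^sub>R y) \<le> (1 - t) * g x + t * g y" by (simp add: u_def algebra_simps)
qed simp

text \<open>A graph that lies on one side of a support line at each of its points cannot switch between lower
  and upper support lines.\<close>

lemma convex_or_concave_of_support_lines:
  fixes g :: "real \<Rightarrow> real"
  assumes cont: "continuous_on {\<alpha>..\<beta>} g"
    and supp: "\<And>u. u \<in> {\<alpha><..<\<beta>} \<Longrightarrow> \<exists>m. (\<forall>t\<in>{\<alpha>..\<beta>}. g u + m * (t - u) \<le> g t) \<or> (\<forall>t\<in>{\<alpha>..\<beta>}. g t \<le> g u + m * (t - u))"
  shows "convex_on {\<alpha>..\<beta>} g \<or> convex_on {\<alpha>..\<beta>} (\<lambda>t. - g t)"
proof -
  \<comment> \<open>\<open>D x y u\<close> has the sign of the height of the graph at \<open>u\<close> over the chord from \<open>x\<close> to \<open>y\<close>. A point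
    of the open set \<open>A\<close> lies above some chord, so its support line is above the graph; a point of \<open>B\<close>
    has its support line below. The interval is connected, so either one of the sets is empty, or
    some point lies on all chords over it.\<close>
  define D where "D x y u = (g u - g x) * (y - u) - (g y - g u) * (u - x)" for x y u
  define A where "A = (\<Union>(x, y)\<in>{\<alpha>..\<beta>} \<times> {\<alpha>..\<beta>}. D x y -` {0<..} \<inter> {x<..<y})"
  define B where "B = (\<Union>(x, y)\<in>{\<alpha>..\<beta>} \<times> {\<alpha>..\<beta>}. D x y -` {..<0} \<inter> {x<..<y})"
  have Dcont: "continuous_on {x<..<y} (D x y)" if "x \<in> {\<alpha>..\<beta>}" "y \<in> {\<alpha>..\<beta>}" for x y
    unfolding D_def by (intro continuous_intros continuous_on_subset[OF cont]) (use that in auto)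
  have op: "open (D x y -` S \<inter> {x<..<y})" if "x \<in> {\<alpha>..\<beta>}" "y \<in> {\<alpha>..\<beta>}" "open S" for x y S
    using Dcont[OF that(1,2)] that(3) by (simp add: continuous_on_open_vimage)
  have "open A" unfolding A_def using op by (intro open_UN) auto
  have "open B" unfolding B_def using op by (intro open_UN) auto
  have disj: "A \<inter> B \<inter> {\<alpha><..<\<beta>} = {}"
  proof -
    have "u \<notin> A \<or> u \<notin> B" if u: "u \<in> {\<alpha><..<\<beta>}" for u
    proof -
      obtain m where "(\<forall>t\<in>{\<alpha>..\<beta>}. g u + m * (t - u) \<le> g t) \<or> (\<forall>t\<in>{\<alpha>..\<beta>}. g t \<le> g u + m * (t - u))"
        using supp[OF u] by blast
      then show ?thesis
      proof
        assume m: "\<forall>t\<in>{\<alpha>..\<beta>}. g u + m * (t - u) \<le> g t"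
        have "D x y u \<le> 0" if "x \<in> {\<alpha>..\<beta>}" "y \<in> {\<alpha>..\<beta>}" "u \<in> {x<..<y}" for x y
        proof -
          have "(g u - g x) * (y - u) \<le> (m * (u - x)) * (y - u)"
            using m that by (intro mult_right_mono) (auto simp: algebra_simps)
          moreover have "(m * (y - u)) * (u - x) \<le> (g y - g u) * (u - x)"
            using m that by (intro mult_right_mono) (auto simp: algebra_simps)
          ultimately show ?thesis by (simp add: D_def mult.assoc mult.left_commute mult.commute)
        qed
        then have "u \<notin> A" by (force simp: A_def)
        then show ?thesis ..
      next
        assume m: "\<forall>t\<in>{\<alpha>..\<beta>}. g t \<le> g u + m * (t - u)"
        have "0 \<le> D x y u" if "x \<in> {\<alpha>..\<beta>}" "y \<in> {\<alpha>..\<beta>}" "u \<in> {x<..<y}" for x y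
        proof -
          have "(m * (u - x)) * (y - u) \<le> (g u - g x) * (y - u)"
            using m that by (intro mult_right_mono) (auto simp: algebra_simps)
          moreover have "(g y - g u) * (u - x) \<le> (m * (y - u)) * (u - x)"
            using m that by (intro mult_right_mono) (auto simp: algebra_simps)
          ultimately show ?thesis by (simp add: D_def mult.assoc mult.left_commute mult.commute)
        qed
        then have "u \<notin> B" by (force simp: B_def)
        then show ?thesis ..
      qed
    qed
    then show ?thesis by blast
  qed
  have notA: "(g u - g x) * (y - u) \<le> (g y - g u) * (u - x)" if "u \<notin> A" "\<alpha> \<le> x" "x < u" "u < y" "y \<le> \<beta>" for x u y
    using that unfolding A_def D_def by force
  have notB: "(g y - g u) * (u - x) \<le> (g u - g x) * (y - u)" if "u \<notin> B" "\<alpha> \<le> x" "x < u" "u < y" "y \<le> \<beta>" for x u y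
    using that unfolding B_def D_def by force
  consider "A \<inter> {\<alpha><..<\<beta>} = {}" | "B \<inter> {\<alpha><..<\<beta>} = {}" | u where "u \<in> {\<alpha><..<\<beta>}" "u \<notin> A" "u \<notin> B"
    using connectedD[OF connected_Ioo \<open>open A\<close> \<open>open B\<close> disj] by blast
  then show ?thesis
  proof cases
    case 1
    have "convex_on {\<alpha>..\<beta>} g"
    proof (rule convex_on_three_slopes)
      fix x u y assume "\<alpha> \<le> x" "x < u" "u < y" "y \<le> \<beta>"
      moreover from this have "u \<notin> A" using 1 by force
      ultimately show "(g u - g x) * (y - u) \<le> (g y - g u) * (u - x)" using notA by blast
    qed
    then show ?thesis ..
  next
    case 2
    have "convex_on {\<alpha>..\<beta>} (\<lambda>t. - g t)"
    proof (rule convex_on_three_slopes)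
      fix x u y assume "\<alpha> \<le> x" "x < u" "u < y" "y \<le> \<beta>"
      moreover from this have "u \<notin> B" using 2 by force
      ultimately have "(g y - g u) * (u - x) \<le> (g u - g x) * (y - u)" using notB by blast
      then show "(- g u - - g x) * (y - u) \<le> (- g y - - g u) * (u - x)" by (simp add: algebra_simps)
    qed
    then show ?thesis ..
  next
    case 3
    define m where "m = (g \<beta> - g u) / (\<beta> - u)"
    have u: "\<alpha> < u" "u < \<beta>" using 3(1) by auto
    have left: "g x = g u + m * (x - u)" if "\<alpha> \<le> x" "x < u" for x
    proof -
      have "(g u - g x) * (\<beta> - u) = (g \<beta> - g u) * (u - x)"
        using notA[OF 3(2) that(1,2) u(2)] notB[OF 3(3) that(1,2) u(2)] by auto
      then have "g u - g x = m * (u - x)" using u by (simp add: m_def field_simps)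
      then show ?thesis by (simp add: algebra_simps)
    qed
    have ma: "g u - g \<alpha> = m * (u - \<alpha>)" using left[of \<alpha>] u by (simp add: algebra_simps)
    have right: "g y = g u + m * (y - u)" if "u < y" "y \<le> \<beta>" for y
    proof -
      have "(g u - g \<alpha>) * (y - u) = (g y - g u) * (u - \<alpha>)"
        using notA[OF 3(2) _ u(1) that] notB[OF 3(3) _ u(1) that] by auto
      then have "(m * (y - u)) * (u - \<alpha>) = (g y - g u) * (u - \<alpha>)" by (simp add: ma algebra_simps)
      then show ?thesis using u by simp
    qed
    have lin: "g t = g u + m * (t - u)" if "t \<in> {\<alpha>..\<beta>}" for t
      using left[of t] right[of t] that by (cases t u rule: linorder_cases) auto
    have "convex_on {\<alpha>..\<beta>} g"
    proof (rule convex_on_three_slopes)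
      fix x v y assume "\<alpha> \<le> x" "x < v" "v < y" "y \<le> \<beta>"
      then have "g v - g x = m * (v - x)" "g y - g v = m * (y - v)"
        using lin[of x] lin[of v] lin[of y] by (simp_all add: algebra_simps)
      then show "(g v - g x) * (y - v) \<le> (g y - g v) * (v - x)" by simp
    qed
    then show ?thesis ..
  qed
qed


lemma convex_on_affine: "convex_on {l..u} (\<lambda>t::real. p * (t + c))"
  by (rule convex_onI) (simp_all add: algebra_simps)

lemma inner_basis: "(of_real p * a + of_real q * (\<i> * a)) \<bullet> z = p * (a \<bullet> z) + q * ((\<i> * a) \<bullet> z)"
  by (simp add: inner_complex_def algebra_simps)

lemma ex_basis:
  assumes "a \<noteq> 0" obtains p q where "b = of_real p * a + of_real q * (\<i> * a)"
proof -
  have "b = (of_real (Re (b / a)) + of_real (Im (b / a)) * \<i>) * a"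
    using assms complex_eq[of "b / a"] by (simp add: mult.commute)
  then show thesis using that[of "Re (b / a)" "Im (b / a)"] by (simp add: algebra_simps)
qed

lemma inner_components:
  assumes "a \<noteq> 0"
  shows "Re z = (Re a * (a \<bullet> z) - Im a * ((\<i> * a) \<bullet> z)) / (norm a)\<^sup>2"
    and "Im z = (Im a * (a \<bullet> z) + Re a * ((\<i> * a) \<bullet> z)) / (norm a)\<^sup>2"
proof -
  have n: "(norm a)\<^sup>2 = Re a * Re a + Im a * Im a" unfolding cmod_power2 by (simp add: power2_eq_square)
  have "(norm a)\<^sup>2 \<noteq> 0" using assms by simp
  moreover have "Re z * (norm a)\<^sup>2 = Re a * (a \<bullet> z) - Im a * ((\<i> * a) \<bullet> z)"
    "Im z * (norm a)\<^sup>2 = Im a * (a \<bullet> z) + Re a * ((\<i> * a) \<bullet> z)"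
    unfolding n by (simp_all add: inner_complex_def algebra_simps)
  ultimately show "Re z = (Re a * (a \<bullet> z) - Im a * ((\<i> * a) \<bullet> z)) / (norm a)\<^sup>2"
    "Im z = (Im a * (a \<bullet> z) + Re a * ((\<i> * a) \<bullet> z)) / (norm a)\<^sup>2"
    by (simp_all add: eq_divide_eq)
qed

lemma convex_curveE:
  assumes "convex_set_curve C" "p \<in> C"
  obtains b where "b \<noteq> 0" "\<And>z. z \<in> C \<Longrightarrow> b \<bullet> z \<le> b \<bullet> p"
proof -
  obtain b where b: "b \<noteq> 0" "(\<forall>z\<in>C. b \<bullet> z \<le> b \<bullet> p) \<or> (\<forall>z\<in>C. b \<bullet> p \<le> b \<bullet> z)"
    using assms unfolding convex_set_curve_def by blast
  then show thesis using that[of b] that[of "- b"] by auto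
qed

text \<open>At an interior parameter the support line of the curve is not parallel to the fibres of the
  functional, because there are points of the graph on both sides of the fibre. So it is the graph of
  an affine function that supports the function \<open>\<lambda>s. (\<i> * a) \<bullet> r s\<close>.\<close>

lemma graph_convex_or_concave:
  assumes a: "a \<noteq> 0" and r: "continuous_on {j0..j1} r" and coord: "\<And>s. s \<in> {j0..j1} \<Longrightarrow> a \<bullet> r s = s + c"
    and conv: "convex_set_curve C" and sub: "r ` {j0..j1} \<subseteq> C" 
    and C: "C \<subseteq> r ` {j0..j1}"
  shows "convex_on {j0..j1} (\<lambda>s. (\<i> * a) \<bullet> r s) \<or> convex_on {j0..j1} (\<lambda>s. - ((\<i> * a) \<bullet> r s))"
proof (rule convex_or_concave_of_support_lines)
  show "continuous_on {j0..j1} (\<lambda>s. (\<i> * a) \<bullet> r s)" by (intro continuous_intros r)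
  fix u assume u: "u \<in> {j0<..<j1}"
  let ?g = "\<lambda>s. (\<i> * a) \<bullet> r s"
  have "r u \<in> C" using sub u by auto
  then obtain b where b: "b \<noteq> 0" "\<And>z. z \<in> C \<Longrightarrow> b \<bullet> z \<le> b \<bullet> r u" using convex_curveE[OF conv] by metis
  obtain p q where pq: "b = of_real p * a + of_real q * (\<i> * a)" using ex_basis[OF a] .
  have ineq: "p * s + q * ?g s \<le> p * u + q * ?g u" if "s \<in> {j0..j1}" for s
  proof -
    have "r s \<in> C" using sub that by blast
    then have "b \<bullet> r s \<le> b \<bullet> r u" by (rule b(2))
    then show ?thesis unfolding pq inner_basis using coord[OF that] coord[of u] u by (simp add: algebra_simps)
  qed
  have "q \<noteq> 0"
  proof
    assume q: "q = 0"
    have "p * j0 \<le> p * u" "p * j1 \<le> p * u" using ineq[of j0] ineq[of j1] u q by auto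
    then have "p * (j0 - u) \<le> 0" "p * (j1 - u) \<le> 0" by (simp_all add: algebra_simps)
    then have "p = 0" using u by (auto simp: mult_le_0_iff)
    with q pq b(1) show False by simp
  qed
  define m where "m = - p / q"
  have m: "m * q = - p" using \<open>q \<noteq> 0\<close> by (simp add: m_def)
  have key: "q * ?g s \<le> q * (?g u + m * (s - u))" if "s \<in> {j0..j1}" for s
  proof -
    have "q * (?g u + m * (s - u)) = q * ?g u + (m * q) * (s - u)" by (simp add: algebra_simps)
    also have "\<dots> = q * ?g u - p * s + p * u" unfolding m by (simp add: algebra_simps)
    finally show ?thesis using ineq[OF that] by simp
  qed
  show "\<exists>m. (\<forall>t\<in>{j0..j1}. ?g u + m * (t - u) \<le> ?g t) \<or> (\<forall>t\<in>{j0..j1}. ?g t \<le> ?g u + m * (t - u))"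
  proof (cases "q > 0")
    case True
    then show ?thesis using key by (intro exI[of _ m]) (auto simp: mult_le_cancel_left)
  next
    case False
    then have "q < 0" using \<open>q \<noteq> 0\<close> by simp
    then show ?thesis using key by (intro exI[of _ m]) (auto simp: mult_le_cancel_left)
  qed
qed

text \<open>The graph is required to extend beyond one end of the unit interval, since the slope may be infinite
  at the ends of a maximal graph and the approximation of convex functions needs room at one end.\<close>

lemma chart_of_graph:
  assumes a: "a \<noteq> 0" and r: "continuous_on {j0..j1} r" and coord: "\<And>s. s \<in> {j0..j1} \<Longrightarrow> a \<bullet> r s = s + c"
    and conv: "convex_set_curve (r ` {j0..j1})" and j: "j0 \<le> 0" "1 \<le> j1" "j0 < 0 \<or> 1 < j1"
  shows "chart a c r"
proof -
  define g where "g s = (\<i> * a) \<bullet> r s" for s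
  have sub: "{0..1} \<subseteq> {j0..j1}" using j by auto
  have gcont: "continuous_on {j0..j1} g" unfolding g_def by (intro continuous_intros r)
  have dich: "convex_on {j0..j1} g \<or> convex_on {j0..j1} (\<lambda>s. - g s)"
    unfolding g_def by (rule graph_convex_or_concave[OF a r coord conv]) auto
  have g: "unit_interval.approx (\<lambda>t. of_real (g t))"
    using dich
  proof
    assume "convex_on {j0..j1} g"
    then show ?thesis by (rule unit_interval_approx_convex[OF _ gcont j])
  next
    assume "convex_on {j0..j1} (\<lambda>s. - g s)"
    then have "unit_interval.approx (\<lambda>t. of_real (- g t))"
      by (rule unit_interval_approx_convex[OF _ continuous_on_minus[OF gcont] j])
    from unit_interval.approx_diff[OF unit_interval.approx_const[of 0] this] show ?thesis by simp
  qed
  have lin: "unit_interval.approx (\<lambda>t. of_real t + of_real c)"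
    by (intro unit_interval.approx_add unit_interval.approx_const unit_interval_approx_id)
  have Re: "unit_interval.approx (\<lambda>t. of_real (Re (r t)))"
  proof -
    have "unit_interval.approx (\<lambda>t. (of_real (Re a) * (of_real t + of_real c) - of_real (Im a) * of_real (g t)) * of_real (1 / (norm a)\<^sup>2))"
      by (intro unit_interval.approx_mult unit_interval.approx_diff unit_interval.approx_const lin g)
    moreover have "complex_of_real (Re (r t)) = (of_real (Re a) * (of_real t + of_real c) - of_real (Im a) * of_real (g t)) * of_real (1 / (norm a)\<^sup>2)"
      if t: "t \<in> {0..1}" for t
    proof -
      have "Re (r t) = (Re a * (t + c) - Im a * g t) * (1 / (norm a)\<^sup>2)"
        using inner_components(1)[OF a, of "r t"] coord[of t] sub t by (auto simp: g_def)
      then show ?thesis by (metis of_real_add of_real_diff of_real_mult)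
    qed
    ultimately show ?thesis by (subst unit_interval.approx_cong) auto
  qed
  have Im: "unit_interval.approx (\<lambda>t. of_real (Im (r t)))"
  proof -
    have "unit_interval.approx (\<lambda>t. (of_real (Im a) * (of_real t + of_real c) + of_real (Re a) * of_real (g t)) * of_real (1 / (norm a)\<^sup>2))"
      by (intro unit_interval.approx_mult unit_interval.approx_add unit_interval.approx_const lin g)
    moreover have "complex_of_real (Im (r t)) = (of_real (Im a) * (of_real t + of_real c) + of_real (Re a) * of_real (g t)) * of_real (1 / (norm a)\<^sup>2)"
      if t: "t \<in> {0..1}" for t
    proof -
      have "Im (r t) = (Im a * (t + c) + Re a * g t) * (1 / (norm a)\<^sup>2)"
        using inner_components(2)[OF a, of "r t"] coord[of t] sub t by (auto simp: g_def)
      then show ?thesis by (metis of_real_add of_real_mult)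
    qed
    ultimately show ?thesis by (subst unit_interval.approx_cong) auto
  qed
  have functional: "convex_on {0..1} (\<lambda>t. b \<bullet> r t) \<or> convex_on {0..1} (\<lambda>t. - (b \<bullet> r t))" for b
  proof -
    obtain p q where b: "b = of_real p * a + of_real q * (\<i> * a)" using ex_basis[OF a] .
    have eq: "b \<bullet> r t = p * (t + c) + q * g t" if "t \<in> {0..1}" for t
      unfolding b inner_basis using coord[of t] sub that by (auto simp: g_def)
    have pos: "convex_on {0..1} (\<lambda>t. p * (t + c) + q * h t)" if "0 \<le> q" "convex_on {j0..j1} h" for p q h
      by (intro convex_on_add convex_on_cmul convex_on_affine convex_on_subset[OF that(2) sub] that(1)) simp
    have cong: "convex_on {0..1} f" if eq: "\<And>t. t \<in> {0..1} \<Longrightarrow> f t = f' t" and f': "convex_on {0..1} f'" for f f' :: "real \<Rightarrow> real"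
    proof (rule convex_onI)
      fix t x y :: real assume t: "0 < t" "t < 1" and xy: "x \<in> {0..1}" "y \<in> {0..1}"
      have "(1 - t) *\<^sub>R x + t *\<^sub>R y \<in> {0..1}"
        using convexD_alt[of "{0..1::real}" x y t] t xy by simp
      then show "f ((1 - t) *\<^sub>R x + t *\<^sub>R y) \<le> (1 - t) * f x + t * f y"
        using convex_onD[OF f', of t x y] t xy eq by simp
    qed simp
    consider "0 \<le> q" "convex_on {j0..j1} g" | "q \<le> 0" "convex_on {j0..j1} g"
      | "0 \<le> q" "convex_on {j0..j1} (\<lambda>s. - g s)" | "q \<le> 0" "convex_on {j0..j1} (\<lambda>s. - g s)"
      using dich by linarith
    then show ?thesis
    proof cases
      case 1
      then show ?thesis using cong[OF _ pos[of q g p], of "\<lambda>t. b \<bullet> r t"] eq by simp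
    next
      case 2
      then show ?thesis using cong[OF _ pos[of "- q" g "- p"], of "\<lambda>t. - (b \<bullet> r t)"] eq by simp
    next
      case 3
      then show ?thesis using cong[OF _ pos[of q "\<lambda>s. - g s" "- p"], of "\<lambda>t. - (b \<bullet> r t)"] eq by simp
    next
      case 4
      then show ?thesis using cong[OF _ pos[of "- q" "\<lambda>s. - g s" p], of "\<lambda>t. b \<bullet> r t"] eq by simp
    qed
  qed
  have vf: "vf (map r ts) \<le> 2" if "sorted_wrt (<) ts" "set ts \<subseteq> {0..1}" for ts
    using functional that by (rule vf_convex_graph)
  show ?thesis
    unfolding chart_def using Re Im vf coord sub continuous_on_subset[OF r sub] by auto
qed

section \<open>Cutting a convex arc into graphs\<close>

text \<open>The functional is rescaled, with a sign, such that it runs from 0 at the prescribed end \<open>v\<close> to 1 at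
  the other end \<open>v'\<close>. The choice of orientation is needed to match charts of two different curves.\<close>

lemma chart_of_arc:
  fixes \<gamma> :: "real \<Rightarrow> complex"
  assumes \<gamma>: "continuous_on {p..q} \<gamma>" and conv: "convex_set_curve (\<gamma> ` {p..q})"
    and inj: "inj_on (\<lambda>t. a \<bullet> \<gamma> t) {p..q}"
    and ord: "p \<le> p'" "p' < q'" "q' \<le> q" "p < p' \<or> q' < q"
    and v: "{v, v'} = {\<gamma> p', \<gamma> q'}"
  shows "\<exists>a c r. chart a c r \<and> r ` {0..1} = \<gamma> ` {p'..q'} \<and> r 0 = v \<and> r 1 = v'"
proof -
  have "v = \<gamma> p' \<and> v' = \<gamma> q' \<or> v = \<gamma> q' \<and> v' = \<gamma> p'" using v by (simp add: doubleton_eq_iff)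
  then have "\<exists>e e'. v = \<gamma> e \<and> v' = \<gamma> e' \<and> {e, e'} = {p', q'} \<and> e \<noteq> e'"
  proof
    assume "v = \<gamma> p' \<and> v' = \<gamma> q'"
    then show ?thesis using ord(2) by (intro exI[of _ p'] exI[of _ q']) simp
  next
    assume "v = \<gamma> q' \<and> v' = \<gamma> p'"
    then show ?thesis using ord(2) by (intro exI[of _ q'] exI[of _ p']) (simp add: insert_commute)
  qed
  then obtain e e' where e: "v = \<gamma> e" "v' = \<gamma> e'" "{e, e'} = {p', q'}" "e \<noteq> e'" by blast
  have "e \<in> {p', q'}" "e' \<in> {p', q'}" using e(3) by blast+
  then have e_in: "e \<in> {p..q}" "e' \<in> {p..q}" using ord by auto
  define d where "d = a \<bullet> \<gamma> e' - a \<bullet> \<gamma> e"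
  have d: "d \<noteq> 0" using inj_onD[OF inj _ e_in(2,1)] e(4) by (auto simp: d_def)
  define a' where "a' = a /\<^sub>R d"
  define c where "c = a' \<bullet> \<gamma> e"
  define u where "u t = a' \<bullet> \<gamma> t - c" for t
  have u: "u t = (a \<bullet> \<gamma> t - a \<bullet> \<gamma> e) / d" for t
    by (simp add: u_def c_def a'_def divide_inverse algebra_simps)
  have ue: "u e = 0" "u e' = 1" using d by (simp_all add: u d_def)
  have "a' \<noteq> 0" using ue by (auto simp: u_def c_def)
  have uinj: "inj_on u {p..q}"
  proof (rule inj_onI)
    fix s t assume st: "s \<in> {p..q}" "t \<in> {p..q}" "u s = u t"
    then have "a \<bullet> \<gamma> s = a \<bullet> \<gamma> t" using d by (simp add: u)
    then show "s = t" using inj_onD[OF inj _ st(1,2)] by simp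
  qed
  have ucont: "continuous_on {p..q} u" unfolding u_def by (intro continuous_intros \<gamma>)
  have "compact (u ` {p..q}) \<and> connected (u ` {p..q})"
    by (intro conjI compact_continuous_image connected_continuous_image ucont) auto
  then obtain j0 j1 where J: "u ` {p..q} = {j0..j1}" using connected_compact_interval_1[of "u ` {p..q}"] by blast
  have "0 \<in> u ` {p..q}" "1 \<in> u ` {p..q}" using ue e_in by force+
  then have j: "j0 \<le> 0" "1 \<le> j1" unfolding J by auto
  have "e = p' \<and> e' = q' \<or> e = q' \<and> e' = p'" using e(3) by (simp add: doubleton_eq_iff)
  then have ends: "u p' = 0 \<and> u q' = 1 \<or> u p' = 1 \<and> u q' = 0" using ue by auto
  have between: "u s \<in> {0..1}" if "s \<in> {p'..q'}" for s
  proof (cases "s = p' \<or> s = q'")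
    case True
    then show ?thesis using ends by auto
  next
    case False
    then have "u p' < u s \<and> u s < u q' \<or> u q' < u s \<and> u s < u p'"
      using that ord by (intro continuous_inj_imp_mono continuous_on_subset[OF ucont] inj_on_subset[OF uinj]) auto
    then show ?thesis using ends by auto
  qed
  have "{0..1} \<subseteq> u ` {p'..q'}"
  proof -
    have "connected (u ` {p'..q'})"
      using ord by (intro connected_continuous_image continuous_on_subset[OF ucont]) auto
    moreover have "0 \<in> u ` {p'..q'}" "1 \<in> u ` {p'..q'}"
    proof -
      have "u p' \<in> u ` {p'..q'}" "u q' \<in> u ` {p'..q'}" using ord(2) by auto
      then show "0 \<in> u ` {p'..q'}" "1 \<in> u ` {p'..q'}" using ends by auto
    qed
    ultimately show ?thesis by (simp add: connected_contains_Icc)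
  qed
  then have im: "u ` {p'..q'} = {0..1}" using between by blast
  have ext: "j0 < 0 \<or> 1 < j1"
  proof -
    obtain s where s: "s \<in> {p..q}" "s \<notin> {p'..q'}"
    proof (cases "p < p'")
      case True
      then show thesis using that[of p] ord by auto
    next
      case False
      then show thesis using that[of q] ord by auto
    qed
    have "u s \<notin> {0..1}"
    proof
      assume "u s \<in> {0..1}"
      then obtain t where "t \<in> {p'..q'}" "u t = u s" using im by (metis imageE)
      then show False using inj_onD[OF uinj, of t s] s ord by auto
    qed
    moreover have "u s \<in> {j0..j1}" using s(1) J by blast
    ultimately show ?thesis by auto
  qed
  define r where "r s = \<gamma> (the_inv_into {p..q} u s)" for s
  have inv: "the_inv_into {p..q} u (u t) = t" if "t \<in> {p..q}" for t
    by (rule the_inv_into_f_f[OF uinj that])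
  have ru: "r (u t) = \<gamma> t" if "t \<in> {p..q}" for t using inv[OF that] by (simp add: r_def)
  have "continuous_on {j0..j1} (the_inv_into {p..q} u)"
    using continuous_on_inv_into[OF ucont _ uinj] J by simp
  moreover have "the_inv_into {p..q} u ` {j0..j1} \<subseteq> {p..q}"
    using inv unfolding J[symmetric] by auto
  ultimately have rcont: "continuous_on {j0..j1} r"
    unfolding r_def by (rule continuous_on_compose2[OF \<gamma>])
  have rim: "r ` u ` A = \<gamma> ` A" if "A \<subseteq> {p..q}" for A
    using ru that by (force simp: image_image)
  have coord: "a' \<bullet> r s = s + c" if s: "s \<in> {j0..j1}" for s
  proof -
    obtain t where "t \<in> {p..q}" "s = u t" using s J by (metis imageE)
    then show ?thesis using ru[of t] by (simp add: u_def)
  qed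
  have "chart a' c r"
  proof (rule chart_of_graph[OF \<open>a' \<noteq> 0\<close> rcont coord _ j ext])
    show "convex_set_curve (r ` {j0..j1})" using conv rim[of "{p..q}"] J by simp
  qed
  moreover have "r ` {0..1} = \<gamma> ` {p'..q'}" using rim[of "{p'..q'}"] im ord by simp
  moreover have "r 0 = v" "r 1 = v'" using ru[OF e_in(1)] ru[OF e_in(2)] ue e by simp_all
  ultimately show ?thesis by blast
qed

text \<open>After cutting at the parameters in \<open>F\<close>, a linear functional is injective on each remaining interval
  and even a little further at one of its ends, as \<open>chart_of_arc\<close> demands.\<close>

definition cuttable :: "(real \<Rightarrow> complex) \<Rightarrow> real \<Rightarrow> real \<Rightarrow> bool" where
  "cuttable \<gamma> l r \<longleftrightarrow> (\<exists>F. finite F \<and> (\<forall>p' q'. l \<le> p' \<and> p' < q' \<and> q' \<le> r \<and> {p'<..<q'} \<inter> F = {} \<longrightarrow>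
     (\<exists>p q a. l \<le> p \<and> p \<le> p' \<and> q' \<le> q \<and> q \<le> r \<and> (p < p' \<or> q' < q) \<and> inj_on (\<lambda>t. a \<bullet> \<gamma> t) {p..q})))"

text \<open>The extra cut at the midpoint provides the room beyond one end.\<close>

lemma cuttable_inj:
  assumes "inj_on (\<lambda>t. a \<bullet> \<gamma> t) {l..r}" shows "cuttable \<gamma> l r"
  unfolding cuttable_def
proof (intro exI[of _ "{(l + r) / 2}"] conjI allI impI)
  fix p' q' assume h: "l \<le> p' \<and> p' < q' \<and> q' \<le> r \<and> {p'<..<q'} \<inter> {(l + r) / 2} = {}"
  then have "(l + r) / 2 \<le> p' \<or> q' \<le> (l + r) / 2" by auto
  then have "l < p' \<or> q' < r" using h by auto
  with h assms show "\<exists>p q a. l \<le> p \<and> p \<le> p' \<and> q' \<le> q \<and> q \<le> r \<and> (p < p' \<or> q' < q) \<and> inj_on (\<lambda>t. a \<bullet> \<gamma> t) {p..q}"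
    by (intro exI[of _ l] exI[of _ r] exI[of _ a]) auto
qed simp

text \<open>An arc on which the real part is constant is injective under the imaginary part.\<close>

lemma cuttable_const:
  assumes inj: "inj_on \<gamma> {l..r}" and const: "\<And>s t. s \<in> {l..r} \<Longrightarrow> t \<in> {l..r} \<Longrightarrow> Re (\<gamma> s) = Re (\<gamma> t)"
  shows "cuttable \<gamma> l r"
proof (rule cuttable_inj)
  show "inj_on (\<lambda>t. \<i> \<bullet> \<gamma> t) {l..r}"
  proof (rule inj_onI)
    fix s t assume st: "s \<in> {l..r}" "t \<in> {l..r}" "\<i> \<bullet> \<gamma> s = \<i> \<bullet> \<gamma> t"
    then have "\<gamma> s = \<gamma> t" using const[OF st(1,2)] by (simp add: complex_eq_iff inner_complex_def)
    then show "s = t" using inj st by (auto dest: inj_onD)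
  qed
qed

lemma cuttable_join:
  assumes "cuttable \<gamma> l m" "cuttable \<gamma> m r" "l \<le> m" "m \<le> r" shows "cuttable \<gamma> l r"
proof -
  obtain F G where F: "finite F" and F': "\<And>p' q'. l \<le> p' \<and> p' < q' \<and> q' \<le> m \<and> {p'<..<q'} \<inter> F = {} \<Longrightarrow>
     (\<exists>p q a. l \<le> p \<and> p \<le> p' \<and> q' \<le> q \<and> q \<le> m \<and> (p < p' \<or> q' < q) \<and> inj_on (\<lambda>t. a \<bullet> \<gamma> t) {p..q})"
   and G: "finite G" and G': "\<And>p' q'. m \<le> p' \<and> p' < q' \<and> q' \<le> r \<and> {p'<..<q'} \<inter> G = {} \<Longrightarrow>
     (\<exists>p q a. m \<le> p \<and> p \<le> p' \<and> q' \<le> q \<and> q \<le> r \<and> (p < p' \<or> q' < q) \<and> inj_on (\<lambda>t. a \<bullet> \<gamma> t) {p..q})"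
    using assms(1,2) unfolding cuttable_def by auto
  show ?thesis
    unfolding cuttable_def
  proof (intro exI[of _ "insert m (F \<union> G)"] conjI allI impI)
    show "finite (insert m (F \<union> G))" using F G by simp
    fix p' q' assume h: "l \<le> p' \<and> p' < q' \<and> q' \<le> r \<and> {p'<..<q'} \<inter> insert m (F \<union> G) = {}"
    then have "q' \<le> m \<or> m \<le> p'" by auto
    then show "\<exists>p q a. l \<le> p \<and> p \<le> p' \<and> q' \<le> q \<and> q \<le> r \<and> (p < p' \<or> q' < q) \<and> inj_on (\<lambda>t. a \<bullet> \<gamma> t) {p..q}"
    proof
      assume "q' \<le> m"
      moreover have "{p'<..<q'} \<inter> F = {}" using h by blast
      ultimately obtain p q a where "l \<le> p \<and> p \<le> p' \<and> q' \<le> q \<and> q \<le> m \<and> (p < p' \<or> q' < q) \<and> inj_on (\<lambda>t. a \<bullet> \<gamma> t) {p..q}"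
        using F'[of p' q'] h by blast
      then show ?thesis using assms(4) by (intro exI[of _ p] exI[of _ q] exI[of _ a]) auto
    next
      assume "m \<le> p'"
      moreover have "{p'<..<q'} \<inter> G = {}" using h by blast
      ultimately obtain p q a where "m \<le> p \<and> p \<le> p' \<and> q' \<le> q \<and> q \<le> r \<and> (p < p' \<or> q' < q) \<and> inj_on (\<lambda>t. a \<bullet> \<gamma> t) {p..q}"
        using G'[of p' q'] h by blast
      then show ?thesis using assms(3) by (intro exI[of _ p] exI[of _ q] exI[of _ a]) auto
    qed
  qed
qed

lemma IVT_open:
  fixes w :: "real \<Rightarrow> real"
  assumes "continuous_on {a..b} w" "a \<le> b" "w a < \<xi> \<and> \<xi> < w b \<or> w b < \<xi> \<and> \<xi> < w a"
  shows "\<exists>t. a < t \<and> t < b \<and> w t = \<xi>"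
  using assms(3)
proof
  assume h: "w a < \<xi> \<and> \<xi> < w b"
  then obtain t where t: "a \<le> t" "t \<le> b" "w t = \<xi>" using IVT'[of w a \<xi> b] assms by auto
  moreover have "a \<noteq> t" "t \<noteq> b" using h t by auto
  ultimately have "a < t" "t < b" by auto
  with t show ?thesis by blast
next
  assume h: "w b < \<xi> \<and> \<xi> < w a"
  then obtain t where t: "a \<le> t" "t \<le> b" "w t = \<xi>" using IVT2'[of w b \<xi> a] assms by auto
  moreover have "a \<noteq> t" "t \<noteq> b" using h t by auto
  ultimately have "a < t" "t < b" by auto
  with t show ?thesis by blast
qed

text \<open>The parameters with a value strictly between \<open>m\<close> and \<open>M\<close> form an interval, on which \<open>w\<close> is injective;
  before and after it \<open>w\<close> is constant.\<close>

lemma cuttable_if_levels_once: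
  fixes \<gamma> :: "real \<Rightarrow> complex"
  defines "w \<equiv> \<lambda>t. Re (\<gamma> t)"
  assumes inj: "inj_on \<gamma> {p..q}" and cont: "continuous_on {p..q} w" and "p \<le> q"
    and range: "\<And>t. t \<in> {p..q} \<Longrightarrow> w t \<in> {m..M}"
    and once: "\<And>s t. s \<in> {p..q} \<Longrightarrow> t \<in> {p..q} \<Longrightarrow> w s = w t \<Longrightarrow> m < w s \<Longrightarrow> w s < M \<Longrightarrow> s = t"
  shows "cuttable \<gamma> p q"
proof -
  define J where "J = {t \<in> {p..q}. m < w t \<and> w t < M}"
  have const: "cuttable \<gamma> l r" if lr: "p \<le> l" "r \<le> q" and nJ: "\<And>t. l < t \<Longrightarrow> t < r \<Longrightarrow> t \<notin> J" for l r
  proof (rule cuttable_const)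
    show "inj_on \<gamma> {l..r}" using inj lr by (auto intro: inj_on_subset)
    have *: "\<not> w s \<noteq> w t" if st: "s \<in> {l..r}" "t \<in> {l..r}" "s < t" for s t
    proof
      assume ne: "w s \<noteq> w t"
      have "continuous_on {s..t} w" using continuous_on_subset[OF cont] st lr by auto
      moreover have "w s < (w s + w t) / 2 \<and> (w s + w t) / 2 < w t \<or> w t < (w s + w t) / 2 \<and> (w s + w t) / 2 < w s"
        using ne by (cases "w s < w t") auto
      ultimately obtain x where x: "s < x" "x < t" "w x = (w s + w t) / 2"
        using IVT_open[of s t w] st(3) by (metis less_imp_le)
      have "w s \<in> {m..M}" "w t \<in> {m..M}" using range st lr by auto
      then have "x \<in> J" using x ne st lr by (auto simp: J_def)
      moreover have "l < x" "x < r" using x st by auto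
      ultimately show False using nJ by blast
    qed
    show "Re (\<gamma> s) = Re (\<gamma> t)" if "s \<in> {l..r}" "t \<in> {l..r}" for s t
      using *[of s t] *[of t s] that by (cases s t rule: linorder_cases) (auto simp: w_def)
  qed
  show ?thesis
  proof (cases "J = {}")
    case True
    then show ?thesis by (intro const) auto
  next
    case False
    define j0 j1 where "j0 = Inf J" and "j1 = Sup J"
    have bdd: "bdd_below J" "bdd_above J" by (auto simp: J_def bdd_below_def bdd_above_def)
    have J_in: "j0 \<le> t" "t \<le> j1" if "t \<in> J" for t
      using that bdd by (auto simp: j0_def j1_def intro: cInf_lower cSup_upper)
    have JI: "J \<subseteq> {p..q}" by (auto simp: J_def)
    obtain t0 where t0: "t0 \<in> J" using False by blast
    have j: "p \<le> j0" "j0 \<le> j1" "j1 \<le> q"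
      using False JI J_in[OF t0] by (auto simp: j0_def j1_def intro!: cInf_greatest cSup_least)
    \<comment> \<open>No value of \<open>w\<close> exceeds, or falls below, values on both sides: a level near it would be taken twice.\<close>
    have peak: "False" if sxt: "s < x" "x < t" "s \<in> {p..q}" "t \<in> {p..q}"
      and val: "w s < w x \<and> w t < w x \<or> w x < w s \<and> w x < w t" for s x t
    proof -
      have c1: "continuous_on {s..x} w" and c2: "continuous_on {x..t} w"
        using continuous_on_subset[OF cont] sxt by auto
      have rs: "w s \<in> {m..M}" "w t \<in> {m..M}" "w x \<in> {m..M}" using range sxt by auto
      \<comment> \<open>a level strictly between \<open>w x\<close> and both other values, hence taken on either side of \<open>x\<close>\<close>
      define \<xi> where "\<xi> = (if w s < w x then (max (w s) (w t) + w x) / 2 else (min (w s) (w t) + w x) / 2)"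
      have \<xi>: "w s < \<xi> \<and> \<xi> < w x \<or> w x < \<xi> \<and> \<xi> < w s" "w x < \<xi> \<and> \<xi> < w t \<or> w t < \<xi> \<and> \<xi> < w x" "m < \<xi>" "\<xi> < M"
        using val rs by (auto simp: \<xi>_def max_def min_def)
      obtain y where y: "s < y" "y < x" "w y = \<xi>" using IVT_open[OF c1 _ \<xi>(1)] sxt by auto
      obtain z where z: "x < z" "z < t" "w z = \<xi>" using IVT_open[OF c2 _ \<xi>(2)] sxt by auto
      have "y \<in> {p..q}" "z \<in> {p..q}" using y z sxt by auto
      moreover have "w y = w z" "m < w y" "w y < M" unfolding y(3) z(3) using \<xi>(3,4) by auto
      ultimately have "y = z" by (rule once)
      then show False using y z by simp
    qed
    have mid: "t \<in> J" if t: "j0 < t" "t < j1" for t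
    proof (rule ccontr)
      assume nt: "t \<notin> J"
      obtain s where s: "s \<in> J" "s < t" using t(1) False bdd unfolding j0_def by (auto simp: cInf_less_iff)
      obtain s' where s': "s' \<in> J" "t < s'" using t(2) False bdd unfolding j1_def by (auto simp: less_cSup_iff)
      have "t \<in> {p..q}" using t j by auto
      then have "w t = m \<or> w t = M" using nt range[of t] by (auto simp: J_def)
      then have "w s < w t \<and> w s' < w t \<or> w t < w s \<and> w t < w s'" using s(1) s'(1) by (auto simp: J_def)
      moreover have "s \<in> {p..q}" "s' \<in> {p..q}" using s(1) s'(1) JI by blast+
      ultimately show False using peak[of s t s'] s(2) s'(2) by blast
    qed
    have ninj: "w s \<noteq> w t" if st: "s \<in> {j0..j1}" "t \<in> {j0..j1}" "s < t" for s t
    proof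
      assume eq: "w s = w t"
      have pq: "s \<in> {p..q}" "t \<in> {p..q}" using st j by auto
      show False
      proof (cases "m < w s \<and> w s < M")
        case True
        then show False using once[OF pq eq] st by auto
      next
        case False
        then have ws: "w s = m \<or> w s = M" using range[OF pq(1)] by auto
        have x: "(s + t) / 2 \<in> J" using st by (intro mid) auto
        then have "w s < w ((s + t) / 2) \<and> w t < w ((s + t) / 2) \<or> w ((s + t) / 2) < w s \<and> w ((s + t) / 2) < w t"
          using ws eq by (auto simp: J_def)
        then show False using peak[of s "(s + t) / 2" t] pq st by auto
      qed
    qed
    have "inj_on (\<lambda>t. 1 \<bullet> \<gamma> t) {j0..j1}"
    proof (rule inj_onI)
      fix s t assume st: "s \<in> {j0..j1}" "t \<in> {j0..j1}" "1 \<bullet> \<gamma> s = 1 \<bullet> \<gamma> t"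
      then have "w s = w t" by (simp add: w_def inner_complex_def)
      then show "s = t" using ninj[of s t] ninj[of t s] st by (cases s t rule: linorder_cases) auto
    qed
    then have c: "cuttable \<gamma> j0 j1" by (rule cuttable_inj)
    have "cuttable \<gamma> p j0"
    proof (rule const)
      show "t \<notin> J" if "t < j0" for t using J_in(1)[of t] that by auto
    qed (use j in auto)
    from cuttable_join[OF this c j(1,2)] have "cuttable \<gamma> p j1" .
    moreover have "cuttable \<gamma> j1 q"
    proof (rule const)
      show "t \<notin> J" if "j1 < t" for t using J_in(2)[of t] that by auto
    qed (use j in auto)
    ultimately show ?thesis using j by (intro cuttable_join[of _ p j1 q]) auto
  qed
qed

text \<open>A support line at the middle one of three points on a line \<open>\<ell>\<close> is \<open>\<ell>\<close> itself, so the curve lies on one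
  side of \<open>\<ell>\<close>.\<close>

lemma convex_curve_level_at_most_twice:
  assumes C: "convex_set_curve C" and x: "x \<in> C" "y \<in> C" "z \<in> C" "Re x = \<xi>" "Re y = \<xi>" "Re z = \<xi>"
    and ord: "Im x < Im y" "Im y < Im z" and lo: "lo \<in> C" "Re lo < \<xi>" and hi: "hi \<in> C" "\<xi> < Re hi"
  shows False
proof -
  obtain b where b: "b \<noteq> 0" "\<And>z. z \<in> C \<Longrightarrow> b \<bullet> z \<le> b \<bullet> y" using convex_curveE[OF C x(2)] by metis
  have "Im b * (Im x - Im y) \<le> 0" "Im b * (Im z - Im y) \<le> 0"
    using b(2)[OF x(1)] b(2)[OF x(3)] x by (simp_all add: inner_complex_def algebra_simps)
  then have "Im b = 0" using ord by (auto simp: mult_le_0_iff)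
  then have "Re b * (Re lo - \<xi>) \<le> 0" "Re b * (Re hi - \<xi>) \<le> 0"
    using b(2)[OF lo(1)] b(2)[OF hi(1)] x by (simp_all add: inner_complex_def algebra_simps)
  then have "Re b = 0" using lo hi by (auto simp: mult_le_0_iff)
  with \<open>Im b = 0\<close> b(1) show False by (simp add: complex_eq_iff)
qed

text \<open>The arc is cut at a minimum and at a maximum of the real part. On each of the three parts every
  level strictly between the extrema is taken at most once.\<close>

theorem convex_arc_cuttable:
  assumes cont: "continuous_on {0..1} \<gamma>" and inj: "inj_on \<gamma> {0..1}" and conv: "convex_set_curve (\<gamma> ` {0..1})"
  shows "cuttable \<gamma> 0 1"
proof -
  define w where "w t = Re (\<gamma> t)" for t
  have wc: "continuous_on {0..1} w" unfolding w_def by (intro continuous_intros cont)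
  obtain tm where tm: "tm \<in> {0..1}" "\<And>t. t \<in> {0..1} \<Longrightarrow> w tm \<le> w t"
    using continuous_attains_inf[OF compact_Icc _ wc] by auto
  obtain tM where tM: "tM \<in> {0..1}" "\<And>t. t \<in> {0..1} \<Longrightarrow> w t \<le> w tM"
    using continuous_attains_sup[OF compact_Icc _ wc] by auto
  define m M where "m = w tm" and "M = w tM"
  have rng: "w t \<in> {m..M}" if "t \<in> {0..1}" for t using tm(2)[OF that] tM(2)[OF that] by (simp add: m_def M_def)
  have no_three: False if t: "s \<in> {0..1}" "t \<in> {0..1}" "u \<in> {0..1}" "s \<noteq> t" "t \<noteq> u" "s \<noteq> u"
    and lev: "w s = \<xi>" "w t = \<xi>" "w u = \<xi>" "m < \<xi>" "\<xi> < M" for s t u \<xi>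
  proof -
    have neq: "Im (\<gamma> x) \<noteq> Im (\<gamma> y)" if "x \<in> {0..1}" "y \<in> {0..1}" "x \<noteq> y" "w x = w y" for x y
      using inj_onD[OF inj _ that(1,2)] that(3,4) by (auto simp: complex_eq_iff w_def)
    have main: False if xyz: "x \<in> {0..1}" "y \<in> {0..1}" "z \<in> {0..1}" "w x = \<xi>" "w y = \<xi>" "w z = \<xi>"
      "Im (\<gamma> x) < Im (\<gamma> y)" "Im (\<gamma> y) < Im (\<gamma> z)" for x y z
      using convex_curve_level_at_most_twice[OF conv, of "\<gamma> x" "\<gamma> y" "\<gamma> z" \<xi> "\<gamma> tm" "\<gamma> tM"] xyz tm(1) tM(1) lev(4,5)
      by (auto simp: w_def m_def M_def)
    show False
      using neq[of s t] neq[of t u] neq[of s u] main[of s t u] main[of s u t] main[of t s u] main[of t u s] main[of u s t] main[of u t s] t lev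
      by (metis linorder_neqE_linordered_idom)
  qed
  show ?thesis
  proof (cases "m < M")
    case False
    have "w s = w t" if "s \<in> {0..1}" "t \<in> {0..1}" for s t using rng[OF that(1)] rng[OF that(2)] False by auto
    then show ?thesis unfolding w_def by (rule cuttable_const[OF inj])
  next
    case True
    \<comment> \<open>Between the extrema every intermediate level is taken, so outside it is taken at most once.\<close>
    define l h where "l = min tm tM" and "h = max tm tM"
    have lh: "0 \<le> l" "l \<le> h" "h \<le> 1" using tm(1) tM(1) by (auto simp: l_def h_def)
    have ends: "w l = m \<and> w h = M \<or> w l = M \<and> w h = m" by (auto simp: l_def h_def m_def M_def min_def max_def)
    have sub: "continuous_on {a..b} w" if "0 \<le> a" "b \<le> 1" for a b using continuous_on_subset[OF wc] that by auto
    have hit: "\<exists>t. l < t \<and> t < h \<and> w t = \<xi>" if "m < \<xi>" "\<xi> < M" for \<xi>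
      using IVT_open[OF sub lh(2), of \<xi>] lh ends that by auto
    have piece: "cuttable \<gamma> a b" if ab: "0 \<le> a" "a \<le> b" "b \<le> 1"
      and once: "\<And>s t. s \<in> {a..b} \<Longrightarrow> t \<in> {a..b} \<Longrightarrow> s < t \<Longrightarrow> w s = w t \<Longrightarrow> m < w s \<Longrightarrow> w s < M \<Longrightarrow> False" for a b
    proof (rule cuttable_if_levels_once)
      show "inj_on \<gamma> {a..b}" using inj ab by (auto intro: inj_on_subset)
      show "continuous_on {a..b} (\<lambda>t. Re (\<gamma> t))" using sub[OF ab(1,3)] by (simp add: w_def)
      show "Re (\<gamma> t) \<in> {m..M}" if "t \<in> {a..b}" for t using rng[of t] that ab by (auto simp: w_def)
      show "s = t" if "s \<in> {a..b}" "t \<in> {a..b}" "Re (\<gamma> s) = Re (\<gamma> t)" "m < Re (\<gamma> s)" "Re (\<gamma> s) < M" for s t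
        using once[of s t] once[of t s] that by (cases s t rule: linorder_cases) (auto simp: w_def)
    qed (rule ab(2))
    have c0: "cuttable \<gamma> 0 l"
    proof (rule piece)
      fix s t assume st: "s \<in> {0..l}" "t \<in> {0..l}" "s < t" "w s = w t" "m < w s" "w s < M"
      obtain u where u: "l < u" "u < h" "w u = w s" using hit[OF st(5,6)] by blast
      show False by (rule no_three[of s t u "w s"]) (use st lh u in auto)
    qed (use lh in auto)
    have c1: "cuttable \<gamma> h 1"
    proof (rule piece)
      fix s t assume st: "s \<in> {h..1}" "t \<in> {h..1}" "s < t" "w s = w t" "m < w s" "w s < M"
      obtain u where u: "l < u" "u < h" "w u = w s" using hit[OF st(5,6)] by blast
      show False by (rule no_three[of s t u "w s"]) (use st lh u in auto)
    qed (use lh in auto)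
    have "cuttable \<gamma> l h"
    proof (rule piece)
      fix s t assume st: "s \<in> {l..h}" "t \<in> {l..h}" "s < t" "w s = w t" "m < w s" "w s < M"
      \<comment> \<open>Two points at one level would give a nearby level that is taken twice between them and a
        third time on the way to an extremum.\<close>
      have "s \<noteq> l" "t \<noteq> h" using ends st by auto
      then have st': "l < s" "t < h" using st by auto
      define x where "x = (s + t) / 2"
      have x: "s < x" "x < t" using st by (auto simp: x_def)
      have "w x \<noteq> w s"
      proof
        assume "w x = w s"
        then show False by (intro no_three[of s x t "w s"]) (use st x lh in auto)
      qed
      have "w x \<in> {m..M}" using x st lh by (intro rng) auto
      define \<xi> where "\<xi> = (w s + w x) / 2"
      have \<xi>: "w s < \<xi> \<and> \<xi> < w x \<or> w x < \<xi> \<and> \<xi> < w s" "m < \<xi>" "\<xi> < M"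
        using \<open>w x \<noteq> w s\<close> \<open>w x \<in> {m..M}\<close> st(5,6) by (auto simp: \<xi>_def)
      obtain y where y: "s < y" "y < x" "w y = \<xi>" using IVT_open[of s x w \<xi>] sub[of s x] x st lh \<xi>(1) by auto
      obtain z where z: "x < z" "z < t" "w z = \<xi>" using IVT_open[of x t w \<xi>] sub[of x t] x st lh \<xi>(1) by auto
      have "\<exists>u\<in>{0..1}. (u < s \<or> t < u) \<and> w u = \<xi>"
      proof -
        have "w l < \<xi> \<and> \<xi> < w s \<or> w s < \<xi> \<and> \<xi> < w l \<or> w h < \<xi> \<and> \<xi> < w t \<or> w t < \<xi> \<and> \<xi> < w h"
          using ends \<xi> st(4) by (elim disjE conjE) simp_all
        then consider "w l < \<xi> \<and> \<xi> < w s \<or> w s < \<xi> \<and> \<xi> < w l" | "w t < \<xi> \<and> \<xi> < w h \<or> w h < \<xi> \<and> \<xi> < w t" by blast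
        then show ?thesis
        proof cases
          case 1
          obtain u where "l < u" "u < s" "w u = \<xi>" using IVT_open[of l s w \<xi>] sub[of l s] st st' lh 1 by auto
          then show ?thesis using lh st by (intro bexI[of _ u]) auto
        next
          case 2
          obtain u where "t < u" "u < h" "w u = \<xi>" using IVT_open[of t h w \<xi>] sub[of t h] st st' lh 2 by auto
          then show ?thesis using lh st by (intro bexI[of _ u]) auto
        qed
      qed
      then obtain u where u: "u \<in> {0..1}" "u < s \<or> t < u" "w u = \<xi>" by blast
      show False by (rule no_three[of y z u \<xi>]) (use u y z x st lh \<xi> in auto)
    qed (use lh in auto)
    from cuttable_join[OF c0 this lh(1,2)] have "cuttable \<gamma> 0 h" .
    from cuttable_join[OF this c1] show ?thesis using lh by auto
  qed
qed

section \<open>Nets of arcs and their refinement\<close>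

text \<open>The last condition says that some line through \<open>\<gamma> t\<close> is crossed transversally there. It is all that is
  kept of the tangents.\<close>

definition smooth_convex_arc :: "(real \<Rightarrow> complex) \<Rightarrow> bool" where
  "smooth_convex_arc \<gamma> \<longleftrightarrow> continuous_on {0..1} \<gamma> \<and> inj_on \<gamma> {0..1} \<and> convex_set_curve (\<gamma> ` {0..1}) \<and>
     (\<forall>t\<in>{0<..<1}. \<exists>u \<delta>. u \<noteq> 0 \<and> 0 < \<delta> \<and> (\<forall>s\<in>{0..1}. \<bar>s - t\<bar> < \<delta> \<longrightarrow> sgn (u \<bullet> (\<gamma> s - \<gamma> t)) = sgn (s - t)))"

text \<open>The transversal line is the normal to the tangent.\<close>

lemma tangent_transversal:
  assumes inj: "inj_on \<gamma> {0..1}" and t: "t \<in> {0<..<1}" and tan: "has_tangent_at \<gamma> t"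
  shows "\<exists>u \<delta>. u \<noteq> 0 \<and> 0 < \<delta> \<and> (\<forall>s\<in>{0..1}. \<bar>s - t\<bar> < \<delta> \<longrightarrow> sgn (u \<bullet> (\<gamma> s - \<gamma> t)) = sgn (s - t))"
proof -
  obtain u where u: "((\<lambda>s. sgn ((\<gamma> s - \<gamma> t) /\<^sub>R (s - t))) \<longlongrightarrow> u) (at t within {0..1})"
    using tan unfolding has_tangent_at_def by blast
  have "eventually (\<lambda>s. s \<noteq> t \<and> s \<in> {0..1}) (at t within {0..1})"
    unfolding eventually_at_filter by (simp add: eventually_True)
  then have "eventually (\<lambda>s. norm (sgn ((\<gamma> s - \<gamma> t) /\<^sub>R (s - t))) = 1) (at t within {0..1})"
  proof (rule eventually_mono)
    fix s assume s: "s \<noteq> t \<and> s \<in> {0..1}"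
    then have "\<gamma> s \<noteq> \<gamma> t" using inj_onD[OF inj, of s t] t by auto
    then show "norm (sgn ((\<gamma> s - \<gamma> t) /\<^sub>R (s - t))) = 1" using s by (simp add: norm_sgn)
  qed
  then have "((\<lambda>s. norm (sgn ((\<gamma> s - \<gamma> t) /\<^sub>R (s - t)))) \<longlongrightarrow> 1) (at t within {0..1})"
    by (rule tendsto_eventually)
  moreover have "at t within {0..1} \<noteq> bot" using t by (simp add: at_within_Icc_at)
  ultimately have "norm u = 1" using tendsto_unique[OF _ tendsto_norm[OF u]] by blast
  then have "u \<noteq> 0" by auto
  have "((\<lambda>s. u \<bullet> sgn ((\<gamma> s - \<gamma> t) /\<^sub>R (s - t))) \<longlongrightarrow> u \<bullet> u) (at t within {0..1})"
    by (intro tendsto_intros u)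
  moreover have "0 < u \<bullet> u" using \<open>u \<noteq> 0\<close> by simp
  ultimately have "eventually (\<lambda>s. 0 < u \<bullet> sgn ((\<gamma> s - \<gamma> t) /\<^sub>R (s - t))) (at t within {0..1})"
    by (rule order_tendstoD(1))
  then obtain \<delta> where \<delta>: "0 < \<delta>" "\<And>s. s \<in> {0..1} \<Longrightarrow> s \<noteq> t \<Longrightarrow> dist s t < \<delta> \<Longrightarrow> 0 < u \<bullet> sgn ((\<gamma> s - \<gamma> t) /\<^sub>R (s - t))"
    unfolding eventually_at by blast
  have "sgn (u \<bullet> (\<gamma> s - \<gamma> t)) = sgn (s - t)" if s: "s \<in> {0..1}" "\<bar>s - t\<bar> < \<delta>" for s
  proof (cases "s = t")
    case False
    define x where "x = (\<gamma> s - \<gamma> t) /\<^sub>R (s - t)"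
    have "0 < u \<bullet> sgn x" unfolding x_def using \<delta>(2)[OF s(1) False] s(2) by (simp add: dist_real_def)
    moreover have "u \<bullet> sgn x = inverse (norm x) * (u \<bullet> x)" by (simp add: sgn_div_norm)
    ultimately have "0 < inverse (norm x) * (u \<bullet> x)" by simp
    moreover have "0 \<le> inverse (norm x)" by simp
    ultimately have ux: "0 < u \<bullet> x" by (metis mult_nonneg_nonpos not_le)
    have "\<gamma> s - \<gamma> t = (s - t) *\<^sub>R x" using False by (simp add: x_def)
    then have "u \<bullet> (\<gamma> s - \<gamma> t) = (s - t) * (u \<bullet> x)" by simp
    then show ?thesis using ux by (simp add: sgn_mult)
  qed simp
  with \<open>u \<noteq> 0\<close> \<delta>(1) show ?thesis by blast
qed

lemma smooth_convex_arc_if_differentiable: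
  assumes "differentiable_convex_curve \<gamma>" shows "smooth_convex_arc \<gamma>"
proof -
  have \<gamma>: "continuous_on {0..1} \<gamma>" "inj_on \<gamma> {0..1}" "convex_set_curve (\<gamma> ` {0..1})"
    and tan: "\<And>t. t \<in> {0<..<1} \<Longrightarrow> has_tangent_at \<gamma> t"
    using assms by (simp_all add: differentiable_convex_curve_def arc_def path_def path_image_def)
  show ?thesis
    unfolding smooth_convex_arc_def
    by (intro conjI ballI \<gamma> tangent_transversal[OF \<gamma>(2) _ tan])
qed

lemma same_side_commute: "same_side \<L> x y \<longleftrightarrow> same_side \<L> y x"
  unfolding same_side_def by (intro ball_cong refl) (auto simp: eq_commute)

lemma same_side_subset: "same_side \<L> x y \<Longrightarrow> \<L>' \<subseteq> \<L> \<Longrightarrow> same_side \<L>' x y"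
  unfolding same_side_def by blast

text \<open>Each pair of points is separated by a line, which also separates nearby pairs; the product of the
  two sets is compact.\<close>

lemma separating_lines:
  assumes "compact X" "compact Y" "X \<inter> Y = {}"
  shows "\<exists>\<L>. finite \<L> \<and> (\<forall>(a, b)\<in>\<L>. a \<noteq> 0) \<and> (\<forall>x\<in>X. \<forall>y\<in>Y. \<not> same_side \<L> x y)"
proof -
  define U where "U l = {(x, y). fst l \<bullet> x < snd l \<and> snd l < fst l \<bullet> y}" for l :: "complex \<times> real"
  have op: "open (U l)" for l
  proof -
    have "U l = {xy. fst l \<bullet> fst xy < snd l} \<inter> {xy. snd l < fst l \<bullet> snd xy}" by (auto simp: U_def)
    then show ?thesis by (auto intro!: open_Int open_Collect_less continuous_intros)
  qed
  have "X \<times> Y \<subseteq> (\<Union>l\<in>{l. fst l \<noteq> 0}. U l)"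
  proof clarify
    fix x y assume "x \<in> X" "y \<in> Y"
    then have ne: "y - x \<noteq> 0" using assms(3) by auto
    define m where "m = ((y - x) \<bullet> x + (y - x) \<bullet> y) / 2"
    have "0 < (y - x) \<bullet> (y - x)" using ne by simp
    then have "(y - x) \<bullet> x < (y - x) \<bullet> y" by (simp only: inner_diff_right)
    then have "(y - x) \<bullet> x < m" "m < (y - x) \<bullet> y" by (simp_all add: m_def)
    with ne show "(x, y) \<in> (\<Union>l\<in>{l. fst l \<noteq> 0}. U l)"
      by (intro UN_I[of "(y - x, m)"]) (auto simp: U_def)
  qed
  with compactE_image[OF compact_Times[OF assms(1,2)], of "{l. fst l \<noteq> 0}" U] op
  obtain L where L: "L \<subseteq> {l. fst l \<noteq> 0}" "finite L" "X \<times> Y \<subseteq> (\<Union>l\<in>L. U l)" by metis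
  have "\<not> same_side L x y" if xy: "x \<in> X" "y \<in> Y" for x y
  proof -
    have "(x, y) \<in> (\<Union>l\<in>L. U l)" using L(3) xy by blast
    then obtain a b where l: "(a, b) \<in> L" "a \<bullet> x < b" "b < a \<bullet> y" by (auto simp: U_def)
    then have "sgn (a \<bullet> x - b) \<noteq> sgn (a \<bullet> y - b)" by simp
    with l(1) show ?thesis unfolding same_side_def by blast
  qed
  with L show ?thesis by (intro exI[of _ L]) auto
qed

fun piece :: "(real \<Rightarrow> complex) \<times> real \<times> real \<Rightarrow> complex set" where
  "piece (\<gamma>, p, q) = \<gamma> ` {p..q}"

definition separated_by :: "complex set \<Rightarrow> ((real \<Rightarrow> complex) \<times> real \<times> real) set \<Rightarrow> (complex \<times> real) set \<Rightarrow> bool" where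
  "separated_by \<sigma> \<B> \<L> \<longleftrightarrow> finite \<L> \<and> (\<forall>(a, b)\<in>\<L>. a \<noteq> 0) \<and>
     (\<forall>x\<in>\<sigma>. \<forall>y\<in>\<sigma>. same_side \<L> x y \<longrightarrow> (\<exists>b\<in>\<B>. x \<in> piece b \<and> y \<in> piece b))"

text \<open>A set covered by finitely many pieces \<open>\<gamma> ` {p..q}\<close> of arcs that meet only in \<open>V\<close>, where \<open>V\<close> consists
  of the ends of the pieces. A piece remembers its arc, so refining a net only changes parameters and
  keeps properties of the arcs.\<close>

definition net :: "complex set \<Rightarrow> complex set \<Rightarrow> ((real \<Rightarrow> complex) \<times> real \<times> real) set \<Rightarrow> bool" where
  "net \<sigma> V \<B> \<longleftrightarrow> finite \<B> \<and> finite V \<and> V \<subseteq> \<sigma> \<and> \<sigma> = \<Union> (piece ` \<B>) \<and>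
     (\<forall>\<gamma> p q. (\<gamma>, p, q) \<in> \<B> \<longrightarrow> smooth_convex_arc \<gamma> \<and> 0 \<le> p \<and> p < q \<and> q \<le> 1 \<and> \<gamma> ` {p..q} \<inter> V = {\<gamma> p, \<gamma> q}) \<and>
     (\<forall>b\<in>\<B>. \<forall>b'\<in>\<B>. b \<noteq> b' \<longrightarrow> piece b \<inter> piece b' \<subseteq> V) \<and> (\<exists>\<L>. separated_by \<sigma> \<B> \<L>)"

lemma netD:
  assumes "net \<sigma> V \<B>"
  shows "finite \<B>" "finite V" "V \<subseteq> \<sigma>" "\<sigma> = \<Union> (piece ` \<B>)"
    "(\<gamma>, p, q) \<in> \<B> \<Longrightarrow> smooth_convex_arc \<gamma>" "(\<gamma>, p, q) \<in> \<B> \<Longrightarrow> 0 \<le> p"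
    "(\<gamma>, p, q) \<in> \<B> \<Longrightarrow> p < q" "(\<gamma>, p, q) \<in> \<B> \<Longrightarrow> q \<le> 1"
    "(\<gamma>, p, q) \<in> \<B> \<Longrightarrow> \<gamma> ` {p..q} \<inter> V = {\<gamma> p, \<gamma> q}"
    "b \<in> \<B> \<Longrightarrow> b' \<in> \<B> \<Longrightarrow> b \<noteq> b' \<Longrightarrow> piece b \<inter> piece b' \<subseteq> V"
    "\<exists>\<L>. separated_by \<sigma> \<B> \<L>"
proof -
  note N = assms[unfolded net_def]
  show "finite \<B>" by (rule N[THEN conjunct1])
  show "finite V" by (rule N[THEN conjunct2, THEN conjunct1])
  show "V \<subseteq> \<sigma>" by (rule N[THEN conjunct2, THEN conjunct2, THEN conjunct1])
  show "\<sigma> = \<Union> (piece ` \<B>)" by (rule N[THEN conjunct2, THEN conjunct2, THEN conjunct2, THEN conjunct1])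
  note N' = N[THEN conjunct2, THEN conjunct2, THEN conjunct2, THEN conjunct2]
  note P = N'[THEN conjunct1, rule_format, of \<gamma> p q]
  show "(\<gamma>, p, q) \<in> \<B> \<Longrightarrow> smooth_convex_arc \<gamma>" by (rule P[THEN conjunct1])
  show "(\<gamma>, p, q) \<in> \<B> \<Longrightarrow> 0 \<le> p" by (rule P[THEN conjunct2, THEN conjunct1])
  show "(\<gamma>, p, q) \<in> \<B> \<Longrightarrow> p < q" by (rule P[THEN conjunct2, THEN conjunct2, THEN conjunct1])
  show "(\<gamma>, p, q) \<in> \<B> \<Longrightarrow> q \<le> 1" by (rule P[THEN conjunct2, THEN conjunct2, THEN conjunct2, THEN conjunct1])
  show "(\<gamma>, p, q) \<in> \<B> \<Longrightarrow> \<gamma> ` {p..q} \<inter> V = {\<gamma> p, \<gamma> q}"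
    by (rule P[THEN conjunct2, THEN conjunct2, THEN conjunct2, THEN conjunct2])
  show "b \<in> \<B> \<Longrightarrow> b' \<in> \<B> \<Longrightarrow> b \<noteq> b' \<Longrightarrow> piece b \<inter> piece b' \<subseteq> V"
    by (rule N'[THEN conjunct2, THEN conjunct1, rule_format])
  show "\<exists>\<L>. separated_by \<sigma> \<B> \<L>" by (rule N'[THEN conjunct2, THEN conjunct2])
qed

lemma netI:
  assumes "finite \<B>" "finite V" "V \<subseteq> \<sigma>" "\<sigma> = \<Union> (piece ` \<B>)"
    and "\<And>\<gamma> p q. (\<gamma>, p, q) \<in> \<B> \<Longrightarrow> smooth_convex_arc \<gamma> \<and> 0 \<le> p \<and> p < q \<and> q \<le> 1 \<and> \<gamma> ` {p..q} \<inter> V = {\<gamma> p, \<gamma> q}"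
    and "\<And>b b'. b \<in> \<B> \<Longrightarrow> b' \<in> \<B> \<Longrightarrow> b \<noteq> b' \<Longrightarrow> piece b \<inter> piece b' \<subseteq> V"
    and "separated_by \<sigma> \<B> \<L>"
  shows "net \<sigma> V \<B>"
  unfolding net_def by (intro conjI allI ballI impI exI[of _ \<L>] assms)

lemma net_lines:
  assumes "net \<sigma> V \<B>"
  obtains \<L> where "finite \<L>" "\<forall>(a, b)\<in>\<L>. a \<noteq> 0"
    "\<forall>x\<in>\<sigma>. \<forall>y\<in>\<sigma>. same_side \<L> x y \<longrightarrow> (\<exists>b\<in>\<B>. x \<in> piece b \<and> y \<in> piece b)"
proof -
  obtain \<L> where L: "separated_by \<sigma> \<B> \<L>" using netD(11)[OF assms] by (rule exE)
  note L = L[unfolded separated_by_def]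
  show thesis
    by (rule that[of \<L>], rule L[THEN conjunct1], rule L[THEN conjunct2, THEN conjunct1],
        rule L[THEN conjunct2, THEN conjunct2])
qed

lemma smooth_convex_arcD:
  assumes "smooth_convex_arc \<gamma>" "0 \<le> p" "q \<le> 1"
  shows "continuous_on {p..q} \<gamma>" "inj_on \<gamma> {p..q}"
proof -
  have sub: "{p..q} \<subseteq> {0..1}" using assms(2,3) by auto
  have "continuous_on {0..1} \<gamma>" "inj_on \<gamma> {0..1}" using assms(1) by (simp_all add: smooth_convex_arc_def)
  then show "continuous_on {p..q} \<gamma>" "inj_on \<gamma> {p..q}"
    using continuous_on_subset[OF _ sub] inj_on_subset[OF _ sub] by blast+
qed

lemma net_piece_compact:
  assumes "net \<sigma> V \<B>" "b \<in> \<B>" shows "compact (piece b)" "connected (piece b)"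
proof -
  obtain \<gamma> p q where b: "b = (\<gamma>, p, q)" by (cases b)
  then have "continuous_on {p..q} \<gamma>"
    using netD(5,6,8)[OF assms(1)] assms(2) by (intro smooth_convex_arcD) auto
  then show "compact (piece b)" "connected (piece b)"
    unfolding b by (auto intro: compact_continuous_image connected_continuous_image)
qed

lemma net_compact:
  assumes "net \<sigma> V \<B>" shows "compact \<sigma>"
proof -
  have "compact (\<Union> (piece ` \<B>))"
  proof (rule compact_Union)
    show "finite (piece ` \<B>)" using netD(1)[OF assms] by simp
    show "compact T" if T: "T \<in> piece ` \<B>" for T
    proof -
      obtain b where "b \<in> \<B>" "T = piece b" using T by blast
      then show ?thesis using net_piece_compact(1)[OF assms] by simp
    qed
  qed
  then show ?thesis by (simp only: netD(4)[OF assms, symmetric])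
qed

lemma net_empty: "net {} {} {}"
  unfolding net_def separated_by_def by (auto intro!: exI[of _ "{}"])

lemma net_Un:
  assumes N: "net \<sigma> V \<B>" and N': "net \<tau> W \<B>'" and disj: "\<sigma> \<inter> \<tau> = {}"
  shows "net (\<sigma> \<union> \<tau>) (V \<union> W) (\<B> \<union> \<B>')"
proof -
  have sub: "piece b \<subseteq> \<sigma>" if "b \<in> \<B>" for b using netD(4)[OF N] that by blast
  have sub': "piece b \<subseteq> \<tau>" if "b \<in> \<B>'" for b using netD(4)[OF N'] that by blast
  obtain \<L>0 where L0: "finite \<L>0" "\<forall>(a, b)\<in>\<L>0. a \<noteq> 0" "\<forall>x\<in>\<sigma>. \<forall>y\<in>\<tau>. \<not> same_side \<L>0 x y"
    using separating_lines[OF net_compact[OF N] net_compact[OF N'] disj] by blast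
  obtain \<L>1 where L1: "finite \<L>1" "\<forall>(a, b)\<in>\<L>1. a \<noteq> 0"
    "\<forall>x\<in>\<sigma>. \<forall>y\<in>\<sigma>. same_side \<L>1 x y \<longrightarrow> (\<exists>b\<in>\<B>. x \<in> piece b \<and> y \<in> piece b)"
    using net_lines[OF N] .
  obtain \<L>2 where L2: "finite \<L>2" "\<forall>(a, b)\<in>\<L>2. a \<noteq> 0"
    "\<forall>x\<in>\<tau>. \<forall>y\<in>\<tau>. same_side \<L>2 x y \<longrightarrow> (\<exists>b\<in>\<B>'. x \<in> piece b \<and> y \<in> piece b)"
    using net_lines[OF N'] .
  have sep: "separated_by (\<sigma> \<union> \<tau>) (\<B> \<union> \<B>') (\<L>0 \<union> \<L>1 \<union> \<L>2)"
    unfolding separated_by_def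
  proof (intro conjI ballI impI)
    fix x y assume xy: "x \<in> \<sigma> \<union> \<tau>" "y \<in> \<sigma> \<union> \<tau>" and s: "same_side (\<L>0 \<union> \<L>1 \<union> \<L>2) x y"
    have s0: "same_side \<L>0 x y" and s1: "same_side \<L>1 x y" and s2: "same_side \<L>2 x y"
      by (rule same_side_subset[OF s]; blast)+
    have "same_side \<L>0 y x" by (rule same_side_commute[THEN iffD1, OF s0])
    with s0 have "x \<in> \<sigma> \<and> y \<in> \<sigma> \<or> x \<in> \<tau> \<and> y \<in> \<tau>" using L0(3) xy by blast
    then show "\<exists>b\<in>\<B> \<union> \<B>'. x \<in> piece b \<and> y \<in> piece b"
      using L1(3)[rule_format, OF _ _ s1] L2(3)[rule_format, OF _ _ s2] by blast
  qed (use L0(1,2) L1(1,2) L2(1,2) in auto)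
  have pieces: "smooth_convex_arc \<gamma> \<and> 0 \<le> p \<and> p < q \<and> q \<le> 1 \<and> \<gamma> ` {p..q} \<inter> (V \<union> W) = {\<gamma> p, \<gamma> q}"
    if "(\<gamma>, p, q) \<in> \<B> \<union> \<B>'" for \<gamma> p q
  proof (cases "(\<gamma>, p, q) \<in> \<B>")
    case True
    then have "\<gamma> ` {p..q} \<inter> W = {}" using sub[OF True] netD(3)[OF N'] disj by auto
    then have "\<gamma> ` {p..q} \<inter> (V \<union> W) = {\<gamma> p, \<gamma> q}" using netD(9)[OF N True] by blast
    then show ?thesis using netD(5-8)[OF N True] by blast
  next
    case False
    then have B: "(\<gamma>, p, q) \<in> \<B>'" using that by blast
    then have "\<gamma> ` {p..q} \<inter> V = {}" using sub'[OF B] netD(3)[OF N] disj by auto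
    then have "\<gamma> ` {p..q} \<inter> (V \<union> W) = {\<gamma> p, \<gamma> q}" using netD(9)[OF N' B] by blast
    then show ?thesis using netD(5-8)[OF N' B] by blast
  qed
  have meet: "piece b \<inter> piece b' \<subseteq> V \<union> W" if bb: "b \<in> \<B> \<union> \<B>'" "b' \<in> \<B> \<union> \<B>'" "b \<noteq> b'" for b b'
  proof -
    consider "b \<in> \<B>" "b' \<in> \<B>" | "b \<in> \<B>'" "b' \<in> \<B>'" | "b \<in> \<B>" "b' \<in> \<B>'" | "b \<in> \<B>'" "b' \<in> \<B>" using bb by blast
    then show ?thesis
    proof cases
      case 1 then show ?thesis using netD(10)[OF N 1 bb(3)] by blast
    next
      case 2 then show ?thesis using netD(10)[OF N' 2 bb(3)] by blast
    next
      case 3 then show ?thesis using sub[OF 3(1)] sub'[OF 3(2)] disj by blast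
    next
      case 4 then show ?thesis using sub'[OF 4(1)] sub[OF 4(2)] disj by blast
    qed
  qed
  have "\<sigma> \<union> \<tau> = \<Union> (piece ` (\<B> \<union> \<B>'))"
    unfolding image_Un Union_Un_distrib netD(4)[OF N, symmetric] netD(4)[OF N', symmetric] ..
  moreover have "V \<union> W \<subseteq> \<sigma> \<union> \<tau>" using netD(3)[OF N] netD(3)[OF N'] by blast
  ultimately show ?thesis
    using netD(1,2)[OF N] netD(1,2)[OF N'] by (intro netI[OF _ _ _ _ pieces meet sep]) simp_all
qed

text \<open>The piece through \<open>w\<close> is replaced by its two halves. The work is in separating the halves by lines.\<close>

lemma net_cut:
  assumes N: "net \<sigma> V \<B>" and w: "w \<in> \<sigma>" "w \<notin> V"
  shows "\<exists>\<B>'. net \<sigma> (insert w V) \<B>' \<and> fst ` \<B>' \<subseteq> fst ` \<B>"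
proof -
  have "w \<in> \<Union> (piece ` \<B>)" using w(1) netD(4)[OF N] by simp
  then obtain \<gamma> p q where B: "(\<gamma>, p, q) \<in> \<B>" and "w \<in> piece (\<gamma>, p, q)" by auto
  then obtain m where m': "m \<in> {p..q}" and wm: "w = \<gamma> m" by auto
  note N5 = netD(5)[OF N B] and pq = netD(6-8)[OF N B] and ends = netD(9)[OF N B]
  have "\<gamma> p \<in> V" "\<gamma> q \<in> V" using ends by blast+
  then have m: "p < m" "m < q" using w(2) wm m' by (auto simp: less_eq_real_def)
  have inj: "inj_on \<gamma> {p..q}" by (rule smooth_convex_arcD[OF N5 pq(1,3)])
  have cont: "continuous_on {p..q} \<gamma>" by (rule smooth_convex_arcD[OF N5 pq(1,3)])
  have cpt: "compact (\<gamma> ` {x..y})" if "p \<le> x" "y \<le> q" for x y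
    using continuous_on_subset[OF cont] that by (intro compact_continuous_image) auto
  obtain u \<delta> where u: "u \<noteq> 0" "0 < \<delta>" "\<And>s. s \<in> {0..1} \<Longrightarrow> \<bar>s - m\<bar> < \<delta> \<Longrightarrow> sgn (u \<bullet> (\<gamma> s - \<gamma> m)) = sgn (s - m)"
  proof -
    have "m \<in> {0<..<1}" using m pq by auto
    then have "\<exists>u \<delta>. u \<noteq> 0 \<and> 0 < \<delta> \<and> (\<forall>s\<in>{0..1}. \<bar>s - m\<bar> < \<delta> \<longrightarrow> sgn (u \<bullet> (\<gamma> s - \<gamma> m)) = sgn (s - m))"
      using N5 unfolding smooth_convex_arc_def by blast
    then show thesis using that by blast
  qed
  have disj: "\<gamma> ` {p..x} \<inter> \<gamma> ` {y..q} = {}" if "x < y" "p \<le> y" "x \<le> q" for x y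
    using inj_onD[OF inj] that by force
  \<comment> \<open>The line through \<open>w\<close> with normal \<open>u\<close> separates the two halves near \<open>w\<close>; away from \<open>w\<close> they are
    separated because they are disjoint and compact.\<close>
  obtain \<L>1 where L1: "finite \<L>1" "\<forall>(a, b)\<in>\<L>1. a \<noteq> 0" "\<forall>x\<in>\<gamma> ` {p..m - \<delta>}. \<forall>y\<in>\<gamma> ` {m..q}. \<not> same_side \<L>1 x y"
    using separating_lines[OF cpt cpt disj, of "m - \<delta>" m] m u(2) by auto
  obtain \<L>2 where L2: "finite \<L>2" "\<forall>(a, b)\<in>\<L>2. a \<noteq> 0" "\<forall>x\<in>\<gamma> ` {p..m}. \<forall>y\<in>\<gamma> ` {m + \<delta>..q}. \<not> same_side \<L>2 x y"
    using separating_lines[OF cpt cpt disj, of m "m + \<delta>"] m u(2) by auto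
  obtain \<L> where L: "finite \<L>" "\<forall>(a, b)\<in>\<L>. a \<noteq> 0"
    "\<forall>x\<in>\<sigma>. \<forall>y\<in>\<sigma>. same_side \<L> x y \<longrightarrow> (\<exists>b\<in>\<B>. x \<in> piece b \<and> y \<in> piece b)"
    using net_lines[OF N] .
  define \<B>0 where "\<B>0 = \<B> - {(\<gamma>, p, q)}"
  define \<B>' where "\<B>' = insert (\<gamma>, p, m) (insert (\<gamma>, m, q) \<B>0)"
  have split: "\<gamma> ` {p..q} = \<gamma> ` {p..m} \<union> \<gamma> ` {m..q}"
    using m by (simp add: image_Un[symmetric] ivl_disj_un_two_touch)
  have other: "piece b \<inter> \<gamma> ` {p..q} \<subseteq> V" if "b \<in> \<B>0" for b
    using netD(10)[OF N _ B, of b] that by (auto simp: \<B>0_def)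
  have wother: "w \<notin> piece b" if "b \<in> \<B>0" for b
    using other[OF that] w(2) wm m' by blast
  have nq: "\<gamma> q \<notin> \<gamma> ` {p..m}" "\<gamma> p \<notin> \<gamma> ` {m..q}" using disj[of m q] disj[of p m] m by force+
  have sep: "separated_by \<sigma> \<B>' (insert (u, u \<bullet> w) (\<L> \<union> \<L>1 \<union> \<L>2))" (is "separated_by _ _ ?\<L>")
    unfolding separated_by_def
  proof (intro conjI ballI impI)
    have half: "\<exists>b\<in>\<B>'. \<gamma> s \<in> piece b \<and> \<gamma> t \<in> piece b" if st: "s \<in> {p..q}" "t \<in> {p..q}" "s \<le> t" and ss: "same_side ?\<L> (\<gamma> s) (\<gamma> t)" for s t
    proof -
      consider "t \<le> m" | "m \<le> s" | "s < m" "m < t" by linarith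
      then show ?thesis
      proof cases
        case 1
        then show ?thesis using st by (intro bexI[of _ "(\<gamma>, p, m)"]) (auto simp: \<B>'_def)
      next
        case 2
        then show ?thesis using st by (intro bexI[of _ "(\<gamma>, m, q)"]) (auto simp: \<B>'_def)
      next
        case 3
        have ss1: "same_side \<L>1 (\<gamma> s) (\<gamma> t)" "same_side \<L>2 (\<gamma> s) (\<gamma> t)" by (rule same_side_subset[OF ss]; blast)+
        have "m - \<delta> < s"
        proof (rule ccontr)
          assume "\<not> m - \<delta> < s"
          then have "\<gamma> s \<in> \<gamma> ` {p..m - \<delta>}" "\<gamma> t \<in> \<gamma> ` {m..q}" using st 3 by auto
          then show False using L1(3) ss1(1) by blast
        qed
        moreover have "t < m + \<delta>"
        proof (rule ccontr)
          assume "\<not> t < m + \<delta>"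
          then have "\<gamma> s \<in> \<gamma> ` {p..m}" "\<gamma> t \<in> \<gamma> ` {m + \<delta>..q}" using st 3 by auto
          then show False using L2(3) ss1(2) by blast
        qed
        ultimately have "\<bar>s - m\<bar> < \<delta>" "\<bar>t - m\<bar> < \<delta>" using 3 by auto
        moreover have "s \<in> {0..1}" "t \<in> {0..1}" using st pq by auto
        ultimately have "sgn (u \<bullet> (\<gamma> s - \<gamma> m)) = sgn (s - m)" "sgn (u \<bullet> (\<gamma> t - \<gamma> m)) = sgn (t - m)"
          using u(3) by blast+
        then have "sgn (u \<bullet> \<gamma> s - u \<bullet> w) = - 1" "sgn (u \<bullet> \<gamma> t - u \<bullet> w) = 1"
          using 3 by (simp_all add: wm inner_diff_right)
        moreover have "sgn (u \<bullet> \<gamma> s - u \<bullet> w) = sgn (u \<bullet> \<gamma> t - u \<bullet> w)" using ss unfolding same_side_def by auto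
        ultimately show ?thesis by simp
      qed
    qed
    fix x y assume xy: "x \<in> \<sigma>" "y \<in> \<sigma>" and ss: "same_side ?\<L> x y"
    have "same_side \<L> x y" by (rule same_side_subset[OF ss]) blast
    then obtain b where b: "b \<in> \<B>" "x \<in> piece b" "y \<in> piece b" using L(3)[rule_format, OF xy] by blast
    show "\<exists>b\<in>\<B>'. x \<in> piece b \<and> y \<in> piece b"
    proof (cases "b = (\<gamma>, p, q)")
      case True
      then obtain s t where st: "s \<in> {p..q}" "t \<in> {p..q}" "x = \<gamma> s" "y = \<gamma> t" using b by auto
      show ?thesis
      proof (cases "s \<le> t")
        case True
        then show ?thesis using half[OF st(1,2)] ss unfolding st(3,4) by blast
      next
        case False
        then have "t \<le> s" by simp
        then show ?thesis using half[OF st(2,1)] ss same_side_commute unfolding st(3,4) by blast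
      qed
    next
      case False
      then show ?thesis using b by (auto simp: \<B>'_def \<B>0_def)
    qed
  qed (use L L1 L2 u(1) in auto)
  have restrict: "A \<inter> insert z V = {x, z}" if "A \<inter> V \<subseteq> {x, y}" "y \<notin> A" "x \<in> A" "x \<in> V" "z \<in> A" for A x y z
    using that by blast
  have P1: "\<gamma> ` {p..m} \<subseteq> \<gamma> ` {p..q}" and P2: "\<gamma> ` {m..q} \<subseteq> \<gamma> ` {p..q}"
    unfolding split by (rule Un_upper1, rule Un_upper2)
  have new1: "\<gamma> ` {p..m} \<inter> insert w V = {\<gamma> p, \<gamma> m}"
    unfolding wm
  proof (rule restrict[OF _ nq(1) _ \<open>\<gamma> p \<in> V\<close>])
    show "\<gamma> ` {p..m} \<inter> V \<subseteq> {\<gamma> p, \<gamma> q}" unfolding ends[symmetric] by (rule Int_mono[OF P1 subset_refl])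
  qed (use m in auto)
  have new2: "\<gamma> ` {m..q} \<inter> insert w V = {\<gamma> m, \<gamma> q}"
    unfolding wm insert_commute[of "\<gamma> m" "\<gamma> q"]
  proof (rule restrict[OF _ nq(2) _ \<open>\<gamma> q \<in> V\<close>])
    show "\<gamma> ` {m..q} \<inter> V \<subseteq> {\<gamma> q, \<gamma> p}"
      unfolding insert_commute[of "\<gamma> q" "\<gamma> p"] ends[symmetric] by (rule Int_mono[OF P2 subset_refl])
  qed (use m in auto)
  have pieces: "smooth_convex_arc \<alpha> \<and> 0 \<le> x \<and> x < y \<and> y \<le> 1 \<and> \<alpha> ` {x..y} \<inter> insert w V = {\<alpha> x, \<alpha> y}"
    if new: "(\<alpha>, x, y) \<in> \<B>'" for \<alpha> x y
  proof -
    consider "(\<alpha>, x, y) = (\<gamma>, p, m)" | "(\<alpha>, x, y) = (\<gamma>, m, q)" | "(\<alpha>, x, y) \<in> \<B>0" using new unfolding \<B>'_def by blast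
    then show ?thesis
    proof cases
      case 1 then show ?thesis using new1 N5 m pq by simp
    next
      case 2 then show ?thesis using new2 N5 m pq by simp
    next
      case 3
      then have "(\<alpha>, x, y) \<in> \<B>" by (simp add: \<B>0_def)
      with netD(5-9)[OF N this] wother[OF 3] show ?thesis by auto
    qed
  qed
  have new_new: "\<gamma> ` {p..m} \<inter> \<gamma> ` {m..q} \<subseteq> insert w V"
  proof -
    have "s = t" if "s \<in> {p..m}" "t \<in> {m..q}" "\<gamma> s = \<gamma> t" for s t
      using inj_onD[OF inj that(3)] that m by auto
    then show ?thesis using wm by fastforce
  qed
  have meet: "piece b \<inter> piece b' \<subseteq> insert w V" if bb: "b \<in> \<B>'" "b' \<in> \<B>'" "b \<noteq> b'" for b b'
  proof -
    have avoid: "A \<inter> C \<subseteq> insert w V \<and> C \<inter> A \<subseteq> insert w V" if "A \<subseteq> X" "C \<inter> X \<subseteq> V" for A C X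
      using that by blast
    have with_old: "piece c \<inter> piece d \<subseteq> insert w V \<and> piece d \<inter> piece c \<subseteq> insert w V"
      if "c = (\<gamma>, p, m) \<or> c = (\<gamma>, m, q)" "d \<in> \<B>0" for c d
    proof (rule avoid[OF _ other[OF that(2)]])
      show "piece c \<subseteq> \<gamma> ` {p..q}" using that(1) P1 P2 by (elim disjE) simp_all
    qed
    have c: "b = (\<gamma>, p, m) \<or> b = (\<gamma>, m, q) \<or> b \<in> \<B>0" "b' = (\<gamma>, p, m) \<or> b' = (\<gamma>, m, q) \<or> b' \<in> \<B>0"
      using bb(1,2) unfolding \<B>'_def insert_iff .
    have "b = (\<gamma>, p, m) \<and> b' = (\<gamma>, m, q) \<or> b = (\<gamma>, m, q) \<and> b' = (\<gamma>, p, m) \<or>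
        (b = (\<gamma>, p, m) \<or> b = (\<gamma>, m, q)) \<and> b' \<in> \<B>0 \<or> (b' = (\<gamma>, p, m) \<or> b' = (\<gamma>, m, q)) \<and> b \<in> \<B>0 \<or> b \<in> \<B>0 \<and> b' \<in> \<B>0"
      using c bb(3) by argo
    then show ?thesis
    proof (elim disjE[of "_ \<and> _"] conjE)
      assume "b = (\<gamma>, p, m)" "b' = (\<gamma>, m, q)"
      then show ?thesis using new_new by simp
    next
      assume "b = (\<gamma>, m, q)" "b' = (\<gamma>, p, m)"
      then show ?thesis using new_new by (simp add: Int_commute)
    next
      assume "b = (\<gamma>, p, m) \<or> b = (\<gamma>, m, q)" "b' \<in> \<B>0"
      from with_old[OF this] show ?thesis ..
    next
      assume "b' = (\<gamma>, p, m) \<or> b' = (\<gamma>, m, q)" "b \<in> \<B>0"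
      from with_old[OF this] show ?thesis ..
    next
      assume "b \<in> \<B>0" "b' \<in> \<B>0"
      then have "piece b \<inter> piece b' \<subseteq> V" using netD(10)[OF N _ _ bb(3)] by (simp add: \<B>0_def)
      then show ?thesis by (rule subset_trans) (rule subset_insertI)
    qed
  qed
  have "\<Union> (piece ` \<B>) = \<gamma> ` {p..q} \<union> \<Union> (piece ` \<B>0)" 
  proof -
    have "\<B> = insert (\<gamma>, p, q) \<B>0" using B by (simp add: \<B>0_def insert_absorb)
    then have "\<Union> (piece ` \<B>) = \<Union> (piece ` insert (\<gamma>, p, q) \<B>0)" by (rule arg_cong)
    then show ?thesis by simp
  qed
  then have "\<sigma> = \<gamma> ` {p..q} \<union> \<Union> (piece ` \<B>0)" by (rule trans[OF netD(4)[OF N]])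
  then have cov: "\<sigma> = \<Union> (piece ` \<B>')" unfolding split by (simp add: \<B>'_def Un_assoc)
  have "net \<sigma> (insert w V) \<B>'"
  proof (rule netI[OF _ _ _ cov pieces meet sep])
    show "finite \<B>'" using netD(1)[OF N] by (simp add: \<B>'_def \<B>0_def)
    show "finite (insert w V)" using netD(2)[OF N] by simp
    show "insert w V \<subseteq> \<sigma>" using netD(3)[OF N] w(1) by simp
  qed
  moreover have "fst ` \<B>' \<subseteq> fst ` \<B>" using B by (force simp: \<B>'_def \<B>0_def)
  ultimately show ?thesis by blast
qed

lemma net_refine:
  assumes "finite W" "net \<sigma> V \<B>" "W \<subseteq> \<sigma>"
  shows "\<exists>\<B>'. net \<sigma> (W \<union> V) \<B>' \<and> fst ` \<B>' \<subseteq> fst ` \<B>"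
  using assms
proof (induction W)
  case empty
  then show ?case by (intro exI[of _ \<B>]) simp
next
  case (insert w W)
  then obtain \<B>1 where B1: "net \<sigma> (W \<union> V) \<B>1" "fst ` \<B>1 \<subseteq> fst ` \<B>" by blast
  show ?case
  proof (cases "w \<in> W \<union> V")
    case True
    then have "insert w W \<union> V = W \<union> V" by blast
    with B1 show ?thesis by (intro exI[of _ \<B>1]) simp
  next
    case False
    from net_cut[OF B1(1) _ False] insert(5) obtain \<B>2 where "net \<sigma> (insert w (W \<union> V)) \<B>2" "fst ` \<B>2 \<subseteq> fst ` \<B>1" by blast
    with B1(2) show ?thesis by (intro exI[of _ \<B>2]) auto
  qed
qed

section \<open>Unions of polygonally inscribed curves\<close>

lemma piece_subset_net:
  assumes "net \<sigma> V \<B>" "b \<in> \<B>" shows "piece b \<subseteq> \<sigma>"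
proof -
  have "piece b \<subseteq> \<Union> (piece ` \<B>)" by (rule Union_upper[OF imageI[OF assms(2)]])
  then show ?thesis by (simp only: netD(4)[OF assms(1), symmetric])
qed

lemma extreme_point_in_frontier:
  fixes P :: "complex set"
  assumes "convex_polygon P" "v extreme_point_of P" shows "v \<in> frontier P"
proof -
  have "closed P" using assms(1) polytope_imp_closed unfolding convex_polygon_def by blast
  moreover have "v \<in> P" using assms(2) by (simp add: extreme_point_of_def)
  moreover have "v \<notin> interior P" by (rule extreme_point_not_in_interior[OF assms(2)])
  ultimately show ?thesis by (simp add: frontier_def)
qed

text \<open>A common vertex or a common side does not meet the interior.\<close>

lemma mosaic_intersection_frontier:
  assumes M: "polygonal_mosaic \<M>" and PQ: "P \<in> \<M>" "Q \<in> \<M>" "P \<noteq> Q"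
  shows "P \<inter> Q \<subseteq> frontier P"
proof (cases "P \<inter> Q = {}")
  case False
  note M' = M[unfolded polygonal_mosaic_def]
  have pol: "convex_polygon P" by (rule M'[THEN conjunct2, THEN conjunct1, rule_format, OF PQ(1)])
  have "(\<exists>v. P \<inter> Q = {v} \<and> v extreme_point_of P \<and> v extreme_point_of Q) \<or> (P \<inter> Q) edge_of P \<and> (P \<inter> Q) edge_of Q"
    using M'[THEN conjunct2, THEN conjunct2, THEN conjunct2, rule_format, OF PQ(1,2)] PQ(3) False by simp
  then show ?thesis
  proof
    assume "\<exists>v. P \<inter> Q = {v} \<and> v extreme_point_of P \<and> v extreme_point_of Q"
    then obtain v where "P \<inter> Q = {v}" "v extreme_point_of P" by blast
    with extreme_point_in_frontier[OF pol] show ?thesis by simp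
  next
    assume "(P \<inter> Q) edge_of P \<and> (P \<inter> Q) edge_of Q"
    then have e: "(P \<inter> Q) face_of P" "aff_dim (P \<inter> Q) = 1" by (auto simp: edge_of_def)
    have "P \<inter> Q \<noteq> P" using e(2) pol unfolding convex_polygon_def by auto
    then have "P \<inter> Q \<inter> interior P = {}" by (rule face_of_disjoint_interior[OF e(1)])
    moreover have "closed P" using pol polytope_imp_closed unfolding convex_polygon_def by blast
    ultimately show ?thesis by (auto simp: frontier_def)
  qed
qed simp

lemma polygon_halfspaces:
  assumes "convex_polygon P"
  shows "\<exists>L. finite L \<and> (\<forall>(a, b)\<in>L. a \<noteq> 0) \<and> P = {z. \<forall>(a, b)\<in>L. a \<bullet> z \<le> b}"
proof -
  have "polyhedron P" using assms polytope_imp_polyhedron unfolding convex_polygon_def by blast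
  then obtain F where F: "finite F" "P = \<Inter>F" "\<forall>h\<in>F. \<exists>a b. a \<noteq> 0 \<and> h = {x. a \<bullet> x \<le> b}"
    unfolding polyhedron_def by blast
  then have "\<forall>h\<in>F. \<exists>l. fst l \<noteq> 0 \<and> h = {x. fst l \<bullet> x \<le> snd l}" by simp
  then obtain l where l: "\<And>h. h \<in> F \<Longrightarrow> fst (l h) \<noteq> 0" "\<And>h. h \<in> F \<Longrightarrow> h = {x. fst (l h) \<bullet> x \<le> snd (l h)}"
    by metis
  have "z \<in> \<Inter>F \<longleftrightarrow> (\<forall>h\<in>F. fst (l h) \<bullet> z \<le> snd (l h))" for z
    using l(2) by blast
  then have "P = {z. \<forall>h\<in>F. fst (l h) \<bullet> z \<le> snd (l h)}" unfolding F(2) by (intro set_eqI) simp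
  then have "P = {z. \<forall>(a, b)\<in>l ` F. a \<bullet> z \<le> b}" by (simp add: case_prod_unfold)
  moreover have "\<forall>(a, b)\<in>l ` F. a \<noteq> 0" using l(1) by (simp add: case_prod_unfold)
  ultimately show ?thesis using F(1) by (intro exI[of _ "l ` F"]) auto
qed

text \<open>Each polygon is an intersection of half-planes, and the boundary lines of these half-planes separate:
  a point on the same side of all of them as a point of a polygon \<open>P\<close> lies in \<open>P\<close>, so both points lie on the single curve \<open>\<sigma> \<inter> P\<close>. Different curves meet in the
  boundaries of their polygons, hence only at their ends.\<close>

lemma PIC_net:
  assumes "\<sigma> \<in> PIC" shows "\<exists>V \<B>. net \<sigma> V \<B>"
proof -
  obtain \<M> where M: "polygonal_mosaic \<M>" "\<sigma> \<subseteq> \<Union>\<M>"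
    and cur: "\<forall>P\<in>\<M>. \<exists>\<gamma>. differentiable_convex_curve \<gamma> \<and> path_image \<gamma> = \<sigma> \<inter> P \<and>
           pathstart \<gamma> extreme_point_of P \<and> pathfinish \<gamma> extreme_point_of P \<and>
           path_image \<gamma> \<inter> frontier P = {pathstart \<gamma>, pathfinish \<gamma>}"
    using assms unfolding PIC_def by blast
  from bchoice[OF cur] obtain \<gamma> where \<gamma>: "\<And>P. P \<in> \<M> \<Longrightarrow> differentiable_convex_curve (\<gamma> P)"
    "\<And>P. P \<in> \<M> \<Longrightarrow> \<gamma> P ` {0..1} = \<sigma> \<inter> P"
    "\<And>P. P \<in> \<M> \<Longrightarrow> \<gamma> P ` {0..1} \<inter> frontier P = {\<gamma> P 0, \<gamma> P 1}"
    unfolding path_image_def pathstart_def pathfinish_def by blast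
  have finM: "finite \<M>" and pol: "\<And>P. P \<in> \<M> \<Longrightarrow> convex_polygon P"
    using M(1) unfolding polygonal_mosaic_def by blast+
  define \<B> where "\<B> = (\<lambda>P. (\<gamma> P, 0::real, 1::real)) ` \<M>"
  define V where "V = (\<Union>P\<in>\<M>. {\<gamma> P 0, \<gamma> P 1})"
  have meet: "\<gamma> P ` {0..1} \<inter> \<gamma> Q ` {0..1} \<subseteq> {\<gamma> P 0, \<gamma> P 1}" if PQ: "P \<in> \<M>" "Q \<in> \<M>" "P \<noteq> Q" for P Q
  proof -
    have "\<gamma> P ` {0..1} \<inter> \<gamma> Q ` {0..1} \<subseteq> P \<inter> Q" using \<gamma>(2)[OF PQ(1)] \<gamma>(2)[OF PQ(2)] by blast
    then have "\<gamma> P ` {0..1} \<inter> \<gamma> Q ` {0..1} \<subseteq> frontier P" using mosaic_intersection_frontier[OF M(1) PQ] by blast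
    then show ?thesis using \<gamma>(3)[OF PQ(1)] by blast
  qed
  have ends: "\<gamma> P 0 \<in> \<gamma> P ` {0..1}" "\<gamma> P 1 \<in> \<gamma> P ` {0..1}" for P by auto
  have "\<forall>P\<in>\<M>. \<exists>L. finite L \<and> (\<forall>(a, b)\<in>L. a \<noteq> 0) \<and> P = {z. \<forall>(a, b)\<in>L. a \<bullet> z \<le> b}"
    using polygon_halfspaces pol by blast
  from bchoice[OF this] obtain L where L0: "\<forall>P\<in>\<M>. finite (L P) \<and> (\<forall>(a, b)\<in>L P. a \<noteq> 0) \<and> P = {z. \<forall>(a, b)\<in>L P. a \<bullet> z \<le> b}" ..
  have L: "finite (L P)" "\<forall>(a, b)\<in>L P. a \<noteq> 0" "P = {z. \<forall>(a, b)\<in>L P. a \<bullet> z \<le> b}" if "P \<in> \<M>" for P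
  proof -
    note L' = L0[rule_format, OF that]
    show "finite (L P)" by (rule L'[THEN conjunct1])
    show "\<forall>(a, b)\<in>L P. a \<noteq> 0" by (rule L'[THEN conjunct2, THEN conjunct1])
    show "P = {z. \<forall>(a, b)\<in>L P. a \<bullet> z \<le> b}" by (rule L'[THEN conjunct2, THEN conjunct2])
  qed
  have cover: "\<sigma> = \<Union> (piece ` \<B>)"
  proof -
    have "\<Union> (piece ` \<B>) = (\<Union>P\<in>\<M>. \<gamma> P ` {0..1})" by (simp add: \<B>_def)
    also have "\<dots> = (\<Union>P\<in>\<M>. \<sigma> \<inter> P)" using \<gamma>(2) by simp
    also have "\<dots> = \<sigma>" using M(2) by blast
    finally show ?thesis ..
  qed
  have sep: "separated_by \<sigma> \<B> (\<Union>P\<in>\<M>. L P)"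
    unfolding separated_by_def
  proof (intro conjI ballI impI)
    show "finite (\<Union>P\<in>\<M>. L P)" using finM L(1) by blast
    show "case l of (a, b) \<Rightarrow> a \<noteq> 0" if "l \<in> (\<Union>P\<in>\<M>. L P)" for l using L(2) that by blast
    fix x y assume xy: "x \<in> \<sigma>" "y \<in> \<sigma>" and ss: "same_side (\<Union>P\<in>\<M>. L P) x y"
    obtain P where P: "P \<in> \<M>" "x \<in> P" using xy(1) M(2) by blast
    have "a \<bullet> y \<le> b" if ab: "(a, b) \<in> L P" for a b
    proof -
      have "x \<in> {z. \<forall>(a, b)\<in>L P. a \<bullet> z \<le> b}" using P(2) L(3)[OF P(1)] by blast
      then have "a \<bullet> x - b \<le> 0" using ab by auto
      moreover have "sgn (a \<bullet> x - b) = sgn (a \<bullet> y - b)" using ss ab P(1) unfolding same_side_def by blast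
      ultimately show ?thesis by (auto simp: sgn_if split: if_splits)
    qed
    then have "y \<in> {z. \<forall>(a, b)\<in>L P. a \<bullet> z \<le> b}" by blast
    then have "y \<in> P" using L(3)[OF P(1)] by blast
    then have "x \<in> piece (\<gamma> P, 0, 1)" "y \<in> piece (\<gamma> P, 0, 1)" using \<gamma>(2)[OF P(1)] P(2) xy by simp_all
    then show "\<exists>b\<in>\<B>. x \<in> piece b \<and> y \<in> piece b" using P(1) unfolding \<B>_def by blast
  qed
  have "net \<sigma> V \<B>"
  proof (rule netI[OF _ _ _ cover _ _ sep])
    show "finite \<B>" "finite V" using finM by (simp_all add: \<B>_def V_def)
    show "V \<subseteq> \<sigma>" using ends \<gamma>(2) unfolding V_def by blast
    show "smooth_convex_arc \<alpha> \<and> 0 \<le> p \<and> p < q \<and> q \<le> 1 \<and> \<alpha> ` {p..q} \<inter> V = {\<alpha> p, \<alpha> q}"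
      if B: "(\<alpha>, p, q) \<in> \<B>" for \<alpha> p q
    proof -
      obtain P where P: "P \<in> \<M>" "\<alpha> = \<gamma> P" "p = 0" "q = 1" using B unfolding \<B>_def by blast
      have "\<gamma> P ` {0..1} \<inter> {\<gamma> Q 0, \<gamma> Q 1} \<subseteq> {\<gamma> P 0, \<gamma> P 1}" if Q: "Q \<in> \<M>" for Q
      proof (cases "P = Q")
        case False
        have "{\<gamma> Q 0, \<gamma> Q 1} \<subseteq> \<gamma> Q ` {0..1}" using ends[of Q] by simp
        then have "\<gamma> P ` {0..1} \<inter> {\<gamma> Q 0, \<gamma> Q 1} \<subseteq> \<gamma> P ` {0..1} \<inter> \<gamma> Q ` {0..1}" by (rule Int_mono[OF subset_refl])
        also have "\<dots> \<subseteq> {\<gamma> P 0, \<gamma> P 1}" by (rule meet[OF P(1) Q False])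
        finally show ?thesis .
      next
        case True
        then show ?thesis by (simp only:) (rule Int_lower2)
      qed
      then have "\<gamma> P ` {0..1} \<inter> V \<subseteq> {\<gamma> P 0, \<gamma> P 1}" unfolding V_def Int_UN_distrib by (rule UN_least)
      moreover have "{\<gamma> P 0, \<gamma> P 1} \<subseteq> V" unfolding V_def by (rule UN_upper[OF P(1)])
      then have "{\<gamma> P 0, \<gamma> P 1} \<subseteq> \<gamma> P ` {0..1} \<inter> V" using ends[of P] by simp
      ultimately have "\<gamma> P ` {0..1} \<inter> V = {\<gamma> P 0, \<gamma> P 1}" by (rule subset_antisym)
      then show ?thesis using smooth_convex_arc_if_differentiable[OF \<gamma>(1)[OF P(1)]] unfolding P(2-4) by simp
    qed
    show "piece b \<inter> piece b' \<subseteq> V" if bb: "b \<in> \<B>" "b' \<in> \<B>" "b \<noteq> b'" for b b'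
    proof -
      obtain P Q where PQ: "P \<in> \<M>" "Q \<in> \<M>" "b = (\<gamma> P, 0, 1)" "b' = (\<gamma> Q, 0, 1)" using bb unfolding \<B>_def by blast
      then have "P \<noteq> Q" using bb(3) by blast
      from meet[OF PQ(1,2) this] have "piece b \<inter> piece b' \<subseteq> {\<gamma> P 0, \<gamma> P 1}" unfolding PQ(3,4) by simp
      also have "\<dots> \<subseteq> V" unfolding V_def by (rule UN_upper[OF PQ(1)])
      finally show ?thesis .
    qed
  qed
  then show ?thesis by blast
qed

lemma PIC_union_net:
  assumes "finite \<C>" "\<C> \<subseteq> PIC" "disjoint \<C>" shows "\<exists>V \<B>. net (\<Union>\<C>) V \<B>"
  using assms
proof (induction \<C>)
  case empty
  then show ?case using net_empty by auto
next
  case (insert \<sigma> \<C>)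
  have "disjoint \<C>" using insert.prems(2) by (auto simp: pairwise_def)
  then obtain V \<B> where N: "net (\<Union>\<C>) V \<B>" using insert by auto
  obtain W \<B>' where N': "net \<sigma> W \<B>'" using PIC_net insert.prems(1) by blast
  have "\<sigma> \<inter> \<Union>\<C> = {}" using insert.prems(2) insert.hyps(2) by (fastforce simp: pairwise_def disjnt_def)
  from net_Un[OF N' N this] show ?case by auto
qed

text \<open>The chart may be oriented either way.\<close>

definition chartable :: "(real \<Rightarrow> complex) \<Rightarrow> real \<Rightarrow> real \<Rightarrow> bool" where
  "chartable \<gamma> p q \<longleftrightarrow> (\<forall>v v'. {v, v'} = {\<gamma> p, \<gamma> q} \<longrightarrow>
     (\<exists>a c r. chart a c r \<and> r ` {0..1} = \<gamma> ` {p..q} \<and> r 0 = v \<and> r 1 = v'))"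

lemma convex_set_curve_subset:
  assumes C: "convex_set_curve C" and sub: "D \<subseteq> C" shows "convex_set_curve D"
  unfolding convex_set_curve_def
proof
  fix z assume "z \<in> D"
  then have "z \<in> C" using sub by blast
  from C[unfolded convex_set_curve_def, rule_format, OF this]
  obtain a b where ab: "a \<noteq> 0" "a \<bullet> z = b" "C \<subseteq> {z. a \<bullet> z \<le> b} \<or> C \<subseteq> {z. b \<le> a \<bullet> z}" by (elim exE conjE)
  from ab(3) have "D \<subseteq> {z. a \<bullet> z \<le> b} \<or> D \<subseteq> {z. b \<le> a \<bullet> z}"
    using subset_trans[OF sub] by (elim disjE) simp_all
  with ab(1,2) show "\<exists>a b. a \<noteq> 0 \<and> a \<bullet> z = b \<and> (D \<subseteq> {z. a \<bullet> z \<le> b} \<or> D \<subseteq> {z. b \<le> a \<bullet> z})"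
    by (intro exI conjI)
qed

lemma chartable_if_uncut:
  assumes arc: "smooth_convex_arc \<gamma>" and F: "\<And>p' q'. 0 \<le> p' \<and> p' < q' \<and> q' \<le> 1 \<and> {p'<..<q'} \<inter> F = {} \<Longrightarrow>
     (\<exists>p q a. 0 \<le> p \<and> p \<le> p' \<and> q' \<le> q \<and> q \<le> 1 \<and> (p < p' \<or> q' < q) \<and> inj_on (\<lambda>t. a \<bullet> \<gamma> t) {p..q})"
    and pq: "0 \<le> p" "p < q" "q \<le> 1" and uncut: "{p<..<q} \<inter> F = {}"
  shows "chartable \<gamma> p q"
proof -
  obtain p0 q0 a where pq0: "0 \<le> p0" "p0 \<le> p" "q \<le> q0" "q0 \<le> 1" "p0 < p \<or> q < q0" and inj: "inj_on (\<lambda>t. a \<bullet> \<gamma> t) {p0..q0}"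
    using F[of p q] pq uncut by blast
  have "continuous_on {p0..q0} \<gamma>" by (rule smooth_convex_arcD[OF arc pq0(1,4)])
  moreover have "convex_set_curve (\<gamma> ` {p0..q0})"
  proof -
    have conv: "convex_set_curve (\<gamma> ` {0..1})" using arc unfolding smooth_convex_arc_def by blast
    have sub: "\<gamma> ` {p0..q0} \<subseteq> \<gamma> ` {0..1}" using pq0 by auto
    show ?thesis by (rule convex_set_curve_subset[OF conv sub])
  qed
  ultimately show ?thesis
    unfolding chartable_def using chart_of_arc[OF _ _ inj pq0(2) pq(2) pq0(3,5)] by blast
qed

text \<open>\<open>V\<close> contains the cut points of all arcs. Finer nets are included, because in the end the cut points of
  two sets have to be merged.\<close>

lemma UPIC_chartable_nets:
  assumes "\<sigma> \<in> UPIC"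
  shows "\<exists>V. finite V \<and> V \<subseteq> \<sigma> \<and> (\<forall>W. finite W \<and> V \<subseteq> W \<and> W \<subseteq> \<sigma> \<longrightarrow>
    (\<exists>\<B>. net \<sigma> W \<B> \<and> (\<forall>\<gamma> p q. (\<gamma>, p, q) \<in> \<B> \<longrightarrow> chartable \<gamma> p q)))"
proof -
  obtain V0 \<B>0 where N0: "net \<sigma> V0 \<B>0" using PIC_union_net assms unfolding UPIC_def by blast
  have arcs: "smooth_convex_arc \<gamma>" if g: "\<gamma> \<in> fst ` \<B>0" for \<gamma>
  proof -
    obtain p q where "(\<gamma>, p, q) \<in> \<B>0" using g by force
    then show ?thesis by (rule netD(5)[OF N0])
  qed
  have "\<forall>\<gamma>\<in>fst ` \<B>0. \<exists>F. finite F \<and> (\<forall>p' q'. 0 \<le> p' \<and> p' < q' \<and> q' \<le> 1 \<and> {p'<..<q'} \<inter> F = {} \<longrightarrow>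
     (\<exists>p q a. 0 \<le> p \<and> p \<le> p' \<and> q' \<le> q \<and> q \<le> 1 \<and> (p < p' \<or> q' < q) \<and> inj_on (\<lambda>t. a \<bullet> \<gamma> t) {p..q}))"
  proof
    fix \<gamma> assume "\<gamma> \<in> fst ` \<B>0"
    from arcs[OF this] have "cuttable \<gamma> 0 1" unfolding smooth_convex_arc_def by (intro convex_arc_cuttable) blast+
    then show "\<exists>F. finite F \<and> (\<forall>p' q'. 0 \<le> p' \<and> p' < q' \<and> q' \<le> 1 \<and> {p'<..<q'} \<inter> F = {} \<longrightarrow>
     (\<exists>p q a. 0 \<le> p \<and> p \<le> p' \<and> q' \<le> q \<and> q \<le> 1 \<and> (p < p' \<or> q' < q) \<and> inj_on (\<lambda>t. a \<bullet> \<gamma> t) {p..q}))"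
      unfolding cuttable_def .
  qed
  from bchoice[OF this] obtain F where F0: "\<forall>\<gamma>\<in>fst ` \<B>0. finite (F \<gamma>) \<and> (\<forall>p' q'. 0 \<le> p' \<and> p' < q' \<and> q' \<le> 1 \<and> {p'<..<q'} \<inter> F \<gamma> = {} \<longrightarrow>
     (\<exists>p q a. 0 \<le> p \<and> p \<le> p' \<and> q' \<le> q \<and> q \<le> 1 \<and> (p < p' \<or> q' < q) \<and> inj_on (\<lambda>t. a \<bullet> \<gamma> t) {p..q}))" ..
  note F = bspec[OF F0, THEN conjunct1] and F' = bspec[OF F0, THEN conjunct2, rule_format]
  define V where "V = V0 \<union> ((\<Union>\<gamma>\<in>fst ` \<B>0. \<gamma> ` F \<gamma>) \<inter> \<sigma>)"
  have "finite (\<Union>\<gamma>\<in>fst ` \<B>0. \<gamma> ` F \<gamma>)"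
    by (intro finite_UN_I finite_imageI netD(1)[OF N0] F)
  then have fin: "finite V" unfolding V_def using netD(2)[OF N0] by simp
  have sub\<sigma>: "V \<subseteq> \<sigma>" unfolding V_def using netD(3)[OF N0] by blast
  have key: "\<exists>\<B>. net \<sigma> W \<B> \<and> (\<forall>\<gamma> p q. (\<gamma>, p, q) \<in> \<B> \<longrightarrow> chartable \<gamma> p q)"
    if W: "finite W" "V \<subseteq> W" "W \<subseteq> \<sigma>" for W
  proof -
    obtain \<B> where B: "net \<sigma> (W \<union> V0) \<B>" "fst ` \<B> \<subseteq> fst ` \<B>0" using net_refine[OF W(1) N0 W(3)] by blast
    have "W \<union> V0 = W" using W(2) unfolding V_def by blast
    then have N: "net \<sigma> W \<B>" using B(1) by simp
    have "chartable \<gamma> p q" if b: "(\<gamma>, p, q) \<in> \<B>" for \<gamma> p q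
    proof -
      have \<gamma>: "\<gamma> \<in> fst ` \<B>0" using b B(2) by force
      note pq = netD(6-8)[OF N b]
      have inj: "inj_on \<gamma> {p..q}" by (rule smooth_convex_arcD[OF netD(5)[OF N b] pq(1,3)])
      have sub: "\<gamma> ` {p..q} \<subseteq> \<sigma>" using piece_subset_net[OF N b] by simp
      have "t \<notin> F \<gamma>" if t: "t \<in> {p<..<q}" for t
      proof
        assume "t \<in> F \<gamma>"
        then have cut: "\<gamma> t \<in> (\<Union>\<gamma>\<in>fst ` \<B>0. \<gamma> ` F \<gamma>)" by (intro UN_I[OF \<gamma>] imageI)
        have im: "\<gamma> t \<in> \<gamma> ` {p..q}" using t by auto
        have "\<gamma> t \<in> V" unfolding V_def by (rule UnI2[OF IntI[OF cut subsetD[OF sub im]]])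
        then have "\<gamma> t \<in> \<gamma> ` {p..q} \<inter> W" by (rule IntI[OF im subsetD[OF W(2)]])
        then have "\<gamma> t \<in> {\<gamma> p, \<gamma> q}" unfolding netD(9)[OF N b] .
        then show False using inj_onD[OF inj, of t p] inj_onD[OF inj, of t q] t by auto
      qed
      then have "{p<..<q} \<inter> F \<gamma> = {}" by blast
      from chartable_if_uncut[OF arcs[OF \<gamma>] F'[OF \<gamma>] pq this] show ?thesis .
    qed
    with N show ?thesis by (intro exI[of _ \<B>] conjI allI impI)
  qed
  show ?thesis
  proof (intro exI[of _ V] conjI allI impI fin sub\<sigma>)
    fix W assume W: "finite W \<and> V \<subseteq> W \<and> W \<subseteq> \<sigma>"
    show "\<exists>\<B>. net \<sigma> W \<B> \<and> (\<forall>\<gamma> p q. (\<gamma>, p, q) \<in> \<B> \<longrightarrow> chartable \<gamma> p q)"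
      by (rule key) (use W in simp_all)
  qed
qed

section \<open>Matching the pieces of homeomorphic sets\<close>

lemma net_inner_point_not_node:
  assumes N: "net \<sigma> V \<B>" and b: "(\<gamma>, p, q) \<in> \<B>" and t: "t \<in> {p<..<q}"
  shows "\<gamma> t \<notin> V"
proof
  assume "\<gamma> t \<in> V"
  note pq = netD(6-8)[OF N b]
  have inj: "inj_on \<gamma> {p..q}" by (rule smooth_convex_arcD[OF netD(5)[OF N b] pq(1,3)])
  have "\<gamma> t \<in> \<gamma> ` {p..q}" using t by auto
  then have "\<gamma> t \<in> {\<gamma> p, \<gamma> q}" using netD(9)[OF N b] \<open>\<gamma> t \<in> V\<close> by blast
  then show False using inj_onD[OF inj, of t p] inj_onD[OF inj, of t q] t by auto
qed

text \<open>The image of a piece without its ends is connected and avoids \<open>W\<close>, so it cannot leave the piece that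
  contains the image of the midpoint.\<close>

lemma piece_maps_into_piece:
  assumes N: "net \<sigma> V \<B>" and N': "net \<tau> W \<B>'" and H: "continuous_on \<sigma> H" "H ` \<sigma> \<subseteq> \<tau>"
    and HW: "\<And>z. z \<in> \<sigma> \<Longrightarrow> H z \<in> W \<Longrightarrow> z \<in> V" and b: "b \<in> \<B>"
  shows "\<exists>b'\<in>\<B>'. H ` piece b \<subseteq> piece b'"
proof -
  obtain \<gamma> p q where bb: "b = (\<gamma>, p, q)" by (cases b)
  have b': "(\<gamma>, p, q) \<in> \<B>" using b bb by simp
  note pq = netD(6-8)[OF N b']
  have cont: "continuous_on {p..q} \<gamma>" by (rule smooth_convex_arcD[OF netD(5)[OF N b'] pq(1,3)])
  have sub: "\<gamma> ` {p..q} \<subseteq> \<sigma>" using piece_subset_net[OF N b] by (simp add: bb)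
  have Hc: "continuous_on {p..q} (\<lambda>t. H (\<gamma> t))"
    by (rule continuous_on_compose2[OF H(1) cont sub])
  define D where "D = (\<lambda>t. H (\<gamma> t)) ` {p<..<q}"
  have conn: "connected D"
    unfolding D_def by (intro connected_continuous_image continuous_on_subset[OF Hc]) auto
  have D\<tau>: "D \<subseteq> \<tau>" unfolding D_def using H(2) sub by force
  have DW: "D \<inter> W = {}"
  proof -
    have "H (\<gamma> t) \<notin> W" if t: "t \<in> {p<..<q}" for t
    proof
      assume "H (\<gamma> t) \<in> W"
      moreover have "\<gamma> t \<in> \<sigma>" using sub t by force
      ultimately have "\<gamma> t \<in> V" by (intro HW)
      with net_inner_point_not_node[OF N b' t] show False ..
    qed
    then show ?thesis unfolding D_def by blast
  qed
  have m: "H (\<gamma> ((p + q) / 2)) \<in> D" unfolding D_def using pq by (intro imageI) auto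
  then have "H (\<gamma> ((p + q) / 2)) \<in> \<Union> (piece ` \<B>')" using D\<tau> netD(4)[OF N'] by blast
  then obtain d where d: "d \<in> \<B>'" "H (\<gamma> ((p + q) / 2)) \<in> piece d" by blast
  define T R where "T = piece d" and "R = \<Union> (piece ` (\<B>' - {d}))"
  have closed_piece: "closed (piece c)" if "c \<in> \<B>'" for c
    using net_piece_compact(1)[OF N' that] by (rule compact_imp_closed)
  have cT: "closed T" unfolding T_def by (rule closed_piece[OF d(1)])
  have cR: "closed R"
    unfolding R_def using netD(1)[OF N'] by (intro closed_Union) (auto intro: closed_piece)
  have cov: "D \<subseteq> T \<union> R"
  proof -
    have "\<tau> \<subseteq> T \<union> R" unfolding netD(4)[OF N'] T_def R_def by blast
    with D\<tau> show ?thesis by (rule subset_trans)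
  qed
  have "T \<inter> R \<subseteq> W"
  proof
    fix z assume z: "z \<in> T \<inter> R"
    then obtain c where c: "c \<in> \<B>'" "c \<noteq> d" "z \<in> piece c" unfolding R_def by blast
    have "z \<in> piece d \<inter> piece c" using z c(3) unfolding T_def by blast
    then show "z \<in> W" using netD(10)[OF N' d(1) c(1)] c(2) by blast
  qed
  then have "T \<inter> R \<inter> D = {}" using DW by blast
  moreover have "T \<inter> D \<noteq> {}" using m d(2) unfolding T_def by blast
  ultimately have "R \<inter> D = {}" using conn cT cR cov unfolding connected_closed by blast
  then have "D \<subseteq> T" using cov by blast
  then have "(\<lambda>t. H (\<gamma> t)) ` closure {p<..<q} \<subseteq> T"
    using Hc cT pq unfolding D_def by (intro image_closure_subset) (simp_all add: closure_greaterThanLessThan)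
  then have "H ` piece b \<subseteq> piece d"
    using pq by (simp add: closure_greaterThanLessThan bb T_def image_image)
  with d(1) show ?thesis by blast
qed

lemma homeomorphism_maps_pieces:
  assumes N: "net \<sigma> V \<B>" and N': "net \<tau> W \<B>'" and H: "homeomorphism \<sigma> \<tau> H K" and W: "W = H ` V" and b: "b \<in> \<B>"
  shows "\<exists>b'\<in>\<B>'. H ` piece b = piece b'"
proof -
  have HK: "continuous_on \<sigma> H" "H ` \<sigma> = \<tau>" "continuous_on \<tau> K" "K ` \<tau> = \<sigma>"
    "\<And>z. z \<in> \<sigma> \<Longrightarrow> K (H z) = z" "\<And>w. w \<in> \<tau> \<Longrightarrow> H (K w) = w"
    using H unfolding homeomorphism_def by blast+
  have HW: "z \<in> V" if z: "z \<in> \<sigma>" "H z \<in> W" for z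
  proof -
    obtain v where v: "v \<in> V" "H z = H v" using z(2) unfolding W by blast
    then have "v \<in> \<sigma>" using netD(3)[OF N] by blast
    have "z = K (H z)" by (rule HK(5)[OF z(1), symmetric])
    also have "\<dots> = v" unfolding v(2) by (rule HK(5)[OF \<open>v \<in> \<sigma>\<close>])
    finally show ?thesis using v(1) by simp
  qed
  have KV: "w \<in> W" if w: "w \<in> \<tau>" "K w \<in> V" for w
  proof -
    have "H (K w) \<in> W" unfolding W using w(2) by (rule imageI)
    then show ?thesis using HK(6)[OF w(1)] by simp
  qed
  obtain b' where b': "b' \<in> \<B>'" "H ` piece b \<subseteq> piece b'"
    using piece_maps_into_piece[OF N N' HK(1) _ HW b] HK(2) by blast
  obtain b2 where b2: "b2 \<in> \<B>" "K ` piece b' \<subseteq> piece b2"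
    using piece_maps_into_piece[OF N' N HK(3) _ KV b'(1)] HK(4) by blast
  have sub: "piece b \<subseteq> piece b2"
  proof
    fix z assume z: "z \<in> piece b"
    then have "H z \<in> piece b'" using b'(2) by blast
    then have "K (H z) \<in> piece b2" using b2(2) by blast
    moreover have "z \<in> \<sigma>" using piece_subset_net[OF N b] z by blast
    ultimately show "z \<in> piece b2" using HK(5) by simp
  qed
  have "b = b2"
  proof (rule ccontr)
    assume "b \<noteq> b2"
    obtain \<gamma> p q where bb: "b = (\<gamma>, p, q)" by (cases b)
    have B: "(\<gamma>, p, q) \<in> \<B>" using b bb by simp
    have mid: "(p + q) / 2 \<in> {p<..<q}" using netD(7)[OF N B] by simp
    then have "\<gamma> ((p + q) / 2) \<in> piece b" unfolding bb by force
    then have "\<gamma> ((p + q) / 2) \<in> V" using sub netD(10)[OF N b b2(1) \<open>b \<noteq> b2\<close>] by blast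
    with net_inner_point_not_node[OF N B mid] show False ..
  qed
  have "piece b' \<subseteq> H ` piece b"
  proof
    fix w assume w: "w \<in> piece b'"
    then have "K w \<in> piece b" using b2(2) \<open>b = b2\<close> by blast
    then have "H (K w) \<in> H ` piece b" by (rule imageI)
    moreover have "w \<in> \<tau>" using piece_subset_net[OF N' b'(1)] w by blast
    ultimately show "w \<in> H ` piece b" using HK(6) by simp
  qed
  with b' show ?thesis by blast
qed

lemma charted_set_of_family:
  assumes "compact_plane_set \<sigma>" "finite I" and ch: "\<And>i. i \<in> I \<Longrightarrow> chart (a i) (c i) (r i)"
    and cov: "\<sigma> = (\<Union>i\<in>I. r i ` {0..1})"
    and meet: "\<And>i j. i \<in> I \<Longrightarrow> j \<in> I \<Longrightarrow> i \<noteq> j \<Longrightarrow> r i ` {0..1} \<inter> r j ` {0..1} \<subseteq> V"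
    and inner: "\<And>i t. i \<in> I \<Longrightarrow> t \<in> {0<..<1} \<Longrightarrow> r i t \<notin> V"
    and L: "finite \<L>" "\<forall>(a, b)\<in>\<L>. a \<noteq> 0"
      "\<And>x y. x \<in> \<sigma> \<Longrightarrow> y \<in> \<sigma> \<Longrightarrow> same_side \<L> x y \<Longrightarrow> \<exists>i\<in>I. x \<in> r i ` {0..1} \<and> y \<in> r i ` {0..1}"
  shows "charted_set \<sigma> ((\<lambda>i. (a i, c i, r i)) ` I) \<L>"
proof -
  interpret compact_plane_set \<sigma> by fact
  show ?thesis
  proof
    show "finite ((\<lambda>i. (a i, c i, r i)) ` I)" "finite \<L>" using assms(2) L(1) by simp_all
    show "chart x y z" if "(x, y, z) \<in> (\<lambda>i. (a i, c i, r i)) ` I" for x y z using that ch by auto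
    show "\<sigma> = (\<Union>(a, c, r)\<in>(\<lambda>i. (a i, c i, r i)) ` I. r ` {0..1})" unfolding cov by simp
    show "x \<noteq> 0" if "(x, y) \<in> \<L>" for x y using L(2) that by blast
    show "\<exists>(a, c, r)\<in>(\<lambda>i. (a i, c i, r i)) ` I. x \<in> r ` {0..1} \<and> y \<in> r ` {0..1}"
      if "x \<in> \<sigma>" "y \<in> \<sigma>" "same_side \<L> x y" for x y
      using L(3)[OF that] by simp
    fix a1 c1 r1 a2 c2 r2 and t :: real
    assume h: "(a1, c1, r1) \<in> (\<lambda>i. (a i, c i, r i)) ` I" "(a2, c2, r2) \<in> (\<lambda>i. (a i, c i, r i)) ` I"
      "t \<in> {0<..<1}" "r1 t \<in> r2 ` {0..1}"
    then obtain i j where ij: "i \<in> I" "j \<in> I" "a1 = a i" "c1 = c i" "r1 = r i" "a2 = a j" "c2 = c j" "r2 = r j" by blast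
    have "i = j"
    proof (rule ccontr)
      assume "i \<noteq> j"
      have "r i t \<in> r i ` {0..1}" using h(3) by auto
      then have "r i t \<in> V" using meet[OF ij(1,2) \<open>i \<noteq> j\<close>] h(4) ij(5,8) by blast
      with inner[OF ij(1) h(3)] show False ..
    qed
    then show "(a1, c1, r1) = (a2, c2, r2)" using ij by simp
  qed
qed

text \<open>A point with two parameters lies in \<open>W\<close>, so it is an end of both pieces, where \<open>K\<close> prescribes the value.\<close>

lemma ex_piecewise_map:
  assumes inj: "\<And>i. i \<in> I \<Longrightarrow> inj_on (r' i) {0..1::real}"
    and meet: "\<And>i j. i \<in> I \<Longrightarrow> j \<in> I \<Longrightarrow> i \<noteq> j \<Longrightarrow> r' i ` {0..1} \<inter> r' j ` {0..1} \<subseteq> W"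
    and inner: "\<And>i t. i \<in> I \<Longrightarrow> t \<in> {0<..<1} \<Longrightarrow> r' i t \<notin> W"
    and ends: "\<And>i. i \<in> I \<Longrightarrow> K (r' i 0) = r i 0" "\<And>i. i \<in> I \<Longrightarrow> K (r' i 1) = r i 1"
  shows "\<exists>k. \<forall>i\<in>I. \<forall>t\<in>{0..1}. k (r' i t) = r i t"
proof -
  have wd: "r i s = r j t" if ij: "i \<in> I" "j \<in> I" "s \<in> {0..1}" "t \<in> {0..1}" "r' i s = r' j t" for i j s t
  proof (cases "i = j")
    case True
    then show ?thesis using inj_onD[OF inj[OF ij(1)], of s t] ij by simp
  next
    case False
    have "r' i s \<in> r' i ` {0..1} \<inter> r' j ` {0..1}" using ij(3,4) unfolding ij(5) by (metis IntI ij(5) imageI)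
    then have W: "r' i s \<in> W" using meet[OF ij(1,2) False] by blast
    have "s = 0 \<or> s = 1"
    proof (rule ccontr)
      assume "\<not> (s = 0 \<or> s = 1)"
      then have "s \<in> {0<..<1}" using ij(3) by auto
      with inner[OF ij(1)] W show False by blast
    qed
    moreover have "t = 0 \<or> t = 1"
    proof (rule ccontr)
      assume "\<not> (t = 0 \<or> t = 1)"
      then have "t \<in> {0<..<1}" using ij(4) by auto
      with inner[OF ij(2)] W ij(5) show False by simp
    qed
    ultimately show ?thesis using ends[OF ij(1)] ends[OF ij(2)] ij(5) by metis
  qed
  define k where "k w = (SOME z. \<exists>i\<in>I. \<exists>t\<in>{0..1}. w = r' i t \<and> z = r i t)" for w
  have "k (r' i t) = r i t" if it: "i \<in> I" "t \<in> {0..1}" for i t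
    unfolding k_def
  proof (rule some_equality)
    show "\<exists>j\<in>I. \<exists>s\<in>{0..1}. r' i t = r' j s \<and> r i t = r j s" using it by blast
    fix z assume "\<exists>j\<in>I. \<exists>s\<in>{0..1}. r' i t = r' j s \<and> z = r j s"
    then obtain j s where "j \<in> I" "s \<in> {0..1}" "r' i t = r' j s" "z = r j s" by blast
    then show "z = r i t" using wd[OF it(1) _ it(2), of j s] by simp
  qed
  then show ?thesis by blast
qed

lemma UPIC_compact_plane_set:
  assumes "\<sigma> \<in> UPIC" shows "compact_plane_set \<sigma>"
proof
  obtain \<C> where C: "\<sigma> = \<Union>\<C>" "finite \<C>" "\<C> \<noteq> {}" "\<C> \<subseteq> PIC" using assms unfolding UPIC_def by blast
  have P: "compact c" "c \<noteq> {}" if "c \<in> \<C>" for c using that C(4) unfolding PIC_def by blast+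
  show "compact \<sigma>" unfolding C(1) by (rule compact_Union[OF C(2) P(1)])
  show "\<sigma> \<noteq> {}" using C(1,3) P(2) by blast
qed

text \<open>The homeomorphism is used only for the combinatorics: it says which piece corresponds to which and in
  which direction. Between corresponding pieces it is replaced by equality of chart parameters.\<close>

theorem UPIC_AC_isomorphic_if_homeomorphic:
  assumes S: "\<sigma> \<in> UPIC" and T: "\<tau> \<in> UPIC" and hom: "\<sigma> homeomorphic \<tau>"
  shows "AC_isomorphic \<sigma> \<tau>"
proof -
  obtain H K where H: "homeomorphism \<sigma> \<tau> H K" using hom unfolding homeomorphic_def by blast
  then have HK: "H ` \<sigma> = \<tau>" "K ` \<tau> = \<sigma>"
    "\<And>z. z \<in> \<sigma> \<Longrightarrow> K (H z) = z" "\<And>w. w \<in> \<tau> \<Longrightarrow> H (K w) = w"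
    unfolding homeomorphism_def by blast+
  obtain V1 where V1': "finite V1 \<and> V1 \<subseteq> \<sigma> \<and> (\<forall>W. finite W \<and> V1 \<subseteq> W \<and> W \<subseteq> \<sigma> \<longrightarrow>
      (\<exists>\<B>. net \<sigma> W \<B> \<and> (\<forall>\<gamma> p q. (\<gamma>, p, q) \<in> \<B> \<longrightarrow> chartable \<gamma> p q)))"
    using UPIC_chartable_nets[OF S] ..
  note V1 = V1'[THEN conjunct1] V1'[THEN conjunct2, THEN conjunct1]
    and net1 = V1'[THEN conjunct2, THEN conjunct2, rule_format]
  obtain V2 where V2': "finite V2 \<and> V2 \<subseteq> \<tau> \<and> (\<forall>W. finite W \<and> V2 \<subseteq> W \<and> W \<subseteq> \<tau> \<longrightarrow>
      (\<exists>\<B>. net \<tau> W \<B> \<and> (\<forall>\<gamma> p q. (\<gamma>, p, q) \<in> \<B> \<longrightarrow> chartable \<gamma> p q)))"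
    using UPIC_chartable_nets[OF T] ..
  note V2 = V2'[THEN conjunct1] V2'[THEN conjunct2, THEN conjunct1]
    and net2 = V2'[THEN conjunct2, THEN conjunct2, rule_format]
  \<comment> \<open>Cutting each set also at the images of the other's cut points makes the pieces correspond.\<close>
  define V where "V = V1 \<union> K ` V2"
  define W where "W = H ` V"
  have V: "finite V" "V1 \<subseteq> V" "V \<subseteq> \<sigma>" using V1 V2 HK(2) unfolding V_def by blast+
  have W: "finite W" "V2 \<subseteq> W" "W \<subseteq> \<tau>"
  proof -
    show "finite W" "W \<subseteq> \<tau>" using V(1,3) HK(1) unfolding W_def by blast+
    show "V2 \<subseteq> W"
    proof
      fix w assume "w \<in> V2"
      then have "K w \<in> V" "H (K w) = w" using V2(2) HK(4) unfolding V_def by blast+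
      then show "w \<in> W" unfolding W_def by (metis imageI)
    qed
  qed
  obtain \<B> where B: "net \<sigma> V \<B> \<and> (\<forall>\<gamma> p q. (\<gamma>, p, q) \<in> \<B> \<longrightarrow> chartable \<gamma> p q)"
    using net1[OF conjI[OF V(1) conjI[OF V(2,3)]]] ..
  note N = B[THEN conjunct1] and ch = B[THEN conjunct2, rule_format]
  obtain \<B>' where B': "net \<tau> W \<B>' \<and> (\<forall>\<gamma> p q. (\<gamma>, p, q) \<in> \<B>' \<longrightarrow> chartable \<gamma> p q)"
    using net2[OF conjI[OF W(1) conjI[OF W(2,3)]]] ..
  note N' = B'[THEN conjunct1] and ch' = B'[THEN conjunct2, rule_format]
  have Hinj: "inj_on H \<sigma>" using HK(3) by (rule inj_on_inverseI)
  have Hint: "H ` A \<inter> H ` B = H ` (A \<inter> B)" if "A \<subseteq> \<sigma>" "B \<subseteq> \<sigma>" for A B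
    using inj_on_image_Int[OF Hinj that] by simp
  have matched: "\<exists>a c r a' c' r'. chart a c r \<and> chart a' c' r' \<and> r ` {0..1} = piece b \<and> r' ` {0..1} = H ` piece b \<and>
      piece b \<inter> V = {r 0, r 1} \<and> r' 0 = H (r 0) \<and> r' 1 = H (r 1)" if b: "b \<in> \<B>" for b
  proof -
    obtain \<gamma> p q where bb: "b = (\<gamma>, p, q)" by (cases b)
    have B: "(\<gamma>, p, q) \<in> \<B>" using b bb by simp
    have ends: "piece b \<inter> V = {\<gamma> p, \<gamma> q}" using netD(9)[OF N B] by (simp add: bb)
    obtain b' where b': "b' \<in> \<B>'" "H ` piece b = piece b'"
      using homeomorphism_maps_pieces[OF N N' H W_def b] by blast
    obtain \<gamma>' p' q' where bb': "b' = (\<gamma>', p', q')" by (cases b')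
    have B': "(\<gamma>', p', q') \<in> \<B>'" using b' bb' by simp
    have "{H (\<gamma> p), H (\<gamma> q)} = H ` (piece b \<inter> V)" unfolding ends by simp
    also have "\<dots> = H ` piece b \<inter> W" unfolding W_def by (rule Hint[OF piece_subset_net[OF N b] V(3), symmetric])
    also have "\<dots> = {\<gamma>' p', \<gamma>' q'}" unfolding b'(2) using netD(9)[OF N' B'] by (simp add: bb')
    finally have ends': "{H (\<gamma> p), H (\<gamma> q)} = {\<gamma>' p', \<gamma>' q'}" .
    obtain a c r where 1: "chart a c r" "r ` {0..1} = \<gamma> ` {p..q}" "r 0 = \<gamma> p" "r 1 = \<gamma> q"
      using ch[OF B, unfolded chartable_def, rule_format, OF refl] by blast
    obtain a' c' r' where 2: "chart a' c' r'" "r' ` {0..1} = \<gamma>' ` {p'..q'}" "r' 0 = H (\<gamma> p)" "r' 1 = H (\<gamma> q)"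
      using ch'[OF B', unfolded chartable_def, rule_format, OF ends'] by blast
    show ?thesis
      by (rule exI[of _ a], rule exI[of _ c], rule exI[of _ r], rule exI[of _ a'], rule exI[of _ c'], rule exI[of _ r'])
         (use 1 2 ends b'(2) in \<open>simp add: bb bb'\<close>)
  qed
  then have "\<forall>b\<in>\<B>. \<exists>a c r a' c' r'. chart a c r \<and> chart a' c' r' \<and> r ` {0..1} = piece b \<and> r' ` {0..1} = H ` piece b \<and>
      piece b \<inter> V = {r 0, r 1} \<and> r' 0 = H (r 0) \<and> r' 1 = H (r 1)" by (rule ballI)
  then obtain a c r a' c' r' where M: "\<forall>b\<in>\<B>. chart (a b) (c b) (r b) \<and> chart (a' b) (c' b) (r' b) \<and>
      r b ` {0..1} = piece b \<and> r' b ` {0..1} = H ` piece b \<and>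
      piece b \<inter> V = {r b 0, r b 1} \<and> r' b 0 = H (r b 0) \<and> r' b 1 = H (r b 1)"
    unfolding bchoice_iff by (elim exE) (rule that)
  have cr: "chart (a b) (c b) (r b)" and cr': "chart (a' b) (c' b) (r' b)"
    and im: "r b ` {0..1} = piece b" and im': "r' b ` {0..1} = H ` piece b"
    and ends: "piece b \<inter> V = {r b 0, r b 1}" and e0: "r' b 0 = H (r b 0)" and e1: "r' b 1 = H (r b 1)"
    if b: "b \<in> \<B>" for b
  proof -
    note Mb = M[rule_format, OF b]
    show "chart (a b) (c b) (r b)" by (rule Mb[THEN conjunct1])
    show "chart (a' b) (c' b) (r' b)" by (rule Mb[THEN conjunct2, THEN conjunct1])
    note Mb = Mb[THEN conjunct2, THEN conjunct2]
    show "r b ` {0..1} = piece b" by (rule Mb[THEN conjunct1])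
    show "r' b ` {0..1} = H ` piece b" by (rule Mb[THEN conjunct2, THEN conjunct1])
    note Mb = Mb[THEN conjunct2, THEN conjunct2]
    show "piece b \<inter> V = {r b 0, r b 1}" by (rule Mb[THEN conjunct1])
    show "r' b 0 = H (r b 0)" by (rule Mb[THEN conjunct2, THEN conjunct1])
    show "r' b 1 = H (r b 1)" by (rule Mb[THEN conjunct2, THEN conjunct2])
  qed
  have sub: "piece b \<subseteq> \<sigma>" if "b \<in> \<B>" for b by (rule piece_subset_net[OF N that])
  have meet: "r b ` {0..1} \<inter> r d ` {0..1} \<subseteq> V" if "b \<in> \<B>" "d \<in> \<B>" "b \<noteq> d" for b d
    unfolding im[OF that(1)] im[OF that(2)] by (rule netD(10)[OF N that])
  have meet': "r' b ` {0..1} \<inter> r' d ` {0..1} \<subseteq> W" if "b \<in> \<B>" "d \<in> \<B>" "b \<noteq> d" for b d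
    unfolding im'[OF that(1)] im'[OF that(2)] Hint[OF sub[OF that(1)] sub[OF that(2)]] W_def
    by (rule image_mono[OF netD(10)[OF N that]])
  have ends': "H ` piece b \<inter> W = {r' b 0, r' b 1}" if b: "b \<in> \<B>" for b
    unfolding W_def Hint[OF sub[OF b] V(3)] ends[OF b] e0[OF b] e1[OF b] by simp
  have inner: "r b t \<notin> V" if b: "b \<in> \<B>" and t: "t \<in> {0<..<1}" for b t
  proof
    assume "r b t \<in> V"
    moreover have "r b t \<in> piece b" unfolding im[OF b, symmetric] using t by auto
    ultimately have "r b t \<in> {r b 0, r b 1}" using ends[OF b] by blast
    then show False using inj_onD[OF chart_inj[OF cr[OF b]], of t 0] inj_onD[OF chart_inj[OF cr[OF b]], of t 1] t by auto
  qed
  have inner': "r' b t \<notin> W" if b: "b \<in> \<B>" and t: "t \<in> {0<..<1}" for b t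
  proof
    assume "r' b t \<in> W"
    moreover have "r' b t \<in> H ` piece b" unfolding im'[OF b, symmetric] using t by auto
    ultimately have "r' b t \<in> {r' b 0, r' b 1}" using ends'[OF b] by blast
    then show False using inj_onD[OF chart_inj[OF cr'[OF b]], of t 0] inj_onD[OF chart_inj[OF cr'[OF b]], of t 1] t by auto
  qed
  have cov: "\<sigma> = (\<Union>b\<in>\<B>. r b ` {0..1})" using netD(4)[OF N] im by simp
  have cov': "\<tau> = (\<Union>b\<in>\<B>. r' b ` {0..1})"
  proof -
    have "(\<Union>b\<in>\<B>. r' b ` {0..1}) = (\<Union>b\<in>\<B>. H ` piece b)" using im' by simp
    also have "\<dots> = H ` (\<Union> (piece ` \<B>))" by blast
    also have "\<dots> = \<tau>" unfolding netD(4)[OF N, symmetric] by (rule HK(1))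
    finally show ?thesis ..
  qed
  obtain \<L> where L: "finite \<L>" "\<forall>(a, b)\<in>\<L>. a \<noteq> 0"
    "\<forall>x\<in>\<sigma>. \<forall>y\<in>\<sigma>. same_side \<L> x y \<longrightarrow> (\<exists>b\<in>\<B>. x \<in> piece b \<and> y \<in> piece b)" using net_lines[OF N] .
  obtain \<L>' where L': "finite \<L>'" "\<forall>(a, b)\<in>\<L>'. a \<noteq> 0"
    "\<forall>x\<in>\<tau>. \<forall>y\<in>\<tau>. same_side \<L>' x y \<longrightarrow> (\<exists>b\<in>\<B>'. x \<in> piece b \<and> y \<in> piece b)" using net_lines[OF N'] .
  have charted: "charted_set \<sigma> ((\<lambda>b. (a b, c b, r b)) ` \<B>) \<L>"
  proof (rule charted_set_of_family[OF UPIC_compact_plane_set[OF S] netD(1)[OF N] cr cov meet inner L(1,2)])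
    fix x y assume "x \<in> \<sigma>" "y \<in> \<sigma>" "same_side \<L> x y"
    then obtain b where "b \<in> \<B>" "x \<in> piece b" "y \<in> piece b" using L(3) by blast
    then show "\<exists>b\<in>\<B>. x \<in> r b ` {0..1} \<and> y \<in> r b ` {0..1}" using im by blast
  qed
  have charted': "charted_set \<tau> ((\<lambda>b. (a' b, c' b, r' b)) ` \<B>) \<L>'"
  proof (rule charted_set_of_family[OF UPIC_compact_plane_set[OF T] netD(1)[OF N] cr' cov' meet' inner' L'(1,2)])
    fix x y assume "x \<in> \<tau>" "y \<in> \<tau>" "same_side \<L>' x y"
    then obtain b' where b': "b' \<in> \<B>'" "x \<in> piece b'" "y \<in> piece b'" using L'(3) by blast
    have "V = K ` W"
    proof -
      have "K ` H ` V = V" using HK(3) V(3) by (force simp: image_image)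
      then show ?thesis by (simp add: W_def)
    qed
    with homeomorphism_maps_pieces[OF N' N homeomorphism_symD[OF H] _ b'(1)]
    obtain b where b: "b \<in> \<B>" "K ` piece b' = piece b" by blast
    have "H ` K ` piece b' = piece b'"
      using HK(4) piece_subset_net[OF N' b'(1)] by (force simp: image_image)
    then have "piece b' = r' b ` {0..1}" unfolding b(2) im'[OF b(1)] by simp
    then show "\<exists>b\<in>\<B>. x \<in> r' b ` {0..1} \<and> y \<in> r' b ` {0..1}" using b(1) b'(2,3) by blast
  qed
  have r\<sigma>: "r b t \<in> \<sigma>" if "b \<in> \<B>" "t \<in> {0..1}" for b t using sub[OF that(1)] im[OF that(1)] that(2) by blast
  have Ke: "K (r' b 0) = r b 0" "K (r' b 1) = r b 1" if "b \<in> \<B>" for b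
    using HK(3)[OF r\<sigma>[OF that]] e0[OF that] e1[OF that] by auto
  obtain k where k: "\<And>b t. b \<in> \<B> \<Longrightarrow> t \<in> {0..1} \<Longrightarrow> k (r' b t) = r b t"
    using ex_piecewise_map[of \<B> r' W K r] chart_inj[OF cr'] meet' inner' Ke by blast
  obtain h where h: "\<And>b t. b \<in> \<B> \<Longrightarrow> t \<in> {0..1} \<Longrightarrow> h (r b t) = r' b t"
    using ex_piecewise_map[of \<B> r V H r', OF chart_inj[OF cr] meet inner e0[symmetric] e1[symmetric]] by blast
  show ?thesis
  proof (rule AC_isomorphic_if_chart_bijection[OF charted charted', of k h])
    show "\<exists>a1 c1 r1. (a1, c1, r1) \<in> (\<lambda>b. (a b, c b, r b)) ` \<B> \<and> (\<forall>t\<in>{0..1}. k (r2 t) = r1 t)"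
      if "(a2, c2, r2) \<in> (\<lambda>b. (a' b, c' b, r' b)) ` \<B>" for a2 c2 r2
    proof -
      from that obtain b where "b \<in> \<B>" "r2 = r' b" by blast
      with k show ?thesis by (intro exI[of _ "a b"] exI[of _ "c b"] exI[of _ "r b"]) auto
    qed
    show "\<exists>a1 c1 r1. (a1, c1, r1) \<in> (\<lambda>b. (a' b, c' b, r' b)) ` \<B> \<and> (\<forall>t\<in>{0..1}. h (r2 t) = r1 t)"
      if "(a2, c2, r2) \<in> (\<lambda>b. (a b, c b, r b)) ` \<B>" for a2 c2 r2
    proof -
      from that obtain b where "b \<in> \<B>" "r2 = r b" by blast
      with h show ?thesis by (intro exI[of _ "a' b"] exI[of _ "c' b"] exI[of _ "r' b"]) auto
    qed
    show "h z \<in> \<tau> \<and> k (h z) = z" if z: "z \<in> \<sigma>" for z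
    proof -
      have "z \<in> (\<Union>b\<in>\<B>. r b ` {0..1})" using z cov by simp
      then obtain b t where bt: "b \<in> \<B>" "t \<in> {0..1}" "z = r b t" by blast
      have "r' b t \<in> (\<Union>b\<in>\<B>. r' b ` {0..1})" using bt by blast
      then have "r' b t \<in> \<tau>" using cov' by simp
      then show ?thesis using h[OF bt(1,2)] k[OF bt(1,2)] bt(3) by simp
    qed
    show "k z \<in> \<sigma> \<and> h (k z) = z" if z: "z \<in> \<tau>" for z
    proof -
      have "z \<in> (\<Union>b\<in>\<B>. r' b ` {0..1})" using z cov' by simp
      then obtain b t where bt: "b \<in> \<B>" "t \<in> {0..1}" "z = r' b t" by blast
      then show ?thesis using h[OF bt(1,2)] k[OF bt(1,2)] r\<sigma>[OF bt(1,2)] by simp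
    qed
  qed
qed

theorem theorem8:
  fixes \<sigma> \<tau> :: "complex set"
  assumes "\<sigma> \<in> UPIC" and "\<tau> \<in> UPIC"
  shows "AC_isomorphic \<sigma> \<tau> \<longleftrightarrow> \<sigma> homeomorphic \<tau>"
proof
  show "AC_isomorphic \<sigma> \<tau> \<Longrightarrow> \<sigma> homeomorphic \<tau>"
    using UPIC_compact_plane_set[OF assms(1)] UPIC_compact_plane_set[OF assms(2)]
    by (rule compact_homeomorphic_if_AC_isomorphic)
  show "\<sigma> homeomorphic \<tau> \<Longrightarrow> AC_isomorphic \<sigma> \<tau>"
    by (rule UPIC_AC_isomorphic_if_homeomorphic[OF assms])
qed

end
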